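(* The global surface area maximizer in $\mathcal{I}_8$ is not a member of $\mathcal{M}_8$; that is, if $P\in\mathcal{I}_8$ satisfies $S(P)=\max_{Q\in\mathcal{I}_8}S(Q)$, then $P\notin\mathcal{M}_8$.
   Context: $\mathbb{S}^2$ is the unit sphere in $\mathbb{R}^3$. For an integer $K\ge 4$, $\mathcal{I}_K$ denotes the set of all convex polytopes in $\mathbb{R}^3$ with at most $K$ distinct vertices, all chosen from $\mathbb{S}^2$. $\mathcal{M}_K\subset\mathcal{I}_K$ denotes the subset of polytopes whose facets are pairwise congruent isosceles triangles or pairwise congruent equilateral triangles. $S(P)$ denotes the surface area of $P$. *)

theory Defs
  imports "HOL-Analysis.Analysis"
begin

definition dist_preserving :: "('a::metric_space \<Rightarrow> 'b::metric_space) \<Rightarrow> bool" where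
  "dist_preserving f \<longleftrightarrow> (\<forall>x y. dist (f x) (f y) = dist x y)"

definition congruent_sets :: "(real^3) set \<Rightarrow> (real^3) set \<Rightarrow> bool" where
  "congruent_sets A B \<longleftrightarrow> (\<exists>f. dist_preserving f \<and> f ` A = B)"

definition isosceles_triangle :: "(real^3) set \<Rightarrow> bool" where
  "isosceles_triangle T \<longleftrightarrow>
     (\<exists>a b c. \<not> collinear {a, b, c} \<and> T = convex hull {a, b, c} \<and> dist a b = dist a c)"

definition equilateral_triangle :: "(real^3) set \<Rightarrow> bool" where
  "equilateral_triangle T \<longleftrightarrow>
     (\<exists>a b c. \<not> collinear {a, b, c} \<and> T = convex hull {a, b, c} \<and>
        dist a b = dist a c \<and> dist a b = dist b c)"

(* Two-dimensional Lebesgue measure of a subset of a plane in space, read off in Cartesian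
   coordinates of that plane.  The value is independent of the chosen coordinates, see
   planar_area_eq below; it is unspecified for sets that are not contained in a plane. *)
definition planar_area :: "(real^3) set \<Rightarrow> real" where
  "planar_area F =
     measure lebesgue ((SOME f :: real^2 \<Rightarrow> real^3. dist_preserving f \<and> F \<subseteq> range f) -` F)"

(* A polygon lying in a plane is regarded as a degenerate polyhedron with two coinciding facets,
   so both of its sides count; this is the continuous extension of the surface area of
   full-dimensional polytopes.  Polytopes of dimension at most 1 get surface area 0. *)
definition surface_area :: "(real^3) set \<Rightarrow> real" where
  "surface_area P =
     (if aff_dim P = 2 then 2 * planar_area P else (\<Sum>F\<in>{F. F facet_of P}. planar_area F))"

definition vertices :: "(real^3) set \<Rightarrow> (real^3) set" where
  "vertices P = {v. v extreme_point_of P}"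

definition inscribed_polytopes :: "nat \<Rightarrow> (real^3) set set" where
  "inscribed_polytopes K =
     {P. polytope P \<and> card (vertices P) \<le> K \<and> vertices P \<subseteq> sphere 0 1}"

definition monohedral_isosceles :: "nat \<Rightarrow> (real^3) set set" where
  "monohedral_isosceles K =
     {P \<in> inscribed_polytopes K.
        (\<forall>F G. F facet_of P \<and> G facet_of P \<longrightarrow> congruent_sets F G) \<and>
        ((\<forall>F. F facet_of P \<longrightarrow> isosceles_triangle F) \<or>
         (\<forall>F. F facet_of P \<longrightarrow> equilateral_triangle F))}"

lemma dist_preserving_linear:
  fixes f :: "'a::euclidean_space \<Rightarrow> 'b::euclidean_space"
  assumes "dist_preserving f"
  shows "linear (\<lambda>x. f x - f 0)"
proof -
  define l where "l x = f x - f 0" for x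
  have d: "norm (l x - l y) = norm (x - y)" for x y
    using assms by (simp add: dist_preserving_def l_def dist_norm)
  have n: "norm (l x) = norm x" for x
    using d[of x 0] by (simp add: l_def)
  have i: "l x \<bullet> l y = x \<bullet> y" for x y
    using d[of x y] n[of x] n[of y] by (simp add: norm_eq_sqrt_inner inner_diff inner_commute)
  have "l (x + y) = l x + l y" for x y
  proof -
    have "(l (x + y) - l x - l y) \<bullet> (l (x + y) - l x - l y) = 0"
      by (simp add: inner_diff i) (simp add: algebra_simps inner_commute)
    then have "l (x + y) - l x - l y = 0" by (simp only: inner_eq_zero_iff)
    then show ?thesis by (simp add: algebra_simps)
  qed
  moreover have "l (c *\<^sub>R x) = c *\<^sub>R l x" for c x
  proof -
    have "(l (c *\<^sub>R x) - c *\<^sub>R l x) \<bullet> (l (c *\<^sub>R x) - c *\<^sub>R l x) = 0"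
      by (simp add: inner_diff i)
    then show ?thesis by simp
  qed
  ultimately have "linear l" by (intro linearI)
  then show ?thesis unfolding l_def .
qed

lemma dist_preserving_affine_vimage:
  fixes f g :: "real^2 \<Rightarrow> real^3"
  assumes f: "dist_preserving f" and g: "dist_preserving g"
  shows "affine (f -` range g)"
proof -
  define k where "k x = f x - f 0" for x
  define l where "l x = g x - g 0" for x
  have k: "linear k" unfolding k_def by (rule dist_preserving_linear[OF f])
  have l: "linear l" unfolding l_def by (rule dist_preserving_linear[OF g])
  show ?thesis unfolding affine_def
  proof (intro ballI allI impI)
    fix x y and u v :: real
    assume "x \<in> f -` range g" "y \<in> f -` range g" and uv: "u + v = 1"
    then obtain x' y' where x: "f x = g x'" and y: "f y = g y'" by auto
    have aff: "w = u *\<^sub>R w + v *\<^sub>R w" for w :: "real^3"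
      using uv by (metis scaleR_add_left scaleR_one)
    have "f (u *\<^sub>R x + v *\<^sub>R y) = u *\<^sub>R k x + v *\<^sub>R k y + f 0"
      using linear_add[OF k, of "u *\<^sub>R x" "v *\<^sub>R y"] linear_cmul[OF k, of u x]
        linear_cmul[OF k, of v y]
      by (simp add: k_def[of "u *\<^sub>R x + v *\<^sub>R y"] eq_diff_eq diff_eq_eq)
    also have "\<dots> = u *\<^sub>R f x + v *\<^sub>R f y + (f 0 - (u *\<^sub>R f 0 + v *\<^sub>R f 0))"
      by (simp add: k_def scaleR_diff_right)
    also have "\<dots> = u *\<^sub>R f x + v *\<^sub>R f y"
      by (simp flip: aff)
    finally have fe: "f (u *\<^sub>R x + v *\<^sub>R y) = u *\<^sub>R f x + v *\<^sub>R f y" .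
    have "g (u *\<^sub>R x' + v *\<^sub>R y') = u *\<^sub>R l x' + v *\<^sub>R l y' + g 0"
      using linear_add[OF l, of "u *\<^sub>R x'" "v *\<^sub>R y'"] linear_cmul[OF l, of u x']
        linear_cmul[OF l, of v y']
      by (simp add: l_def[of "u *\<^sub>R x' + v *\<^sub>R y'"] eq_diff_eq diff_eq_eq)
    also have "\<dots> = u *\<^sub>R g x' + v *\<^sub>R g y' + (g 0 - (u *\<^sub>R g 0 + v *\<^sub>R g 0))"
      by (simp add: l_def scaleR_diff_right)
    also have "\<dots> = u *\<^sub>R g x' + v *\<^sub>R g y'"
      by (simp flip: aff)
    finally have ge: "g (u *\<^sub>R x' + v *\<^sub>R y') = u *\<^sub>R g x' + v *\<^sub>R g y'" .
    have "f (u *\<^sub>R x + v *\<^sub>R y) = g (u *\<^sub>R x' + v *\<^sub>R y')"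
      by (simp add: fe ge x y)
    then show "u *\<^sub>R x + v *\<^sub>R y \<in> f -` range g" by auto
  qed
qed

lemma measure_orthogonal_transformation_image:
  fixes l :: "real^2 \<Rightarrow> real^2"
  assumes l: "orthogonal_transformation l"
  shows "measure lebesgue (l ` A) = measure lebesgue A"
proof (cases "A \<in> lmeasurable")
  case True
  then show ?thesis by (rule measure_orthogonal_image[OF l])
next
  case False
  have zero: "measure lebesgue B = 0" if "B \<notin> lmeasurable" for B :: "(real^2) set"
  proof (cases "B \<in> sets lebesgue")
    case True
    with that have "emeasure lebesgue B = top"
      by (metis fmeasurableI top.not_eq_extremum infinity_ennreal_def)
    then show ?thesis by (simp only: Sigma_Algebra.measure_def enn2real_top)
  next
    case False
    then show ?thesis by (rule measure_notin_sets)
  qed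
  have "inv l ` l ` A = A"
    using orthogonal_transformation_inj[OF l] by (simp add: image_inv_f_f)
  then have "l ` A \<notin> lmeasurable"
    using False measurable_orthogonal_image[OF orthogonal_transformation_inv[OF l]] by metis
  then show ?thesis using False zero by simp
qed

lemma planar_area_eq_aux:
  fixes f g :: "real^2 \<Rightarrow> real^3"
  assumes f: "dist_preserving f" "F \<subseteq> range f" and g: "dist_preserving g" "F \<subseteq> range g"
    and full: "affine hull (f -` F) = UNIV"
  shows "measure lebesgue (f -` F) = measure lebesgue (g -` F)"
proof -
  have "f -` F \<subseteq> f -` range g" using g(2) by auto
  then have "f -` range g = UNIV"
    using full hull_minimal[of "f -` F" "f -` range g" affine]
      dist_preserving_affine_vimage[OF f(1) g(1)] by blast
  then have "\<forall>x. \<exists>y. g y = f x" by (metis UNIV_I vimageE rangeE)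
  then obtain h where h: "\<And>x. g (h x) = f x" by metis
  have inj: "x = y" if "g x = g y" for x y
    using that g(1) by (metis dist_preserving_def dist_eq_0_iff)
  have dh: "dist (h x) (h y) = dist x y" for x y
    using f(1) g(1) h by (metis dist_preserving_def)
  define l where "l x = h x - h 0" for x
  have ot: "orthogonal_transformation l"
    unfolding orthogonal_transformation_isometry using dh by (simp add: l_def dist_norm)
  have "g -` F = h ` (f -` F)"
  proof
    show "h ` (f -` F) \<subseteq> g -` F" using h by auto
    show "g -` F \<subseteq> h ` (f -` F)"
    proof
      fix y assume y: "y \<in> g -` F"
      then obtain x where x: "g y = f x" using f(2) by auto
      then have "y = h x" using inj h by metis
      then show "y \<in> h ` (f -` F)" using x y by auto
    qed
  qed
  also have "h ` (f -` F) = (+) (h 0) ` (l ` (f -` F))"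
    by (simp add: image_image l_def)
  finally show ?thesis
    by (simp add: measure_translation measure_orthogonal_transformation_image[OF ot])
qed

lemma planar_area_eq:
  fixes f :: "real^2 \<Rightarrow> real^3"
  assumes f: "dist_preserving f" "F \<subseteq> range f"
  shows "planar_area F = measure lebesgue (f -` F)"
proof -
  define g where "g = (SOME f :: real^2 \<Rightarrow> real^3. dist_preserving f \<and> F \<subseteq> range f)"
  have g: "dist_preserving g" "F \<subseteq> range g"
    using someI[of "\<lambda>f. dist_preserving f \<and> F \<subseteq> range f" f] f unfolding g_def by auto
  have zero: "measure lebesgue A = 0" if "affine hull A \<noteq> UNIV" for A :: "(real^2) set"
  proof -
    have "interior (convex hull A) = {}"
      using that affine_hull_nonempty_interior[of "convex hull A"] by auto
    then have "negligible (convex hull A)"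
      by (simp add: negligible_convex_interior)
    then show ?thesis
      by (metis hull_subset negligible_imp_measure0 negligible_subset)
  qed
  have "measure lebesgue (g -` F) = measure lebesgue (f -` F)"
    using planar_area_eq_aux[OF f g] planar_area_eq_aux[OF g f] zero by metis
  then show ?thesis by (simp add: planar_area_def g_def)
qed

end

theory Submission
  imports Defs
begin

text \<open>The competitor is the cube, whose surface area is \<open>8\<close>. Let \<open>P\<close> be a full-dimensional member of
  the family with \<open>V \<le> 8\<close> vertices and \<open>N\<close> facets. Its facets have the same circumradius, hence the
  same distance from the origin, and comparing solid angles and volumes of the cones over the facets shows
  that the origin is an interior point. The cones over the facets therefore tile space, and so do, at
  every vertex \<open>v\<close>, the wedges along the line through the origin and \<open>v\<close>. Let \<open>\<alpha>\<close> be the wedge angle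
  at the apex and \<open>\<beta>\<close> the one at the base vertices, as fractions of a full turn. Girard's theorem and
  summation over all vertices give \<open>N = 2 * V - 4\<close> and \<open>\<alpha> + 2 * \<beta> = 2 / N + 1 / 2\<close>.

  At each vertex \<open>k * \<alpha> + m * \<beta> = 1\<close>, where \<open>m\<close> is even since every base edge lies in exactly
  two facets. The average of \<open>k\<close> is \<open>N / V\<close> and that of \<open>m\<close> is twice as large, so some vertex has
  \<open>2 * k > m\<close> and some vertex has \<open>2 * k < m\<close>, unless \<open>N = 4\<close>. This leaves only \<open>\<beta> = 1 / 4\<close>,
  \<open>\<alpha> = 2 / N\<close>, the triangle of a regular bipyramid, and \<open>N = 12\<close>, \<open>\<alpha> = 1 / 3\<close>, \<open>\<beta> = 1 / 6\<close>,
  which is half a face of the cube and would force coplanar facets. For equilateral facets the base is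
  ambiguous, but then the number of facets at each vertex is \<open>1 / \<alpha>\<close>, so \<open>N\<close> is \<open>4\<close> or \<open>8\<close>. In the
  surviving cases the surface area is less than \<open>8\<close>.\<close>

section \<open>Solid angles\<close>

text \<open>The incidence counts come from measure alone: each is an equation saying that finitely
  many cones fill space up to null sets, around the origin, along the line through a vertex, or
  along the line through the midpoint of an edge. This is why solid angles are Lebesgue measures
  here and null overlaps are ignored throughout. The obstacle is that nothing places the origin
  inside \<open>P\<close> beforehand: an inscribed polytope may lie in one half of the ball, and
  then cones over different facets overlap. Congruence helps because corners on the unit sphere turn
  equal edge lengths into equal Gram matrices, so two facets differ by an orthogonal map, which
  fixes the origin. The final estimate has little room. With \<open>p\<close> and \<open>q\<close>
  the cosines of the leg and base arcs, the area is
  \<open>N * sqrt ((1 - q) * (3 - 4 * p + q)) / 2\<close>; the hexagonal bipyramid gives half the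
  square root of 252, the cube half that of 256.\<close>

lemma convex_sets_lebesgue:
  fixes C :: "'a::euclidean_space set"
  assumes "convex C"
  shows "C \<in> sets lebesgue"
proof -
  have "C = (\<Union>n::nat. C \<inter> ball 0 (real n))"
    using reals_Archimedean2 by (fastforce simp only: set_eq_iff UN_iff Int_iff mem_ball_0 UNIV_I)
  moreover have "C \<inter> ball 0 (real n) \<in> sets lebesgue" for n
    using assms by (intro fmeasurableD measurable_convex) (auto intro: convex_Int bounded_Int)
  then have "(\<Union>n::nat. C \<inter> ball 0 (real n)) \<in> sets lebesgue"
    by (intro sets.countable_UN) auto
  ultimately show ?thesis by simp
qed

text \<open>The measure is taken inside the unit ball and normalised so that all of space gets 1.
  For a cone with apex 0 this is its share of the unit sphere, obtained without a surface
  measure.\<close>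

definition solid_angle :: "'a::euclidean_space set \<Rightarrow> real" where
  "solid_angle X = measure lebesgue (X \<inter> ball 0 1) / measure lebesgue (ball (0::'a) 1)"

lemma measure_unit_ball_pos: "0 < measure lebesgue (ball (0::'a::euclidean_space) 1)"
  by (simp add: content_ball_pos)

lemma lmeasurable_Int_ball:
  "X \<in> sets lebesgue \<Longrightarrow> X \<inter> ball (0::'a::euclidean_space) 1 \<in> lmeasurable"
  by (rule bounded_set_imp_lmeasurable) (simp_all add: bounded_Int sets.Int)

lemma solid_angle_UNIV [simp]: "solid_angle (UNIV::'a::euclidean_space set) = 1"
  using measure_unit_ball_pos[where 'a='a] by (simp add: solid_angle_def)

lemma solid_angle_nonneg: "0 \<le> solid_angle X"
  by (simp add: solid_angle_def)

text \<open>Inclusion is asked only up to a null set, so that coverings may miss the origin or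
  boundary planes.\<close>

lemma solid_angle_mono:
  assumes "X \<in> sets lebesgue" "Y \<in> sets lebesgue" "negligible (X - Y)"
  shows "solid_angle X \<le> solid_angle Y"
proof -
  have "measure lebesgue (X \<inter> ball 0 1) \<le> measure lebesgue ((Y \<inter> ball 0 1) \<union> (X - Y))"
  proof (rule measure_mono_fmeasurable)
    show "X \<inter> ball 0 1 \<in> sets lebesgue" using lmeasurable_Int_ball[OF assms(1)] by blast
    show "Y \<inter> ball 0 1 \<union> (X - Y) \<in> lmeasurable"
      by (rule fmeasurable.Un[OF lmeasurable_Int_ball[OF assms(2)] negligible_imp_measurable[OF assms(3)]])
  qed auto
  also have "\<dots> = measure lebesgue (Y \<inter> ball 0 1)"
  proof (rule measure_negligible_symdiff[OF lmeasurable_Int_ball[OF assms(2)]])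
    show "negligible (Y \<inter> ball 0 1 - (Y \<inter> ball 0 1 \<union> (X - Y)) \<union>
        (Y \<inter> ball 0 1 \<union> (X - Y) - Y \<inter> ball 0 1))"
      by (rule negligible_subset[OF assms(3)]) auto
  qed
  finally show ?thesis
    by (simp add: solid_angle_def divide_right_mono)
qed

lemma solid_angle_finite_Union:
  assumes "finite I" "\<And>i. i \<in> I \<Longrightarrow> C i \<in> sets lebesgue"
    and "\<And>i j. i \<in> I \<Longrightarrow> j \<in> I \<Longrightarrow> i \<noteq> j \<Longrightarrow> negligible (C i \<inter> C j)"
  shows "solid_angle (\<Union>i\<in>I. C i) = (\<Sum>i\<in>I. solid_angle (C i))"
proof -
  have "measure lebesgue (\<Union>i\<in>I. C i \<inter> ball 0 1) = (\<Sum>i\<in>I. measure lebesgue (C i \<inter> ball 0 1))"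
  proof (rule measure_negligible_finite_Union_image)
    show "pairwise (\<lambda>i j. negligible (C i \<inter> ball 0 1 \<inter> (C j \<inter> ball 0 1))) I"
      using assms(3) by (auto simp: pairwise_def intro: negligible_subset)
  qed (use assms in \<open>auto intro: lmeasurable_Int_ball\<close>)
  moreover have "(\<Union>i\<in>I. C i) \<inter> ball 0 1 = (\<Union>i\<in>I. C i \<inter> ball 0 1)" by auto
  ultimately show ?thesis
    unfolding solid_angle_def by (simp only: sum_divide_distrib)
qed

lemma solid_angle_Un:
  assumes "X \<in> sets lebesgue" "Y \<in> sets lebesgue" "negligible (X \<inter> Y)"
  shows "solid_angle (X \<union> Y) = solid_angle X + solid_angle Y"
proof -
  have "solid_angle (\<Union>b\<in>UNIV. if b then X else Y) = (\<Sum>b\<in>UNIV. solid_angle (if b then X else Y))"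
    by (rule solid_angle_finite_Union) (use assms in \<open>auto simp: Int_commute\<close>)
  then show ?thesis by (simp add: UNIV_bool Un_commute)
qed

lemma solid_angle_orthogonal_image:
  fixes X :: "(real^'n::{finite,wellorder}) set"
    and l :: "real^'n::{finite,wellorder} \<Rightarrow> real^'n::{finite,wellorder}"
  assumes "orthogonal_transformation l" "X \<in> sets lebesgue"
  shows "solid_angle (l ` X) = solid_angle X"
proof -
  have "l ` (X \<inter> ball 0 1) = l ` X \<inter> ball 0 1"
    by (auto simp: orthogonal_transformation_norm[OF assms(1)])
  then have "measure lebesgue (l ` X \<inter> ball 0 1) = measure lebesgue (X \<inter> ball 0 1)"
    by (metis measure_orthogonal_image[OF assms(1)] lmeasurable_Int_ball[OF assms(2)])
  then show ?thesis by (simp add: solid_angle_def)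
qed

lemma orthogonal_transformation_uminus: "orthogonal_transformation (uminus :: 'a::euclidean_space \<Rightarrow> 'a)"
  unfolding orthogonal_transformation_def by (simp add: linear_iff)

text \<open>The antipodal map exchanges the two closed half spaces, which overlap in a null
  hyperplane.\<close>

lemma solid_angle_halfspace:
  fixes n :: "real^'n::{finite,wellorder}"
  assumes "n \<noteq> 0"
  shows "solid_angle {x. n \<bullet> x \<ge> 0} = 1/2"
proof -
  have ms: "{x. n \<bullet> x \<ge> 0} \<in> sets lebesgue" "{x. n \<bullet> x \<le> 0} \<in> sets lebesgue"
    by (auto intro!: convex_sets_lebesgue simp: convex_halfspace_ge convex_halfspace_le)
  have "uminus ` {x. n \<bullet> x \<ge> 0} = {x. n \<bullet> x \<le> 0}"
  proof safe
    fix x assume "n \<bullet> x \<le> 0"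
    then show "x \<in> uminus ` {x. n \<bullet> x \<ge> 0}" by (intro image_eqI[of _ _ "-x"]) auto
  qed auto
  then have "solid_angle {x. n \<bullet> x \<le> 0} = solid_angle {x. n \<bullet> x \<ge> 0}"
    using solid_angle_orthogonal_image[OF orthogonal_transformation_uminus ms(1)] by simp
  moreover have "{x. n \<bullet> x \<le> 0} \<union> {x. n \<bullet> x \<ge> 0} = UNIV" by auto
  moreover have "{x. n \<bullet> x \<le> 0} \<inter> {x. n \<bullet> x \<ge> 0} = {x. n \<bullet> x = 0}" by auto
  ultimately show ?thesis
    using solid_angle_Un[OF ms(2,1)] negligible_hyperplane[of n 0] assms by simp
qed

section \<open>Wedges\<close>

text \<open>A wedge along the third axis: the third coordinate is free, and the first two are
  constrained in polar form, so that a rotation about the axis just shifts the interval of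
  angles.\<close>

definition sector :: "real \<Rightarrow> real \<Rightarrow> (real^3) set" where
  "sector \<alpha> \<beta> = {x. \<exists>r \<phi>. 0 \<le> r \<and> \<alpha> \<le> \<phi> \<and> \<phi> \<le> \<beta> \<and> x$1 = r * cos \<phi> \<and> x$2 = r * sin \<phi>}"

lemma sectorE:
  assumes "x \<in> sector \<alpha> \<beta>"
  obtains r \<phi> where "0 \<le> r" "\<alpha> \<le> \<phi>" "\<phi> \<le> \<beta>" "x$1 = r * cos \<phi>" "x$2 = r * sin \<phi>"
  using assms by (simp add: sector_def) metis

lemma sectorI:
  "0 \<le> r \<Longrightarrow> \<alpha> \<le> \<phi> \<Longrightarrow> \<phi> \<le> \<beta> \<Longrightarrow> x$1 = r * cos \<phi> \<Longrightarrow> x$2 = r * sin \<phi> \<Longrightarrow>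
    x \<in> sector \<alpha> \<beta>"
  by (simp add: sector_def) metis

lemma sector_mono: "\<alpha>' \<le> \<alpha> \<Longrightarrow> \<beta> \<le> \<beta>' \<Longrightarrow> sector \<alpha> \<beta> \<subseteq> sector \<alpha>' \<beta>'"
  by (meson order_trans sectorE sectorI subsetI)

definition rot3 :: "real \<Rightarrow> real^3 \<Rightarrow> real^3" where
  "rot3 \<theta> x = vector [cos \<theta> * x$1 - sin \<theta> * x$2, sin \<theta> * x$1 + cos \<theta> * x$2, x$3]"

lemma rot3_nth [simp]:
  "rot3 \<theta> x $ 1 = cos \<theta> * x$1 - sin \<theta> * x$2"
  "rot3 \<theta> x $ 2 = sin \<theta> * x$1 + cos \<theta> * x$2"
  "rot3 \<theta> x $ 3 = x$3"
  by (simp_all add: rot3_def vector_3)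

lemma orthogonal_transformation_rot3: "orthogonal_transformation (rot3 \<theta>)"
  unfolding orthogonal_transformation_def
proof (intro conjI allI)
  show "linear (rot3 \<theta>)"
    by (simp add: linear_iff vec_eq_iff forall_3 algebra_simps)
  fix v w :: "real^3"
  have "rot3 \<theta> v \<bullet> rot3 \<theta> w = ((sin \<theta>)\<^sup>2 + (cos \<theta>)\<^sup>2) * (v$1 * w$1 + v$2 * w$2) + v$3 * w$3"
    unfolding inner_vec_def sum_3 rot3_nth inner_real_def power2_eq_square by algebra
  then show "rot3 \<theta> v \<bullet> rot3 \<theta> w = v \<bullet> w"
    by (simp add: inner_vec_def sum_3)
qed

lemma rot3_inverse: "rot3 \<theta> (rot3 (- \<theta>) x) = x"
proof -
  have *: "cos \<theta> * (cos \<theta> * z) + sin \<theta> * (sin \<theta> * z) = z" for z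
    using sin_cos_squared_add3[of \<theta>] by (metis distrib_right mult.assoc mult_1)
  show ?thesis
    by (simp add: vec_eq_iff forall_3 algebra_simps) (simp only: * simp_thms)
qed

lemma rot3_image_sector: "rot3 \<theta> ` sector \<alpha> \<beta> = sector (\<alpha> + \<theta>) (\<beta> + \<theta>)"
proof -
  have *: "rot3 \<theta> x \<in> sector (\<alpha> + \<theta>) (\<beta> + \<theta>)" if mem: "x \<in> sector \<alpha> \<beta>" for x \<theta> \<alpha> \<beta>
  proof -
    obtain r \<phi> where p: "0 \<le> r" "\<alpha> \<le> \<phi>" "\<phi> \<le> \<beta>"
      and x: "x$1 = r * cos \<phi>" "x$2 = r * sin \<phi>"
      by (rule sectorE[OF mem])
    have "rot3 \<theta> x $ 1 = r * cos (\<phi> + \<theta>)" "rot3 \<theta> x $ 2 = r * sin (\<phi> + \<theta>)"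
      by (simp_all add: x cos_add sin_add right_diff_distrib distrib_left)
    moreover have "\<alpha> + \<theta> \<le> \<phi> + \<theta>" "\<phi> + \<theta> \<le> \<beta> + \<theta>" using p by auto
    ultimately show ?thesis using p(1) by (intro sectorI)
  qed
  show ?thesis
  proof safe
    fix x assume "x \<in> sector (\<alpha> + \<theta>) (\<beta> + \<theta>)"
    from *[OF this, of "- \<theta>"] have "rot3 (-\<theta>) x \<in> sector \<alpha> \<beta>" by simp
    then show "x \<in> rot3 \<theta> ` sector \<alpha> \<beta>" using rot3_inverse by (metis image_eqI)
  qed (rule *)
qed

lemma polar_upper_half_plane:
  fixes x y :: real
  assumes "0 \<le> y"
  obtains r \<phi> where "0 \<le> r" "0 \<le> \<phi>" "\<phi> \<le> pi" "x = r * cos \<phi>" "y = r * sin \<phi>"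
proof (cases "x = 0 \<and> y = 0")
  case True
  then show ?thesis using that[of 0 0] by simp
next
  case False
  define r where "r = sqrt (x\<^sup>2 + y\<^sup>2)"
  have r: "r > 0" using False by (simp add: r_def sum_power2_gt_zero_iff)
  have r2: "r\<^sup>2 = x\<^sup>2 + y\<^sup>2" by (simp add: r_def)
  have "\<bar>x\<bar> \<le> r" unfolding r_def by simp
  then have b: "-1 \<le> x / r" "x / r \<le> 1" using r by (auto simp: field_simps)
  have "(r * sin (arccos (x / r)))\<^sup>2 = r\<^sup>2 - (r * cos (arccos (x / r)))\<^sup>2"
    by (simp add: power_mult_distrib sin_squared_eq algebra_simps)
  also have "\<dots> = y\<^sup>2" using b r r2 by simp
  finally have "y\<^sup>2 = (r * sin (arccos (x / r)))\<^sup>2" by simp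
  moreover have "0 \<le> sin (arccos (x / r))" using b by (simp add: arccos_lbound arccos_ubound sin_ge_zero)
  ultimately have "y = r * sin (arccos (x / r))"
    using assms r by (metis mult_nonneg_nonneg less_imp_le power2_eq_imp_eq)
  then show ?thesis
    using that[of r "arccos (x / r)"] r b by (simp add: arccos_lbound arccos_ubound)
qed

text \<open>In polar form \<open>x$1 * sin \<theta> - x$2 * cos \<theta>\<close> is
  \<open>r * sin (\<theta> - \<phi>)\<close>, whose sign decides whether
  \<open>\<phi> \<le> \<theta>\<close> for angles up to \<open>pi\<close>. The polar form serves
  additivity; the linear inequalities give convexity and measurability.\<close>

lemma sector_eq_wedge:
  assumes "0 < \<theta>" "\<theta> \<le> pi"
  shows "sector 0 \<theta> = {x. 0 \<le> x$2 \<and> x$2 * cos \<theta> \<le> x$1 * sin \<theta>}"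
proof safe
  fix x assume "x \<in> sector 0 \<theta>"
  then obtain r \<phi> where *: "0 \<le> r" "0 \<le> \<phi>" "\<phi> \<le> \<theta>" "x$1 = r * cos \<phi>" "x$2 = r * sin \<phi>"
    by (rule sectorE)
  show "0 \<le> x$2" using * assms by (simp add: sin_ge_zero)
  have "0 \<le> r * sin (\<theta> - \<phi>)" using * assms by (simp add: sin_ge_zero)
  then show "x$2 * cos \<theta> \<le> x$1 * sin \<theta>" using * by (simp add: sin_diff algebra_simps)
next
  fix x :: "real^3" assume x: "0 \<le> x$2" "x$2 * cos \<theta> \<le> x$1 * sin \<theta>"
  obtain r \<phi> where *: "0 \<le> r" "0 \<le> \<phi>" "\<phi> \<le> pi" "x$1 = r * cos \<phi>" "x$2 = r * sin \<phi>"
    using polar_upper_half_plane[OF x(1)] by metis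
  have "0 \<le> r * sin (\<theta> - \<phi>)" using x * by (simp add: sin_diff algebra_simps)
  then have "\<phi> \<le> \<theta> \<or> r = 0"
  proof (rule contrapos_pp)
    assume "\<not> (\<phi> \<le> \<theta> \<or> r = 0)"
    then have "r * sin (\<phi> - \<theta>) > 0" using * assms by (intro mult_pos_pos sin_gt_zero) auto
    then show "\<not> 0 \<le> r * sin (\<theta> - \<phi>)" by (simp add: sin_diff algebra_simps)
  qed
  then show "x \<in> sector 0 \<theta>"
  proof
    assume "r = 0" then show ?thesis using * assms by (intro sectorI[of 0 0 0]) auto
  qed (use * in \<open>auto intro: sectorI\<close>)
qed

lemma convex_sector:
  assumes "0 < \<theta>" "\<theta> \<le> pi"
  shows "convex (sector 0 \<theta>)"
proof -
  have "sector 0 \<theta> = {x. axis 2 1 \<bullet> x \<ge> 0} \<inter> {x. (cos \<theta> *\<^sub>R axis 2 1 - sin \<theta> *\<^sub>R axis 1 1) \<bullet> x \<le> 0}"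
    unfolding sector_eq_wedge[OF assms] by (auto simp: inner_axis' inner_diff_left algebra_simps)
  then show ?thesis by (simp add: convex_Int convex_halfspace_ge convex_halfspace_le)
qed

lemma solid_angle_sector_add:
  assumes "0 < s" "0 < t" "s + t \<le> pi"
  shows "solid_angle (sector 0 (s + t)) = solid_angle (sector 0 s) + solid_angle (sector 0 t)"
proof -
  have r: "rot3 s ` sector 0 t = sector s (s + t)"
    using rot3_image_sector[of s 0 t] by (simp add: add.commute)
  have ms: "sector 0 s \<in> sets lebesgue" "sector 0 t \<in> sets lebesgue" "sector s (s + t) \<in> sets lebesgue"
    using assms orthogonal_transformation_linear[OF orthogonal_transformation_rot3]
    by (auto intro!: convex_sets_lebesgue convex_sector convex_linear_image simp flip: r)
  \<comment> \<open>The functional \<open>x$1 * sin s - x$2 * cos s\<close> is nonnegative on the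
    first sector and nonpositive on the second, so they share only points of one plane.\<close>
  have "sector 0 s \<inter> sector s (s + t) \<subseteq> {x. (sin s *\<^sub>R axis 1 1 - cos s *\<^sub>R axis 2 1) \<bullet> x = 0}"
  proof safe
    fix x assume "x \<in> sector 0 s" "x \<in> sector s (s + t)"
    then obtain r \<phi> r' \<phi>' where *: "0 \<le> r" "0 \<le> \<phi>" "\<phi> \<le> s" "x$1 = r * cos \<phi>" "x$2 = r * sin \<phi>"
      "0 \<le> r'" "s \<le> \<phi>'" "\<phi>' \<le> s + t" "x$1 = r' * cos \<phi>'" "x$2 = r' * sin \<phi>'"
      by (elim sectorE) metis
    have "0 \<le> r * sin (s - \<phi>)" "0 \<le> r' * sin (\<phi>' - s)" using * assms by (simp_all add: sin_ge_zero)
    moreover have "r * sin (s - \<phi>) = x$1 * sin s - x$2 * cos s"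
      "r' * sin (\<phi>' - s) = x$2 * cos s - x$1 * sin s"
    proof -
      show "r * sin (s - \<phi>) = x$1 * sin s - x$2 * cos s"
        unfolding *(4,5) by (simp add: sin_diff algebra_simps)
      show "r' * sin (\<phi>' - s) = x$2 * cos s - x$1 * sin s"
        unfolding *(9,10) by (simp add: sin_diff algebra_simps)
    qed
    ultimately have "x$1 * sin s = x$2 * cos s" by linarith
    then show "(sin s *\<^sub>R axis 1 1 - cos s *\<^sub>R axis 2 1) \<bullet> x = 0"
      by (simp add: inner_axis' inner_diff_left mult.commute)
  qed
  moreover have "sin s *\<^sub>R axis 1 1 - cos s *\<^sub>R axis 2 1 \<noteq> (0::real^3)"
  proof
    assume "sin s *\<^sub>R axis 1 1 - cos s *\<^sub>R axis 2 1 = (0::real^3)"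
    then have "(sin s *\<^sub>R axis 1 1 - cos s *\<^sub>R axis 2 1 :: real^3) $ 1 = 0" by simp
    then have "sin s = 0" by (simp add: axis_def)
    then show False using sin_gt_zero[of s] assms by simp
  qed
  ultimately have "negligible (sector 0 s \<inter> sector s (s + t))"
    using negligible_hyperplane negligible_subset by blast
  moreover have "sector 0 (s + t) = sector 0 s \<union> sector s (s + t)"
  proof (intro equalityI subsetI)
    fix x assume "x \<in> sector 0 (s + t)"
    then obtain r \<phi> where "0 \<le> r" "0 \<le> \<phi>" "\<phi> \<le> s + t" "x$1 = r * cos \<phi>" "x$2 = r * sin \<phi>"
      by (rule sectorE)
    then show "x \<in> sector 0 s \<union> sector s (s + t)"
      using sectorI[of r 0 \<phi> s x] sectorI[of r s \<phi> "s + t" x] by force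
  next
    fix x assume "x \<in> sector 0 s \<union> sector s (s + t)"
    then show "x \<in> sector 0 (s + t)"
      using sector_mono[of 0 0 s "s + t"] sector_mono[of 0 s "s + t" "s + t"] assms by auto
  qed
  ultimately have "solid_angle (sector 0 (s + t)) = solid_angle (sector 0 s) + solid_angle (sector s (s + t))"
    using solid_angle_Un ms by metis
  then show ?thesis
    using solid_angle_orthogonal_image[OF orthogonal_transformation_rot3 ms(2)] r by metis
qed

lemma solid_angle_sector_mono:
  assumes "0 < s" "s \<le> t" "t \<le> pi"
  shows "solid_angle (sector 0 s) \<le> solid_angle (sector 0 t)"
proof (rule solid_angle_mono)
  have "sector 0 s - sector 0 t = {}" using sector_mono[of 0 0 s t] assms(2) by auto
  then show "negligible (sector 0 s - sector 0 t)" by simp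
qed (use assms in \<open>auto intro!: convex_sets_lebesgue convex_sector\<close>)

lemma solid_angle_sector_pi: "solid_angle (sector 0 pi) = 1/2"
proof -
  have "sector 0 pi = {x. axis 2 1 \<bullet> x \<ge> 0}"
    by (subst sector_eq_wedge) (auto simp: inner_axis')
  then show ?thesis using solid_angle_halfspace[of "axis 2 1 :: real^3"] by (simp add: axis_eq_0_iff)
qed

lemma solid_angle_sector_mult:
  assumes "0 < s" "real (Suc k) * s \<le> pi"
  shows "solid_angle (sector 0 (real (Suc k) * s)) = real (Suc k) * solid_angle (sector 0 s)"
  using assms(2)
proof (induction k)
  case (Suc k)
  have "real (Suc k) * s \<le> pi" using Suc.prems assms(1) by (simp add: algebra_simps)
  moreover have "solid_angle (sector 0 (real (Suc k) * s + s)) =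
      solid_angle (sector 0 (real (Suc k) * s)) + solid_angle (sector 0 s)"
    using Suc.prems assms(1) by (intro solid_angle_sector_add) (auto simp: algebra_simps add_pos_nonneg)
  ultimately show ?case using Suc.IH by (simp add: algebra_simps)
qed simp

text \<open>Additivity and monotonicity in the angle force linearity, which avoids polar coordinates.\<close>

lemma solid_angle_sector:
  assumes "0 < \<theta>" "\<theta> \<le> pi"
  shows "solid_angle (sector 0 \<theta>) = \<theta> / (2 * pi)"
proof -
  let ?m = "\<lambda>\<theta>. solid_angle (sector 0 \<theta>)"
  have unit: "?m (pi / real (Suc n)) = 1 / (2 * real (Suc n))" for n
  proof -
    have "real (Suc n) * (pi / real (Suc n)) = pi" by simp
    then have "1/2 = real (Suc n) * ?m (pi / real (Suc n))"
      using solid_angle_sector_mult[of "pi / real (Suc n)" n] solid_angle_sector_pi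
      by (metis divide_pos_pos of_nat_0_less_iff order_refl pi_gt_zero zero_less_Suc)
    then show ?thesis by (simp add: field_simps)
  qed
  have frac: "?m (real (Suc k) * (pi / real (Suc n))) = real (Suc k) / (2 * real (Suc n))" if "k \<le> n" for k n
  proof -
    have "real (Suc k) * (pi / real (Suc n)) \<le> pi" using that by (simp add: field_simps)
    then show ?thesis using solid_angle_sector_mult[of "pi / real (Suc n)" k] by (simp add: unit del: of_nat_Suc)
  qed
  have close: "\<bar>?m \<theta> - \<theta> / (2 * pi)\<bar> \<le> 1 / real (Suc n)" for n
  proof -
    \<comment> \<open>\<open>k\<close> rounds \<open>\<theta>\<close> up to the grid of multiples of
      \<open>pi / real (Suc n)\<close>, and monotonicity traps both quantities between neighbouring
      grid values. The value \<open>j = 0\<close> is treated apart because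
      \<open>solid_angle_sector_mono\<close> asks for a positive angle.\<close>
    define k where "k = nat \<lceil>\<theta> * real (Suc n) / pi\<rceil>"
    have pos: "0 < \<theta> * real (Suc n) / pi" using assms by simp
    have k: "real k - 1 < \<theta> * real (Suc n) / pi" "\<theta> * real (Suc n) / pi \<le> real k"
      using pos unfolding k_def by linarith+
    have "k > 0" using k(2) pos by (cases k) auto
    then obtain j where j: "k = Suc j" by (cases k) auto
    have "\<theta> * real (Suc n) / pi \<le> real (Suc n)"
    proof -
      have "\<theta> * real (Suc n) \<le> pi * real (Suc n)" using assms by (intro mult_right_mono) auto
      then show ?thesis by (simp add: field_simps)
    qed
    then have "k \<le> Suc n" unfolding k_def by (simp add: ceiling_le_iff nat_le_iff)
    then have jn: "j \<le> n" by (simp add: j)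
    have "\<theta> \<le> real (Suc j) * (pi / real (Suc n))"
      using k(2) j by (simp add: field_simps)
    moreover have "real (Suc j) * (pi / real (Suc n)) \<le> pi" using jn by (simp add: field_simps)
    ultimately have up: "?m \<theta> \<le> real (Suc j) / (2 * real (Suc n))"
      using solid_angle_sector_mono[OF assms(1)] frac[OF jn] by metis
    have lo: "real j / (2 * real (Suc n)) \<le> ?m \<theta>"
    proof (cases j)
      case 0 then show ?thesis by (simp add: solid_angle_nonneg)
    next
      case (Suc i)
      have "real (Suc i) * (pi / real (Suc n)) \<le> \<theta>"
        using k(1) j Suc by (simp add: field_simps)
      then have "?m (real (Suc i) * (pi / real (Suc n))) \<le> ?m \<theta>"
        using solid_angle_sector_mono assms by simp
      then show ?thesis using frac[of i n] jn Suc by simp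
    qed
    have "real j / (2 * real (Suc n)) \<le> \<theta> / (2 * pi)" "\<theta> / (2 * pi) \<le> real (Suc j) / (2 * real (Suc n))"
      using k j by (simp_all add: field_simps)
    then have "\<bar>?m \<theta> - \<theta> / (2 * pi)\<bar> \<le> real (Suc j) / (2 * real (Suc n)) - real j / (2 * real (Suc n))"
      using up lo by linarith
    also have "\<dots> = 1 / (2 * real (Suc n))" by (simp add: field_simps)
    also have "\<dots> \<le> 1 / real (Suc n)" by (simp add: field_simps)
    finally show ?thesis .
  qed
  show ?thesis
  proof (rule ccontr)
    assume "?m \<theta> \<noteq> \<theta> / (2 * pi)"
    then have "0 < \<bar>?m \<theta> - \<theta> / (2 * pi)\<bar>" by simp
    then obtain n where "1 / real (Suc n) < \<bar>?m \<theta> - \<theta> / (2 * pi)\<bar>"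
      using reals_Archimedean by (metis inverse_eq_divide)
    then show False using close[of n] by linarith
  qed
qed

text \<open>The coefficient of \<open>v\<close> is unrestricted, so this is a dihedral wedge whose
  edge is the whole line through \<open>v\<close>.\<close>

definition wedge :: "'a::real_vector \<Rightarrow> 'a \<Rightarrow> 'a \<Rightarrow> 'a set" where
  "wedge v a b = {s *\<^sub>R v + t *\<^sub>R a + u *\<^sub>R b | s t u. 0 \<le> t \<and> 0 \<le> u}"

lemma orthogonal_transformation_frame:
  fixes e1 e2 e3 :: "real^3"
  assumes "e1 \<bullet> e1 = 1" "e2 \<bullet> e2 = 1" "e3 \<bullet> e3 = 1" "e1 \<bullet> e2 = 0" "e1 \<bullet> e3 = 0" "e2 \<bullet> e3 = 0"
  shows "orthogonal_transformation (\<lambda>x::real^3. x$1 *\<^sub>R e1 + x$2 *\<^sub>R e2 + x$3 *\<^sub>R e3)"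
  unfolding orthogonal_transformation_def
proof (intro conjI allI)
  show "linear (\<lambda>x::real^3. x$1 *\<^sub>R e1 + x$2 *\<^sub>R e2 + x$3 *\<^sub>R e3)"
    by (simp add: linear_iff algebra_simps)
  fix v w :: "real^3"
  have "e2 \<bullet> e1 = 0" "e3 \<bullet> e1 = 0" "e3 \<bullet> e2 = 0" using assms by (simp_all add: inner_commute)
  then show "(v$1 *\<^sub>R e1 + v$2 *\<^sub>R e2 + v$3 *\<^sub>R e3) \<bullet> (w$1 *\<^sub>R e1 + w$2 *\<^sub>R e2 + w$3 *\<^sub>R e3) = v \<bullet> w"
    using assms by (simp add: inner_add_left inner_add_right inner_vec_def[of v w] sum_3)
qed

text \<open>\<open>A\<close>, \<open>B\<close>, \<open>C\<close> are the inner products of the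
  components of \<open>a\<close> and \<open>b\<close> orthogonal to \<open>v\<close>, and
  \<open>C\<^sup>2 < A * B\<close> says that these are not parallel. Gram-Schmidt on them gives an
  orthonormal frame with third axis \<open>v\<close> that carries a standard sector onto the wedge;
  its angle is the one between the two components.\<close>

theorem solid_angle_wedge:
  fixes v a b :: "real^3"
  assumes v: "v \<bullet> v = 1"
    and A: "A = a \<bullet> a - (v \<bullet> a)\<^sup>2" "A > 0" and B: "B = b \<bullet> b - (v \<bullet> b)\<^sup>2" "B > 0"
    and C: "C = a \<bullet> b - (v \<bullet> a) * (v \<bullet> b)" "C\<^sup>2 < A * B"
  shows "solid_angle (wedge v a b) = arccos (C / (sqrt A * sqrt B)) / (2 * pi)"
proof -
  define c where "c = C / (sqrt A * sqrt B)"
  have sA: "sqrt A > 0" "(sqrt A)\<^sup>2 = A" and sB: "sqrt B > 0" "(sqrt B)\<^sup>2 = B" using A B by auto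
  have c2: "c\<^sup>2 < 1" using C sA sB A(2) B(2) by (simp add: c_def power_divide power_mult_distrib)
  then have c1: "\<bar>c\<bar> < 1" by (simp add: abs_square_less_1)
  define s where "s = sqrt (1 - c\<^sup>2)"
  have s: "s > 0" "s\<^sup>2 = 1 - c\<^sup>2" using c2 by (auto simp: s_def)
  define \<theta> where "\<theta> = arccos c"
  have cos: "cos \<theta> = c" and sin: "sin \<theta> = s"
    using c1 by (auto simp: \<theta>_def s_def sin_arccos_abs)
  have \<theta>: "0 < \<theta>" "\<theta> \<le> pi"
    using c1 arccos_lt_bounded[of c] by (auto simp: \<theta>_def abs_less_iff)
  define a0 where "a0 = a - (v \<bullet> a) *\<^sub>R v"
  define b0 where "b0 = b - (v \<bullet> b) *\<^sub>R v"
  have ip: "a0 \<bullet> a0 = A" "b0 \<bullet> b0 = B" "a0 \<bullet> b0 = C" "a0 \<bullet> v = 0" "b0 \<bullet> v = 0"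
    using v A B C by (simp_all add: a0_def b0_def inner_diff power2_eq_square inner_commute algebra_simps)
  define e1 where "e1 = (1 / sqrt A) *\<^sub>R a0"
  define f where "f = (1 / sqrt B) *\<^sub>R b0"
  define e2 where "e2 = (1 / s) *\<^sub>R (f - c *\<^sub>R e1)"
  have ef: "e1 \<bullet> e1 = 1" "f \<bullet> f = 1" "e1 \<bullet> f = c" "e1 \<bullet> v = 0" "f \<bullet> v = 0"
    using sA sB ip by (simp_all add: e1_def f_def c_def power2_eq_square field_simps)
  have "(f - c *\<^sub>R e1) \<bullet> (f - c *\<^sub>R e1) = s\<^sup>2"
    using ef s by (simp add: inner_diff inner_commute power2_eq_square algebra_simps)
  moreover have "e2 \<bullet> e2 = (f - c *\<^sub>R e1) \<bullet> (f - c *\<^sub>R e1) / s\<^sup>2"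
    by (simp add: e2_def power2_eq_square)
  ultimately have "e2 \<bullet> e2 = 1" using s(1) by simp
  moreover have "e1 \<bullet> e2 = 0" "e2 \<bullet> v = 0"
    using ef s(1) by (simp_all add: e2_def inner_diff_left inner_diff_right)
  ultimately have e2: "e2 \<bullet> e2 = 1" "e1 \<bullet> e2 = 0" "e2 \<bullet> v = 0"
    by blast+
  define l where "l = (\<lambda>x::real^3. x$1 *\<^sub>R e1 + x$2 *\<^sub>R e2 + x$3 *\<^sub>R v)"
  have ot: "orthogonal_transformation l"
    unfolding l_def by (rule orthogonal_transformation_frame) (use ef e2 v in auto)
  have f: "f = c *\<^sub>R e1 + s *\<^sub>R e2" using s(1) by (simp add: e2_def)
  have a: "a = sqrt A *\<^sub>R e1 + (v \<bullet> a) *\<^sub>R v" using sA by (simp add: e1_def a0_def)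
  have b: "b = sqrt B *\<^sub>R f + (v \<bullet> b) *\<^sub>R v" using sB by (simp add: f_def b0_def)
  have "wedge v a b = l ` sector 0 \<theta>"
    unfolding sector_eq_wedge[OF \<theta>] cos sin
  proof (intro equalityI subsetI)
    fix x assume "x \<in> wedge v a b"
    then obtain r t u where x: "x = r *\<^sub>R v + t *\<^sub>R a + u *\<^sub>R b" and tu: "0 \<le> t" "0 \<le> u"
      unfolding wedge_def by blast
    define y :: "real^3" where "y = vector [t * sqrt A + u * sqrt B * c, u * sqrt B * s, r + t * (v \<bullet> a) + u * (v \<bullet> b)]"
    have "x = l y"
      unfolding x l_def y_def by (subst a, subst b, unfold f) (simp add: vector_3 algebra_simps)
    moreover have "0 \<le> y$2" "y$2 * c \<le> y$1 * s"
      using tu sA sB s by (simp_all add: y_def vector_3 algebra_simps)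
    ultimately show "x \<in> l ` {x. 0 \<le> x$2 \<and> x$2 * c \<le> x$1 * s}" by blast
  next
    fix x assume "x \<in> l ` {x. 0 \<le> x$2 \<and> x$2 * c \<le> x$1 * s}"
    then obtain y where x: "x = l y" and y: "0 \<le> y$2" "y$2 * c \<le> y$1 * s" by blast
    define u where "u = y$2 / (s * sqrt B)"
    define t where "t = (y$1 - y$2 * c / s) / sqrt A"
    have "0 \<le> u" "0 \<le> t" using y s sA sB by (simp_all add: u_def t_def field_simps)
    moreover have "x = (y$3 - t * (v \<bullet> a) - u * (v \<bullet> b)) *\<^sub>R v + t *\<^sub>R a + u *\<^sub>R b"
    proof -
      have y1: "y$1 = t * sqrt A + u * sqrt B * c" and y2: "y$2 = u * sqrt B * s"
        using s(1) sA(1) sB(1) by (simp_all add: u_def t_def)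
      have "t *\<^sub>R a + u *\<^sub>R b = y$1 *\<^sub>R e1 + y$2 *\<^sub>R e2 + (t * (v \<bullet> a) + u * (v \<bullet> b)) *\<^sub>R v"
        unfolding y1 y2 by (subst a, subst b, unfold f) (simp add: algebra_simps)
      then show ?thesis unfolding x l_def by (simp add: algebra_simps)
    qed
    ultimately show "x \<in> wedge v a b" unfolding wedge_def by blast
  qed
  moreover have "sector 0 \<theta> \<in> sets lebesgue" using convex_sets_lebesgue convex_sector[OF \<theta>] by blast
  ultimately show ?thesis
    using solid_angle_orthogonal_image[OF ot] solid_angle_sector[OF \<theta>] by (simp add: \<theta>_def c_def)
qed

section \<open>Facets seen from a point\<close>

text \<open>Far and near are read off along rays from the origin: a ray does not continue in
  \<open>P\<close> beyond a far facet, and has no earlier point in \<open>P\<close> before a near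
  one. This form needs no choice of normals and is the one that the overlap and covering arguments
  use.\<close>

definition far_facet :: "'a::euclidean_space set \<Rightarrow> 'a set \<Rightarrow> bool" where
  "far_facet P F \<longleftrightarrow> F facet_of P \<and> (\<forall>f\<in>F. \<forall>t. t *\<^sub>R f \<in> P \<longrightarrow> t \<le> 1)"

definition near_facet :: "'a::euclidean_space set \<Rightarrow> 'a set \<Rightarrow> bool" where
  "near_facet P F \<longleftrightarrow> F facet_of P \<and> (\<forall>f\<in>F. \<forall>t. t *\<^sub>R f \<in> P \<longrightarrow> 1 \<le> t)"

text \<open>The facet is cut out by a supporting hyperplane \<open>a \<bullet> x = b\<close>.
  Scaling a point of it by \<open>t\<close> scales the value by \<open>t\<close>, so the sign of
  \<open>b\<close> decides. If \<open>b\<close> were 0, this hyperplane would be the affine hull of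
  the facet by dimension and would contain the origin.\<close>

lemma facet_far_or_near:
  fixes P :: "'a::euclidean_space set"
  assumes P: "polytope P" "interior P \<noteq> {}" and F: "F facet_of P" and 0: "0 \<notin> affine hull F"
  shows "far_facet P F \<or> near_facet P F"
proof -
  have dim: "aff_dim P = DIM('a)" using P(2) by (simp add: aff_dim_nonempty_interior)
  have "F exposed_face_of P"
    using P(1) F exposed_face_of_polyhedron facet_of_imp_face_of polytope_imp_polyhedron by blast
  then obtain a b where ab: "P \<subseteq> {x. a \<bullet> x \<le> b}" "F = P \<inter> {x. a \<bullet> x = b}"
    unfolding exposed_face_of_def by blast
  have Fdim: "aff_dim F = DIM('a) - 1" "F \<noteq> {}" using F dim by (auto simp: facet_of_def)
  have "b \<noteq> 0"
  proof
    assume b: "b = 0"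
    show False
    proof (cases "a = 0")
      case True
      then have "F = P" using ab b by auto
      then show False using Fdim dim by simp
    next
      case False
      have "affine hull F = {x. a \<bullet> x = 0}"
      proof (rule affine_dim_equal)
        show "affine hull F \<subseteq> {x. a \<bullet> x = 0}"
          using ab b by (intro hull_minimal) (auto simp: affine_hyperplane)
        show "aff_dim (affine hull F) = aff_dim {x. a \<bullet> x = 0}"
          using Fdim False by (simp add: aff_dim_hyperplane)
      qed (use Fdim in \<open>auto simp: affine_hyperplane\<close>)
      then show False using 0 by simp
    qed
  qed
  have le: "t * b \<le> b" if "f \<in> F" "t *\<^sub>R f \<in> P" for f t
    using that ab by auto
  show ?thesis
  proof (cases "b > 0")
    case True
    then have "far_facet P F" unfolding far_facet_def using F le by (auto simp: mult_le_cancel_right1)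
    then show ?thesis ..
  next
    case False
    then have "b < 0" using \<open>b \<noteq> 0\<close> by simp
    then have "near_facet P F" unfolding near_facet_def using F le by (auto simp: mult_le_cancel_right1)
    then show ?thesis ..
  qed
qed

text \<open>Two distinct facets meet in a proper face of each, at least two dimensions below the
  space, so even the linear span of the intersection is a proper subspace.\<close>

lemma negligible_conic_hull_facet_Int:
  fixes P :: "'a::euclidean_space set"
  assumes "polytope P" "F facet_of P" "G facet_of P" "F \<noteq> G"
  shows "negligible (conic hull (F \<inter> G))"
proof (cases "F \<inter> G = {}")
  case False
  have c: "convex F" "convex P" using assms facet_of_imp_face_of face_of_imp_convex polytope_imp_convex by blast+
  have FG: "(F \<inter> G) face_of P" using assms c facet_of_imp_face_of face_of_Int by blast
  have "F \<inter> G \<noteq> F"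
  proof
    assume "F \<inter> G = F"
    then have "F \<subseteq> G" by auto
    then have "F face_of G" using assms facet_of_imp_face_of face_of_subset facet_of_imp_subset by blast
    moreover have "convex G" using assms facet_of_imp_face_of face_of_imp_convex polytope_imp_convex by blast
    ultimately have "aff_dim F < aff_dim G" using face_of_aff_dim_lt assms(4) by blast
    then show False using assms(2,3) by (simp add: facet_of_def)
  qed
  moreover have "(F \<inter> G) face_of F"
    using FG assms(2) facet_of_imp_subset face_of_subset by (metis inf_le1)
  ultimately have "aff_dim (F \<inter> G) < aff_dim F" using face_of_aff_dim_lt c by blast
  also have "aff_dim F = aff_dim P - 1" using assms(2) by (simp add: facet_of_def)
  also have "\<dots> \<le> DIM('a) - 1" using aff_dim_le_DIM[of P] by simp
  finally have lt: "aff_dim (F \<inter> G) < DIM('a) - 1" .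
  have "int (dim (F \<inter> G)) = aff_dim (insert 0 (F \<inter> G))"
    by (simp add: aff_dim_zero hull_inc dim_insert span_0)
  also have "\<dots> \<le> aff_dim (F \<inter> G) + 1" by (simp add: aff_dim_insert)
  finally have "dim (F \<inter> G) < DIM('a)" using lt DIM_positive[where 'a='a] by linarith
  then have "negligible (span (F \<inter> G))" by (intro negligible_lowdim) simp
  moreover have "conic hull (F \<inter> G) \<subseteq> span (F \<inter> G)"
    by (auto simp: conic_hull_explicit span_base span_scale)
  ultimately show ?thesis by (rule negligible_subset)
qed simp

text \<open>If a ray meets both facets, the far (or near) property of each bounds the ratio of the
  two hitting points from both sides by 1, so the ray passes through \<open>F \<inter> G\<close>.
  Facets of opposite kind are left out since one may lie behind the other.\<close>

lemma negligible_conic_hull_Int: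
  fixes P :: "'a::euclidean_space set"
  assumes P: "polytope P" and ne: "F \<noteq> G"
    and FG: "far_facet P F \<and> far_facet P G \<or> near_facet P F \<and> near_facet P G"
  shows "negligible (conic hull F \<inter> conic hull G)"
proof -
  have fac: "F facet_of P" "G facet_of P" using FG by (auto simp: far_facet_def near_facet_def)
  have sub: "F \<subseteq> P" "G \<subseteq> P" using fac facet_of_imp_subset by auto
  have "conic hull F \<inter> conic hull G \<subseteq> insert 0 (conic hull (F \<inter> G))"
  proof
    fix x assume "x \<in> conic hull F \<inter> conic hull G"
    then have "\<exists>c f. x = c *\<^sub>R f \<and> 0 \<le> c \<and> f \<in> F" "\<exists>d g. x = d *\<^sub>R g \<and> 0 \<le> d \<and> g \<in> G"
      by (auto simp: conic_hull_explicit)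
    then obtain c f d g where x: "x = c *\<^sub>R f" "x = d *\<^sub>R g" "0 \<le> c" "0 \<le> d" "f \<in> F" "g \<in> G"
      by blast
    show "x \<in> insert 0 (conic hull (F \<inter> G))"
    proof (cases "x = 0")
      case False
      then have cd: "c > 0" "d > 0" using x by (auto simp: less_le)
      have "(1 / c) *\<^sub>R (c *\<^sub>R f) = (1 / c) *\<^sub>R (d *\<^sub>R g)" "(1 / d) *\<^sub>R (d *\<^sub>R g) = (1 / d) *\<^sub>R (c *\<^sub>R f)"
        using x by simp_all
      then have f: "f = (d / c) *\<^sub>R g" and g: "g = (c / d) *\<^sub>R f"
        using cd by simp_all
      have "d / c \<le> 1 \<and> c / d \<le> 1 \<or> 1 \<le> d / c \<and> 1 \<le> c / d"
        using FG f g x(5,6) sub unfolding far_facet_def near_facet_def by (metis subsetD)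
      then have "c = d" using cd by (auto simp: field_simps)
      then have "f = g" using f cd by simp
      then show ?thesis using x by (auto simp: conic_hull_explicit)
    qed simp
  qed
  moreover have "negligible (insert 0 (conic hull (F \<inter> G)))"
    using negligible_conic_hull_facet_Int[OF P fac ne] by simp
  ultimately show ?thesis using negligible_subset by blast
qed

section \<open>Rays through a polytope and the tiling by cones over its facets\<close>

lemma frontier_polytope_facets:
  fixes P :: "'a::euclidean_space set"
  assumes "polytope P" "interior P \<noteq> {}"
  shows "frontier P = \<Union>{F. F facet_of P}"
  using assms rel_frontier_of_polyhedron[OF polytope_imp_polyhedron] rel_frontier_nonempty_interior by metis

text \<open>Following the ray outwards from \<open>z\<close> to the frontier leaves \<open>z\<close>
  as an earlier point in \<open>P\<close>, which no near facet allows.\<close>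

lemma far_facet_on_ray:
  fixes P :: "'a::euclidean_space set"
  assumes P: "polytope P" and z: "z \<in> interior P" "z \<noteq> 0"
    and fn: "\<And>F. F facet_of P \<Longrightarrow> far_facet P F \<or> near_facet P F"
  obtains F t where "far_facet P F" "1 < t" "t *\<^sub>R z \<in> F"
proof -
  obtain d where d: "0 < d" "z + d *\<^sub>R z \<in> frontier P"
    using ray_to_frontier[OF polytope_imp_bounded[OF P] z] by metis
  then obtain F where F: "F facet_of P" "(1 + d) *\<^sub>R z \<in> F"
    using frontier_polytope_facets[OF P] z(1) by (auto simp: algebra_simps)
  have "(1 / (1 + d)) *\<^sub>R ((1 + d) *\<^sub>R z) \<in> P" using d z(1) interior_subset by auto
  moreover have "1 / (1 + d) < 1" using d by simp
  ultimately have "\<not> near_facet P F" using F(2) unfolding near_facet_def by (meson not_less)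
  then show ?thesis using fn[OF F(1)] F(2) d(1) that[of F "1 + d"] by simp
qed

text \<open>Going from \<open>z\<close> back towards the origin, the ray leaves \<open>P\<close>
  before reaching 0, which is outside. Beyond the exit point lies \<open>z\<close>, which no far
  facet allows.\<close>

lemma near_facet_on_ray:
  fixes P :: "'a::euclidean_space set"
  assumes P: "polytope P" "0 \<notin> P" and z: "z \<in> interior P"
    and fn: "\<And>F. F facet_of P \<Longrightarrow> far_facet P F \<or> near_facet P F"
  obtains F t where "near_facet P F" "0 < t" "t < 1" "t *\<^sub>R z \<in> F"
proof -
  have z0: "z \<noteq> 0" using P(2) z interior_subset by blast
  obtain d where d: "0 < d" "z + d *\<^sub>R (- z) \<in> frontier P"
      "\<And>e. 0 \<le> e \<Longrightarrow> e < d \<Longrightarrow> z + e *\<^sub>R (- z) \<in> interior P"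
    using ray_to_frontier[OF polytope_imp_bounded[OF P(1)] z, of "- z"] z0 by (metis neg_equal_0_iff_equal)
  have "\<not> 1 < d" using d(3)[of 1] P(2) interior_subset by auto
  moreover have "d \<noteq> 1"
  proof
    assume "d = 1"
    then have "0 \<in> frontier P" using d(2) by simp
    then show False
      using P frontier_subset_closed compact_imp_closed polytope_imp_compact by blast
  qed
  ultimately have d1: "d < 1" by simp
  obtain F where F: "F facet_of P" "(1 - d) *\<^sub>R z \<in> F"
    using frontier_polytope_facets[OF P(1)] z(1) d(2) by (auto simp: algebra_simps)
  have "(1 / (1 - d)) *\<^sub>R ((1 - d) *\<^sub>R z) \<in> P" using d1 z(1) interior_subset by auto
  moreover have "1 / (1 - d) > 1" using d1 d(1) by (simp add: field_simps)
  ultimately have "\<not> far_facet P F" using F(2) unfolding far_facet_def by (meson not_less)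
  then show ?thesis using fn[OF F(1)] F(2) d(1) d1 that[of F "1 - d"] by simp
qed

lemma convex_facet: "convex P \<Longrightarrow> F facet_of P \<Longrightarrow> convex F"
  using facet_of_imp_face_of face_of_imp_convex by blast

lemma sets_lebesgue_conic_hull: "convex F \<Longrightarrow> conic hull F \<in> sets lebesgue"
  by (simp add: convex_conic_hull convex_sets_lebesgue)

lemma facet_subset_frontier:
  fixes P :: "'a::euclidean_space set"
  assumes "polytope P" "interior P \<noteq> {}" "F facet_of P"
  shows "F \<subseteq> frontier P"
  using frontier_polytope_facets[OF assms(1,2)] assms(3) by auto

text \<open>If \<open>P\<close> contained a point further out on the ray, the point of the facet
  would lie strictly between it and the interior point 0, hence in the interior.\<close>

lemma facet_far_if_interior_0:
  fixes P :: "'a::euclidean_space set"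
  assumes P: "polytope P" and 0: "0 \<in> interior P" and F: "F facet_of P"
  shows "far_facet P F"
  unfolding far_facet_def
proof (intro conjI ballI allI impI)
  fix f t assume f: "f \<in> F" and t: "t *\<^sub>R f \<in> P"
  show "t \<le> 1"
  proof (rule ccontr)
    assume "\<not> t \<le> 1"
    then have t1: "t > 1" by simp
    have "t *\<^sub>R f - (1 - 1/t) *\<^sub>R (t *\<^sub>R f - 0) \<in> interior P"
      using t1 0 t by (intro mem_interior_convex_shrink polytope_imp_convex P) auto
    moreover have "t *\<^sub>R f - (1 - 1/t) *\<^sub>R (t *\<^sub>R f - 0) = f" using t1 by (simp add: algebra_simps)
    ultimately have "f \<in> interior P" by simp
    moreover have "f \<in> frontier P" using facet_subset_frontier[OF P _ F] 0 f by blast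
    ultimately show False by (simp add: frontier_def)
  qed
qed (rule F)

lemma conic_hulls_of_facets_cover:
  fixes P :: "'a::euclidean_space set"
  assumes P: "polytope P" and 0: "0 \<in> interior P" and x: "x \<noteq> 0"
  obtains F where "F facet_of P" "x \<in> conic hull F"
proof -
  obtain d where d: "0 < d" "0 + d *\<^sub>R x \<in> frontier P"
    using ray_to_frontier[OF polytope_imp_bounded[OF P] 0 x] by metis
  then obtain F where F: "F facet_of P" "d *\<^sub>R x \<in> F"
    using frontier_polytope_facets[OF P] 0 by auto
  then have "(1/d) *\<^sub>R (d *\<^sub>R x) \<in> conic hull F" unfolding conic_hull_explicit using d(1) by fastforce
  then show ?thesis using that F d(1) by simp
qed

lemma sum_solid_angle_facets:
  fixes P :: "'a::euclidean_space set"
  assumes P: "polytope P" and 0: "0 \<in> interior P"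
  shows "(\<Sum>F\<in>{F. F facet_of P}. solid_angle (conic hull F)) = 1"
proof -
  let ?I = "{F. F facet_of P}"
  have "negligible (UNIV - (\<Union>F\<in>?I. conic hull F))"
  proof (rule negligible_subset)
    show "UNIV - (\<Union>F\<in>?I. conic hull F) \<subseteq> {0}"
      using conic_hulls_of_facets_cover[OF P 0] by blast
  qed simp
  moreover have fin: "finite ?I" by (rule finite_polytope_facets[OF P])
  moreover have ms: "conic hull F \<in> sets lebesgue" if "F \<in> ?I" for F
    using that convex_facet polytope_imp_convex[OF P] sets_lebesgue_conic_hull by blast
  ultimately have "solid_angle (UNIV::'a set) \<le> solid_angle (\<Union>F\<in>?I. conic hull F)"
    by (intro solid_angle_mono sets.finite_UN) auto
  moreover have "solid_angle (\<Union>F\<in>?I. conic hull F) \<le> solid_angle (UNIV::'a set)"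
    using fin ms by (intro solid_angle_mono sets.finite_UN) auto
  moreover have "solid_angle (\<Union>F\<in>?I. conic hull F) = (\<Sum>F\<in>?I. solid_angle (conic hull F))"
    using fin ms negligible_conic_hull_Int[OF P] facet_far_if_interior_0[OF P 0]
    by (intro solid_angle_finite_Union) auto
  ultimately show ?thesis by simp
qed

text \<open>This is what the cone over \<open>F\<close> looks like when one zooms in at a point
  \<open>v\<close> of \<open>F\<close>: directions along \<open>v\<close> are divided out. At a
  corner of a triangle it becomes a wedge, at the midpoint of an edge a half space.\<close>

definition line_cone :: "'a::real_vector \<Rightarrow> 'a set \<Rightarrow> 'a set" where
  "line_cone v F = {x. \<exists>s. x + s *\<^sub>R v \<in> conic hull F}"

lemma convex_line_cone:
  assumes "convex F"
  shows "convex (line_cone v F)"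
  unfolding convex_def line_cone_def
proof (intro ballI allI impI, elim CollectE exE, intro CollectI)
  fix x y and u w s t :: real
  assume "0 \<le> u" "0 \<le> w" "u + w = 1" "x + s *\<^sub>R v \<in> conic hull F" "y + t *\<^sub>R v \<in> conic hull F"
  then have "u *\<^sub>R (x + s *\<^sub>R v) + w *\<^sub>R (y + t *\<^sub>R v) \<in> conic hull F"
    using convex_conic_hull[OF assms] by (simp add: convex_def)
  then show "\<exists>s. u *\<^sub>R x + w *\<^sub>R y + s *\<^sub>R v \<in> conic hull F"
    by (intro exI[of _ "u * s + w * t"]) (simp add: algebra_simps)
qed

lemma conic_hull_add:
  assumes "convex F" "x \<in> conic hull F" "y \<in> conic hull F"
  shows "x + y \<in> conic hull F"
proof -
  have "2 *\<^sub>R ((1/2) *\<^sub>R x + (1/2) *\<^sub>R y) \<in> conic hull F"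
    using assms convex_conic_hull[OF assms(1)] conic_conic_hull[of F]
    by (intro conic_mul) (auto simp: convex_def)
  then show ?thesis by (simp add: algebra_simps)
qed

text \<open>A common point, moved by a large enough multiple of \<open>v\<close>, lies in both
  cones, and moving on along \<open>v\<close> stays there. So countably many integer translates of a
  null set cover the intersection.\<close>

lemma negligible_line_cone_Int:
  fixes F G :: "'a::euclidean_space set"
  assumes "convex F" "convex G" "v \<in> F" "v \<in> G" and N: "negligible (conic hull F \<inter> conic hull G)"
  shows "negligible (line_cone v F \<inter> line_cone v G)"
proof (rule negligible_subset)
  show "negligible (\<Union>n::nat. (+) (- (real n *\<^sub>R v)) ` (conic hull F \<inter> conic hull G))"
  proof (rule negligible_countable_Union)
    show "negligible S" if "S \<in> range (\<lambda>n::nat. (+) (- (real n *\<^sub>R v)) ` (conic hull F \<inter> conic hull G))" for S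
      using that negligible_translation[OF N] by blast
  qed simp
  show "line_cone v F \<inter> line_cone v G \<subseteq> (\<Union>n::nat. (+) (- (real n *\<^sub>R v)) ` (conic hull F \<inter> conic hull G))"
  proof
    fix x assume "x \<in> line_cone v F \<inter> line_cone v G"
    then obtain s t where st: "x + s *\<^sub>R v \<in> conic hull F" "x + t *\<^sub>R v \<in> conic hull G"
      by (auto simp: line_cone_def)
    obtain n :: nat where n: "max s t \<le> real n" using real_arch_simple by blast
    have *: "x + real n *\<^sub>R v \<in> conic hull H"
      if "convex H" "v \<in> H" "x + r *\<^sub>R v \<in> conic hull H" "r \<le> real n" for H r
    proof -
      have "(real n - r) *\<^sub>R v \<in> conic hull H"
        using that by (intro conic_mul[OF conic_conic_hull] hull_inc) auto
      then have "(x + r *\<^sub>R v) + (real n - r) *\<^sub>R v \<in> conic hull H"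
        using that conic_hull_add by blast
      then show ?thesis by (simp add: algebra_simps)
    qed
    have "x + real n *\<^sub>R v \<in> conic hull F \<inter> conic hull G"
      using *[OF assms(1,3) st(1)] *[OF assms(2,4) st(2)] n by simp
    then show "x \<in> (\<Union>n::nat. (+) (- (real n *\<^sub>R v)) ` (conic hull F \<inter> conic hull G))"
      by (intro UN_I[of n] image_eqI[of _ _ "x + real n *\<^sub>R v"]) auto
  qed
qed

text \<open>Close to \<open>v\<close> only cones over facets through \<open>v\<close> are present.
  Hence \<open>v + d *\<^sub>R x\<close> lies in one of them for small \<open>d\<close>, and
  rescaling puts \<open>x\<close> itself into the corresponding line cone.\<close>

lemma sum_solid_angle_line_cone:
  fixes P :: "'a::euclidean_space set"
  assumes P: "polytope P" and 0: "0 \<in> interior P" and v: "v \<in> frontier P"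
  shows "(\<Sum>F\<in>{F. F facet_of P \<and> v \<in> F}. solid_angle (line_cone v F)) = 1"
proof -
  let ?I = "{F. F facet_of P \<and> v \<in> F}" and ?J = "{F. F facet_of P \<and> v \<notin> F}"
  have fin: "finite {F. F facet_of P}" by (rule finite_polytope_facets[OF P])
  have finI: "finite ?I" and finJ: "finite ?J" using fin by auto
  \<comment> \<open>Facets are compact and avoid 0, so the cones over them are closed. The finite
    union over the facets avoiding \<open>v\<close> will be shown to miss \<open>v\<close>, which
    leaves a ball around \<open>v\<close> free of it.\<close>
  have cl: "closed (\<Union>F\<in>?J. conic hull F)"
  proof (intro closed_UN finJ ballI)
    fix F assume "F \<in> ?J"
    then have F: "F facet_of P" by simp
    have "compact F" using F P face_of_imp_compact facet_of_imp_face_of polytope_imp_compact polytope_imp_convex by blast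
    moreover have "0 \<notin> F" using facet_subset_frontier[OF P _ F] 0 by (auto simp: frontier_def)
    ultimately show "closed (conic hull F)" by (simp add: closed_conic_hull)
  qed
  have v0: "v \<noteq> 0" using v 0 by (auto simp: frontier_def)
  have vJ: "v \<notin> (\<Union>F\<in>?J. conic hull F)"
  proof
    assume "v \<in> (\<Union>F\<in>?J. conic hull F)"
    then obtain F c f where F: "F facet_of P" "v \<notin> F" "v = c *\<^sub>R f" "0 \<le> c" "f \<in> F"
      by (auto simp: conic_hull_explicit)
    obtain G where G: "G facet_of P" "v \<in> G"
      using v frontier_polytope_facets[OF P] 0 by auto
    have c0: "c > 0" using v0 F by (cases "c = 0") auto
    have "c *\<^sub>R f \<in> P" using G F facet_of_imp_subset by blast
    then have "c \<le> 1" using facet_far_if_interior_0[OF P 0 F(1)] F(5) by (auto simp: far_facet_def)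
    moreover have "(1/c) *\<^sub>R v \<in> P" using F c0 facet_of_imp_subset by auto
    then have "1/c \<le> 1" using facet_far_if_interior_0[OF P 0 G(1)] G(2) by (auto simp: far_facet_def)
    ultimately have "c = 1" using c0 by (simp add: field_simps)
    then show False using F by simp
  qed
  obtain e where e: "e > 0" "ball v e \<inter> (\<Union>F\<in>?J. conic hull F) = {}"
  proof -
    have "open (- (\<Union>F\<in>?J. conic hull F))" using cl by (rule open_Compl)
    moreover have "v \<in> - (\<Union>F\<in>?J. conic hull F)" using vJ by (simp only: Compl_iff not_False_eq_True)
    ultimately obtain e where "e > 0" "ball v e \<subseteq> - (\<Union>F\<in>?J. conic hull F)"
      by (rule openE)
    then show ?thesis using that by (simp only: disjoint_eq_subset_Compl)
  qed
  have "(\<Union>F\<in>?I. line_cone v F) = UNIV"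
  proof (intro equalityI subsetI)
    fix x :: 'a
    \<comment> \<open>Small enough to keep \<open>v + d *\<^sub>R x\<close> inside the ball and away
      from 0; the summand 1 covers \<open>x = 0\<close>.\<close>
    define d where "d = min e (norm v) / (2 * (norm x + 1))"
    have m: "0 < min e (norm v)" using e v0 by simp
    then have d: "d > 0" unfolding d_def by (intro divide_pos_pos) (auto simp: add_nonneg_pos)
    have "norm (d *\<^sub>R x) = min e (norm v) * (norm x / (2 * (norm x + 1)))"
      unfolding norm_scaleR abs_of_pos[OF d] by (simp add: d_def)
    also have "\<dots> < min e (norm v) * 1"
      by (rule mult_strict_left_mono[OF _ m]) (simp add: divide_less_eq add_nonneg_pos)
    finally have n: "norm (d *\<^sub>R x) < e" "norm (d *\<^sub>R x) < norm v" by auto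
    have "v + d *\<^sub>R x \<noteq> 0" using n(2) by (metis add_eq_0_iff norm_minus_cancel less_irrefl)
    then obtain F where F: "F facet_of P" "v + d *\<^sub>R x \<in> conic hull F"
      using conic_hulls_of_facets_cover[OF P 0] by metis
    have "v + d *\<^sub>R x \<in> ball v e" using n(1) by (simp add: dist_norm)
    then have "v \<in> F" using F e(2) by blast
    have "(1/d) *\<^sub>R (v + d *\<^sub>R x) \<in> conic hull F" using F d by (intro conic_mul[OF conic_conic_hull]) auto
    then have "x + (1/d) *\<^sub>R v \<in> conic hull F" using d by (simp add: algebra_simps)
    then show "x \<in> (\<Union>F\<in>?I. line_cone v F)" using F(1) \<open>v \<in> F\<close> unfolding line_cone_def by blast
  qed simp
  moreover have "solid_angle (\<Union>F\<in>?I. line_cone v F) = (\<Sum>F\<in>?I. solid_angle (line_cone v F))"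
  proof (rule solid_angle_finite_Union[OF finI])
    fix F G assume FG: "F \<in> ?I" "G \<in> ?I" "F \<noteq> G"
    then show "negligible (line_cone v F \<inter> line_cone v G)"
      using negligible_conic_hull_Int[OF P FG(3)] facet_far_if_interior_0[OF P 0]
        convex_facet[OF polytope_imp_convex[OF P]]
      by (intro negligible_line_cone_Int) auto
  next
    fix F assume "F \<in> ?I"
    then show "line_cone v F \<in> sets lebesgue"
      using convex_facet[OF polytope_imp_convex[OF P]] by (intro convex_sets_lebesgue convex_line_cone) auto
  qed
  ultimately show ?thesis by simp
qed

section \<open>Pyramids over the facets and the position of the origin\<close>

lemma mem_convex_hull_insert_0:
  assumes "convex F" "F \<noteq> {}"
  shows "x \<in> convex hull (insert 0 F) \<longleftrightarrow> (\<exists>s f. 0 \<le> s \<and> s \<le> 1 \<and> f \<in> F \<and> x = s *\<^sub>R f)"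
proof -
  have "convex hull F = F" using assms(1) by (simp add: hull_same)
  then have "x \<in> convex hull (insert 0 F) \<longleftrightarrow> (\<exists>u v b. 0 \<le> u \<and> 0 \<le> v \<and> u + v = 1 \<and> b \<in> F \<and> x = v *\<^sub>R b)"
    unfolding convex_hull_insert[OF assms(2)] by auto
  also have "\<dots> \<longleftrightarrow> (\<exists>s f. 0 \<le> s \<and> s \<le> 1 \<and> f \<in> F \<and> x = s *\<^sub>R f)"
  proof (intro iffI; elim exE conjE)
    fix s f assume "0 \<le> s" "s \<le> 1" "f \<in> F" "x = s *\<^sub>R f"
    then show "\<exists>u v b. 0 \<le> u \<and> 0 \<le> v \<and> u + v = 1 \<and> b \<in> F \<and> x = v *\<^sub>R b"
      by (intro exI[of _ "1 - s"] exI[of _ s] exI[of _ f]) simp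
  next
    fix u v b assume "0 \<le> u" "0 \<le> v" "u + v = 1" "b \<in> F" "x = v *\<^sub>R b"
    then show "\<exists>s f. 0 \<le> s \<and> s \<le> 1 \<and> f \<in> F \<and> x = s *\<^sub>R f"
      by (intro exI[of _ v] exI[of _ b]) simp
  qed
  finally show ?thesis .
qed

text \<open>Seen from a point outside the polytope, the near and the far facets cover the same cone, so
  there are equally many of each if all facets subtend the same solid angle. If moreover the
  pyramids over the facets have equal volume, the volume of the polytope, which is the difference of
  the volumes of the far and the near pyramids, vanishes.\<close>

lemma interior_0_if_uniform_facets:
  fixes P :: "'a::euclidean_space set"
  assumes P: "polytope P" and ne: "interior P \<noteq> {}"
    and 0: "\<And>F. F facet_of P \<Longrightarrow> 0 \<notin> affine hull F"
    and \<omega>: "\<And>F. F facet_of P \<Longrightarrow> solid_angle (conic hull F) = \<omega>" "\<omega> > 0"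
    and \<tau>: "\<And>F. F facet_of P \<Longrightarrow> measure lebesgue (convex hull (insert 0 F)) = \<tau>"
  shows "0 \<in> interior P"
proof (rule ccontr)
  assume n0: "0 \<notin> interior P"
  have cP: "convex P" "compact P" "closed P"
    using P polytope_imp_convex polytope_imp_compact polytope_imp_closed by auto
  have fr: "frontier P = \<Union>{F. F facet_of P}" by (rule frontier_polytope_facets[OF P ne])
  have "0 \<notin> frontier P" unfolding fr by (auto dest: 0 hull_inc)
  then have 0: "0 \<notin> P" using n0 cP(3) by (simp add: frontier_def)
  have fn: "far_facet P F \<or> near_facet P F" if "F facet_of P" for F
    using facet_far_or_near[OF P ne that assms(3)[OF that]] .
  let ?U = "{F. far_facet P F}" and ?D = "{F. near_facet P F}"
  let ?T = "\<lambda>F. convex hull (insert 0 F)"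
  have fin: "finite ?U" "finite ?D"
    using finite_subset[OF _ finite_polytope_facets[OF P]] by (auto simp: far_facet_def near_facet_def)
  have facU: "F facet_of P" if "F \<in> ?U" for F using that by (simp add: far_facet_def)
  have facD: "F facet_of P" if "F \<in> ?D" for F using that by (simp add: near_facet_def)
  have Fp: "convex F" "F \<noteq> {}" "compact F" "F \<subseteq> P" "F \<subseteq> frontier P" if "F facet_of P" for F
  proof -
    show "convex F" by (rule convex_facet[OF cP(1) that])
    show "compact F" by (rule face_of_imp_compact[OF cP(1,2) facet_of_imp_face_of[OF that]])
    show "F \<noteq> {}" using that by (simp add: facet_of_def)
    show "F \<subseteq> P" by (rule facet_of_imp_subset[OF that])
    show "F \<subseteq> frontier P" by (rule facet_subset_frontier[OF P ne that])
  qed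
  have Cm: "conic hull F \<in> sets lebesgue" if "F facet_of P" for F
    using Fp[OF that] by (intro sets_lebesgue_conic_hull)
  have Tm: "?T F \<in> lmeasurable" if "F facet_of P" for F
    using Fp[OF that] by (intro lmeasurable_compact compact_convex_hull compact_insert)
  \<comment> \<open>The open cone over the interior. Up to null sets the far cones fit into
    \<open>K\<close> without overlap, and the near cones cover it, so there are at most as many far
    facets as near ones.\<close>
  define K where "K = (\<Union>c\<in>{0<..}. (*\<^sub>R) c ` interior P)"
  have oK: "open K" unfolding K_def by (intro open_UN ballI open_scaling) auto
  have cK: "convex K"
    unfolding convex_alt
  proof (intro ballI allI impI)
    fix x y and u :: real assume xy: "x \<in> K" "y \<in> K" and u: "0 \<le> u \<and> u \<le> 1"
    obtain c z where c: "c > 0" "z \<in> interior P" "x = c *\<^sub>R z" using xy(1) K_def by auto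
    obtain d w where d: "d > 0" "w \<in> interior P" "y = d *\<^sub>R w" using xy(2) K_def by auto
    define m where "m = (1 - u) * c + u * d"
    have m: "m > 0"
    proof (cases "u = 0")
      case False
      then have "0 < u * d" "0 \<le> (1 - u) * c" using u c(1) d(1) by auto
      then show ?thesis unfolding m_def by linarith
    qed (simp add: m_def c)
    have "((1 - u) * c / m) *\<^sub>R z + (u * d / m) *\<^sub>R w \<in> interior P"
    proof (rule convexD[OF convex_interior[OF cP(1)] c(2) d(2)])
      show "(1 - u) * c / m + u * d / m = 1" using m by (simp add: m_def add_divide_distrib[symmetric])
    qed (use m u c(1) d(1) in auto)
    moreover have "(1 - u) *\<^sub>R x + u *\<^sub>R y = m *\<^sub>R (((1 - u) * c / m) *\<^sub>R z + (u * d / m) *\<^sub>R w)"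
      using m by (simp add: c(3) d(3) scaleR_add_right)
    ultimately show "(1 - u) *\<^sub>R x + u *\<^sub>R y \<in> K" unfolding K_def using m by blast
  qed
  have Km: "K \<in> sets lebesgue" by (rule convex_sets_lebesgue[OF cK])
  have neg: "negligible (conic hull F - K)" if F: "F facet_of P" for F
  proof (rule negligible_subset)
    show "negligible (insert 0 (frontier K))" using negligible_convex_frontier[OF cK] by simp
    show "conic hull F - K \<subseteq> insert 0 (frontier K)"
    proof
      fix x assume x: "x \<in> conic hull F - K"
      then obtain c f where cf: "x = c *\<^sub>R f" "0 \<le> c" "f \<in> F" by (auto simp: conic_hull_explicit)
      show "x \<in> insert 0 (frontier K)"
      proof (cases "c = 0")
        case False
        then have c: "c > 0" using cf by simp
        have "f \<in> closure (interior P)"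
          using Fp(4)[OF F] cf(3) convex_closure_interior[OF cP(1) ne] closure_subset by blast
        then have "x \<in> closure ((*\<^sub>R) c ` interior P)" using cf(1) closure_scaleR by blast
        moreover have "(*\<^sub>R) c ` interior P \<subseteq> K" unfolding K_def using c by blast
        ultimately have "x \<in> closure K" using closure_mono by blast
        then show ?thesis using x oK by (simp add: frontier_def interior_open)
      qed (use cf in simp)
    qed
  qed
  have covD: "K \<subseteq> (\<Union>F\<in>?D. conic hull F)"
  proof
    fix x assume "x \<in> K"
    then obtain c z where c: "c > 0" "z \<in> interior P" "x = c *\<^sub>R z" unfolding K_def by auto
    obtain F t where F: "near_facet P F" "0 < t" "t < 1" "t *\<^sub>R z \<in> F"
      using near_facet_on_ray[OF P 0 c(2) fn] by metis
    have "(c / t) *\<^sub>R (t *\<^sub>R z) \<in> conic hull F"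
      using F c by (intro conic_mul[OF conic_conic_hull] hull_inc) auto
    then show "x \<in> (\<Union>F\<in>?D. conic hull F)" using F c by auto
  qed
  have "real (card ?U) * \<omega> = solid_angle (\<Union>F\<in>?U. conic hull F)"
  proof (subst solid_angle_finite_Union)
    show "negligible (conic hull i \<inter> conic hull j)" if "i \<in> ?U" "j \<in> ?U" "i \<noteq> j" for i j
      using negligible_conic_hull_Int[OF P that(3)] that by simp
  qed (use fin Cm facU \<omega> in auto)
  also have "\<dots> \<le> solid_angle K"
  proof (rule solid_angle_mono)
    have "negligible (\<Union>F\<in>?U. conic hull F - K)"
      using fin(1) neg facU by (intro negligible_Union) auto
    then show "negligible ((\<Union>F\<in>?U. conic hull F) - K)"
      by (rule negligible_subset) auto
  qed (use fin Cm facU Km in auto)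
  also have "\<dots> \<le> solid_angle (\<Union>F\<in>?D. conic hull F)"
  proof (rule solid_angle_mono)
    have "K - (\<Union>F\<in>?D. conic hull F) = {}" using covD by blast
    then show "negligible (K - (\<Union>F\<in>?D. conic hull F))" by simp
  qed (use fin Cm facD Km in auto)
  also have "\<dots> = real (card ?D) * \<omega>"
  proof (subst solid_angle_finite_Union)
    show "negligible (conic hull i \<inter> conic hull j)" if "i \<in> ?D" "j \<in> ?D" "i \<noteq> j" for i j
      using negligible_conic_hull_Int[OF P that(3)] that by simp
  qed (use fin Cm facD \<omega> in auto)
  finally have card: "real (card ?U) \<le> real (card ?D)" using \<omega>(2) by simp
  \<comment> \<open>For pyramids the inclusion goes the other way: along every ray in
    \<open>K\<close> the far facet lies beyond both \<open>P\<close> and the near facet.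
    Intersecting with \<open>K\<close> removes only null sets.\<close>
  have covT: "interior P \<union> (\<Union>G\<in>?D. ?T G \<inter> K) \<subseteq> (\<Union>F\<in>?U. ?T F)"
  proof -
    have far: "\<exists>F\<in>?U. s *\<^sub>R g \<in> ?T F" if fa: "g \<in> P" "g = c *\<^sub>R z" "c > 0" "z \<in> interior P" "0 \<le> s" "s \<le> 1" for s c g z
    proof -
      have z0: "z \<noteq> 0" using fa(4) n0 by blast
      obtain F t where F: "far_facet P F" "1 < t" "t *\<^sub>R z \<in> F"
        using far_facet_on_ray[OF P fa(4) z0 fn] by metis
      have g: "g = (c / t) *\<^sub>R (t *\<^sub>R z)" using fa F by simp
      then have "c / t \<le> 1" using F fa(1) unfolding far_facet_def by metis
      moreover have "0 \<le> c / t" using fa(3) F(2) by simp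
      ultimately have "0 \<le> s * (c / t)" "s * (c / t) \<le> 1" using fa(5,6) by (auto intro!: mult_nonneg_nonneg mult_le_one simp del: times_divide_eq_right)
      moreover have "s *\<^sub>R g = (s * (c / t)) *\<^sub>R (t *\<^sub>R z)" using g by simp
      ultimately have "s *\<^sub>R g \<in> ?T F"
        using F(3) mem_convex_hull_insert_0[OF Fp(1,2)] facU F(1) by blast
      then show ?thesis using F(1) by blast
    qed
    have "x \<in> (\<Union>F\<in>?U. ?T F)" if "x \<in> interior P" for x
      using far[of x 1 x 1] that interior_subset by auto
    moreover have "x \<in> (\<Union>F\<in>?U. ?T F)" if x: "G \<in> ?D" "x \<in> ?T G" "x \<in> K" for x G
    proof -
      obtain s g where sg: "0 \<le> s" "s \<le> 1" "g \<in> G" "x = s *\<^sub>R g"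
        using x(2) mem_convex_hull_insert_0[OF Fp(1,2)] facD[OF x(1)] by blast
      obtain c z where c: "c > 0" "z \<in> interior P" "x = c *\<^sub>R z" using x(3) unfolding K_def by auto
      have s: "s > 0"
      proof (rule ccontr)
        assume "\<not> s > 0"
        then have "s = 0" using sg(1) by simp
        then have "z = 0" using c sg(4) by simp
        then show False using c(2) n0 by simp
      qed
      have "(1 / s) *\<^sub>R (s *\<^sub>R g) = (1 / s) *\<^sub>R (c *\<^sub>R z)" using sg(4) c(3) by simp
      then have "g = (c / s) *\<^sub>R z" using s by simp
      then show ?thesis
        using far[of g "c / s" z s] sg s c Fp(4)[OF facD[OF x(1)]] by (auto simp: sg(4))
    qed
    ultimately show ?thesis by blast
  qed
  \<comment> \<open>\<open>P\<close> meets the near pyramids only in its frontier, so the volume of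
    \<open>A\<close> is that of \<open>P\<close> plus \<open>card ?D * \<tau>\<close>; it is at most
    \<open>card ?U * \<tau>\<close>, which does not exceed \<open>card ?D * \<tau>\<close>.\<close>
  define A where "A = P \<union> (\<Union>G\<in>?D. ?T G)"
  have mP: "P \<in> lmeasurable" by (rule lmeasurable_compact[OF cP(2)])
  have mD: "(\<Union>G\<in>?D. ?T G) \<in> lmeasurable" "(\<Union>F\<in>?U. ?T F) \<in> lmeasurable"
    using fin Tm facD facU by (auto intro!: fmeasurable.finite_Union)
  have Tsub: "?T F \<subseteq> conic hull F" if "F facet_of P" for F
    by (rule hull_minimal) (use convex_conic_hull Fp[OF that] in \<open>auto simp: hull_inc\<close>)
  have negPT: "negligible (P \<inter> (\<Union>G\<in>?D. ?T G))"
  proof (rule negligible_subset[OF negligible_convex_frontier[OF cP(1)]])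
    show "P \<inter> (\<Union>G\<in>?D. ?T G) \<subseteq> frontier P"
    proof
      fix x assume "x \<in> P \<inter> (\<Union>G\<in>?D. ?T G)"
      then obtain G where G: "G \<in> ?D" "x \<in> ?T G" "x \<in> P" by blast
      obtain s g where sg: "0 \<le> s" "s \<le> 1" "g \<in> G" "x = s *\<^sub>R g"
        using G mem_convex_hull_insert_0[OF Fp(1,2)] facD[OF G(1)] by blast
      then have "1 \<le> s" using G unfolding near_facet_def by blast
      then have "x = g" using sg by simp
      then show "x \<in> frontier P" using sg Fp(5)[OF facD[OF G(1)]] by blast
    qed
  qed
  have "measure lebesgue (\<Union>G\<in>?D. ?T G) = (\<Sum>G\<in>?D. measure lebesgue (?T G))"
  proof (rule measure_negligible_finite_Union_image)
    show "pairwise (\<lambda>x y. negligible (?T x \<inter> ?T y)) ?D"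
      unfolding pairwise_def
    proof (intro ballI impI)
      fix F G assume FG: "F \<in> ?D" "G \<in> ?D" "F \<noteq> G"
      show "negligible (?T F \<inter> ?T G)"
        by (rule negligible_subset[OF negligible_conic_hull_Int[OF P FG(3)]])
          (use FG Tsub facD in auto)
    qed
  qed (use fin Tm facD in auto)
  also have "\<dots> = real (card ?D) * \<tau>" using \<tau> facD by simp
  finally have "measure lebesgue A = measure lebesgue P + real (card ?D) * \<tau>"
    unfolding A_def using mP mD(1) negPT by (simp add: measure_Un3 negligible_imp_measure0)
  moreover have "measure lebesgue A \<le> measure lebesgue (\<Union>F\<in>?U. ?T F)"
  proof -
    let ?N = "frontier P \<union> (\<Union>G\<in>?D. ?T G - K)"
    have "negligible (\<Union>G\<in>?D. ?T G - K)"
    proof (intro negligible_Union finite_imageI fin(2), elim imageE)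
      fix S G assume G: "S = ?T G - K" "G \<in> ?D"
      show "negligible S"
        unfolding G(1) by (rule negligible_subset[OF neg[OF facD[OF G(2)]]]) (use Tsub[OF facD[OF G(2)]] in auto)
    qed
    then have N: "negligible ?N" using negligible_convex_frontier[OF cP(1)] by simp
    have "A \<subseteq> (\<Union>F\<in>?U. ?T F) \<union> ?N"
      unfolding A_def using covT closure_subset[of P] by (auto simp: frontier_def)
    then have "measure lebesgue A \<le> measure lebesgue ((\<Union>F\<in>?U. ?T F) \<union> ?N)"
      using N mD mP by (intro measure_mono_fmeasurable)
        (auto simp: A_def intro: fmeasurable.Un negligible_imp_measurable)
    also have "\<dots> \<le> measure lebesgue (\<Union>F\<in>?U. ?T F) + measure lebesgue ?N"
      using N mD negligible_imp_measurable by (intro measure_Un_le) (auto simp: negligible_imp_sets)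
    finally show ?thesis using N negligible_imp_measure0[OF N] by simp
  qed
  moreover have "measure lebesgue (\<Union>F\<in>?U. ?T F) \<le> (\<Sum>F\<in>?U. measure lebesgue (?T F))"
    using fin Tm facU by (intro measure_UNION_le) auto
  moreover have "(\<Sum>F\<in>?U. measure lebesgue (?T F)) = real (card ?U) * \<tau>" using \<tau> facU by simp
  moreover have "real (card ?U) * \<tau> \<le> real (card ?D) * \<tau>"
  proof -
    obtain F where "F facet_of P" using ne near_facet_on_ray[OF P 0 _ fn] facD by blast
    then have "\<tau> \<ge> 0" using \<tau> measure_nonneg by metis
    then show ?thesis using card by (rule mult_right_mono[rotated])
  qed
  ultimately have "measure lebesgue P \<le> 0" by linarith
  then have "measure lebesgue P = 0" using measure_nonneg[of lebesgue P] by linarith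
  then have "negligible P" using mP by (simp add: negligible_iff_measure)
  then have "negligible (interior P)" using interior_subset negligible_subset by blast
  then show False using ne open_not_negligible open_interior by blast
qed

section \<open>Triangular cones and spherical excess\<close>

text \<open>Stated for a triple and not for a set, so that a repeated vector counts as a
  dependency.\<close>

definition lin_indep3 :: "'a::real_vector \<Rightarrow> 'a \<Rightarrow> 'a \<Rightarrow> bool" where
  "lin_indep3 a b c \<longleftrightarrow> (\<forall>r s t. r *\<^sub>R a + s *\<^sub>R b + t *\<^sub>R c = 0 \<longrightarrow> r = 0 \<and> s = 0 \<and> t = 0)"

lemma lin_indep3_perm:
  assumes "lin_indep3 a b c"
  shows "lin_indep3 b a c" "lin_indep3 a c b" "lin_indep3 b c a" "lin_indep3 c a b" "lin_indep3 c b a"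
proof -
  have 1: "lin_indep3 b a c" if ind: "lin_indep3 a b c" for a b c :: 'a
    unfolding lin_indep3_def
  proof (intro allI impI)
    fix r s t assume "r *\<^sub>R b + s *\<^sub>R a + t *\<^sub>R c = 0"
    then have "s *\<^sub>R a + r *\<^sub>R b + t *\<^sub>R c = 0" by (simp add: add.commute)
    then show "r = 0 \<and> s = 0 \<and> t = 0" using ind unfolding lin_indep3_def by blast
  qed
  have 2: "lin_indep3 a c b" if ind: "lin_indep3 a b c" for a b c :: 'a
    unfolding lin_indep3_def
  proof (intro allI impI)
    fix r s t assume "r *\<^sub>R a + s *\<^sub>R c + t *\<^sub>R b = 0"
    then have "r *\<^sub>R a + t *\<^sub>R b + s *\<^sub>R c = 0" by (simp add: add.commute add.left_commute)
    then show "r = 0 \<and> s = 0 \<and> t = 0" using ind unfolding lin_indep3_def by blast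
  qed
  show "lin_indep3 b a c" "lin_indep3 a c b" "lin_indep3 b c a" "lin_indep3 c a b" "lin_indep3 c b a"
    using 1 2 assms by blast+
qed

lemma lin_indep3_uminus:
  assumes "lin_indep3 a b c"
  shows "lin_indep3 (- a) b c"
  unfolding lin_indep3_def
proof (intro allI impI)
  fix r s t assume "r *\<^sub>R (- a) + s *\<^sub>R b + t *\<^sub>R c = 0"
  then have "(- r) *\<^sub>R a + s *\<^sub>R b + t *\<^sub>R c = 0" by simp
  then show "r = 0 \<and> s = 0 \<and> t = 0" using assms unfolding lin_indep3_def by (metis neg_equal_0_iff_equal)
qed

lemma lin_indep3_coords:
  assumes "lin_indep3 a b c" "r *\<^sub>R a + s *\<^sub>R b + t *\<^sub>R c = r' *\<^sub>R a + s' *\<^sub>R b + t' *\<^sub>R c"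
  shows "r = r'" "s = s'" "t = t'"
proof -
  have "(r - r') *\<^sub>R a + (s - s') *\<^sub>R b + (t - t') *\<^sub>R c = 0"
    using assms(2) by (simp add: algebra_simps)
  then show "r = r'" "s = s'" "t = t'" using assms(1) unfolding lin_indep3_def by force+
qed

lemma span_3: "span {a, b, c} = {r *\<^sub>R a + s *\<^sub>R b + t *\<^sub>R c | r s t. True}"
proof -
  have "x \<in> span {a, b, c} \<longleftrightarrow> (\<exists>r s t. x = r *\<^sub>R a + s *\<^sub>R b + t *\<^sub>R c)" for x
  proof -
    have "x \<in> span {a, b, c} \<longleftrightarrow> (\<exists>r s t. x - r *\<^sub>R a - s *\<^sub>R b - t *\<^sub>R c = 0)"
      by (simp add: span_breakdown_eq)
    also have "\<dots> \<longleftrightarrow> (\<exists>r s t. x = r *\<^sub>R a + s *\<^sub>R b + t *\<^sub>R c)"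
      by (simp add: diff_diff_eq add.assoc)
    finally show ?thesis .
  qed
  then show ?thesis by blast
qed

lemma lin_indep3_span:
  fixes a b c :: "'a::euclidean_space"
  assumes "lin_indep3 a b c" "DIM('a) = 3"
  shows "span {a, b, c} = UNIV" "independent {a, b, c}" "a \<noteq> b" "a \<noteq> c" "b \<noteq> c"
proof -
  have *: "a' \<noteq> b'" if "lin_indep3 a' b' c'" for a' b' c' :: 'a
  proof
    assume "a' = b'"
    then have "1 *\<^sub>R a' + (-1) *\<^sub>R b' + 0 *\<^sub>R c' = 0" by simp
    then show False using that unfolding lin_indep3_def by (metis zero_neq_one)
  qed
  show d: "a \<noteq> b" "a \<noteq> c" "b \<noteq> c" using * assms(1) lin_indep3_perm by blast+
  have **: "a' \<notin> span {b', c'}" if "lin_indep3 a' b' c'" for a' b' c' :: 'a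
  proof
    assume "a' \<in> span {b', c'}"
    then obtain s t where "a' - s *\<^sub>R b' - t *\<^sub>R c' = 0" by (auto simp: span_breakdown_eq)
    then have "1 *\<^sub>R a' + (-s) *\<^sub>R b' + (-t) *\<^sub>R c' = 0" by (simp add: algebra_simps)
    then show False using that unfolding lin_indep3_def by (metis zero_neq_one)
  qed
  have "c \<noteq> 0" "b \<notin> span {c}"
    using **[OF lin_indep3_perm(4)[OF assms(1)]] **[OF lin_indep3_perm(1)[OF assms(1)]]
      span_mono[of "{c}" "{a, c}"] span_0 by blast+
  then show i: "independent {a, b, c}"
    using **[OF assms(1)] d by (simp add: independent_insert)
  have "card {a, b, c} = 3" using d by simp
  then show "span {a, b, c} = UNIV"
    using card_eq_dim[of "{a,b,c}" UNIV] i assms(2) by auto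
qed

lemma lin_indep3E:
  fixes a b c :: "'a::euclidean_space"
  assumes "lin_indep3 a b c" "DIM('a) = 3"
  obtains r s t where "x = r *\<^sub>R a + s *\<^sub>R b + t *\<^sub>R c"
proof -
  have "x \<in> span {a, b, c}" using lin_indep3_span(1)[OF assms] by simp
  then show ?thesis using that unfolding span_3 by blast
qed

text \<open>Adding the origin, which lies off the plane of the three points, raises the affine
  dimension to 3, and for a set containing 0 this is the linear dimension.\<close>

lemma lin_indep3_if_affine:
  fixes a b c :: "'a::euclidean_space"
  assumes "DIM('a) = 3" "aff_dim {a, b, c} = 2" "0 \<notin> affine hull {a, b, c}"
  shows "lin_indep3 a b c"
proof -
  have "int (dim {a, b, c}) = aff_dim (insert 0 {a, b, c})"
    by (simp add: aff_dim_zero hull_inc dim_insert span_0)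
  also have "\<dots> = 3" using assms(2,3) by (simp only: aff_dim_insert) simp
  finally have dim: "dim {a, b, c} = 3" by simp
  have "card {a, b, c} \<ge> 3" using dim dim_le_card'[of "{a, b, c}"] by simp
  then have d: "a \<noteq> b" "a \<noteq> c" "b \<noteq> c" by (auto simp: card_insert_if split: if_splits)
  then have "card {a, b, c} = 3" by simp
  then have ind: "independent {a, b, c}"
    using dim card_eq_dim[of "{a,b,c}" "{a,b,c}"] span_superset[of "{a,b,c}"] by auto
  show ?thesis unfolding lin_indep3_def
  proof (intro allI impI)
    fix r s t assume eq: "r *\<^sub>R a + s *\<^sub>R b + t *\<^sub>R c = 0"
    define u where "u x = (if x = a then r else if x = b then s else t)" for x
    have "(\<Sum>x\<in>{a,b,c}. u x *\<^sub>R x) = 0" using d eq by (simp add: u_def algebra_simps)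
    then have "\<forall>x\<in>{a,b,c}. u x = 0" using ind independent_explicit_finite_subsets[of "{a,b,c}"] by blast
    then show "r = 0 \<and> s = 0 \<and> t = 0" using d by (simp add: u_def)
  qed
qed

definition same_gram :: "'a::real_inner \<Rightarrow> 'a \<Rightarrow> 'a \<Rightarrow> 'a \<Rightarrow> 'a \<Rightarrow> 'a \<Rightarrow> bool" where
  "same_gram a b c a' b' c' \<longleftrightarrow> a' \<bullet> a' = a \<bullet> a \<and> b' \<bullet> b' = b \<bullet> b \<and> c' \<bullet> c' = c \<bullet> c \<and>
     a' \<bullet> b' = a \<bullet> b \<and> a' \<bullet> c' = a \<bullet> c \<and> b' \<bullet> c' = b \<bullet> c"

text \<open>The linear extension from the basis \<open>a\<close>, \<open>b\<close>, \<open>c\<close>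
  preserves all inner products by bilinearity.\<close>

lemma orthogonal_transformation_of_gram:
  fixes a b c :: "real^3"
  assumes ind: "lin_indep3 a b c" and gram: "same_gram a b c a' b' c'"
  obtains l where "orthogonal_transformation l" "l a = a'" "l b = b'" "l c = c'"
proof -
  have D: "DIM(real^3) = 3" by simp
  note sp = lin_indep3_span[OF ind D]
  obtain l where l: "linear l" "\<And>x. x \<in> {a, b, c} \<Longrightarrow> l x = (if x = a then a' else if x = b then b' else c')"
    using linear_independent_extend[OF sp(2), of "\<lambda>x. if x = a then a' else if x = b then b' else c'"]
    by blast
  have la: "l a = a'" "l b = b'" "l c = c'" using l(2) sp by auto
  have "l x \<bullet> l y = x \<bullet> y" for x y
  proof -
    obtain r s t where x: "x = r *\<^sub>R a + s *\<^sub>R b + t *\<^sub>R c"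
      by (rule lin_indep3E[OF ind D])
    obtain r' s' t' where y: "y = r' *\<^sub>R a + s' *\<^sub>R b + t' *\<^sub>R c"
      by (rule lin_indep3E[OF ind D])
    have lx: "l x = r *\<^sub>R a' + s *\<^sub>R b' + t *\<^sub>R c'" "l y = r' *\<^sub>R a' + s' *\<^sub>R b' + t' *\<^sub>R c'"
      unfolding x y by (simp_all add: linear_add[OF l(1)] linear_scale[OF l(1)] la)
    have g: "b' \<bullet> a' = b \<bullet> a" "c' \<bullet> a' = c \<bullet> a" "c' \<bullet> b' = c \<bullet> b"
      using gram by (simp_all add: same_gram_def inner_commute)
    show ?thesis unfolding lx unfolding x y using gram g
      by (simp add: same_gram_def inner_add_left inner_add_right)
  qed
  then have "orthogonal_transformation l" unfolding orthogonal_transformation_def using l(1) by blast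
  then show ?thesis using that la by blast
qed

section \<open>Cones, wedges and half spaces spanned by three vectors\<close>

definition tri_cone :: "'a::real_vector \<Rightarrow> 'a \<Rightarrow> 'a \<Rightarrow> 'a set" where
  "tri_cone a b c = {r *\<^sub>R a + s *\<^sub>R b + t *\<^sub>R c | r s t. 0 \<le> r \<and> 0 \<le> s \<and> 0 \<le> t}"

definition half_space3 :: "'a::real_vector \<Rightarrow> 'a \<Rightarrow> 'a \<Rightarrow> 'a set" where
  "half_space3 a b c = {r *\<^sub>R a + s *\<^sub>R b + t *\<^sub>R c | r s t. 0 \<le> t}"

lemma conic_hull_triangle: "conic hull (convex hull {a, b, c}) = tri_cone a b c"
proof
  show "conic hull (convex hull {a, b, c}) \<subseteq> tri_cone a b c"
  proof
    fix x assume "x \<in> conic hull (convex hull {a, b, c})"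
    then obtain k u v w where "x = k *\<^sub>R (u *\<^sub>R a + v *\<^sub>R b + w *\<^sub>R c)" "0 \<le> k" "0 \<le> u" "0 \<le> v" "0 \<le> w"
      by (auto simp: conic_hull_explicit convex_hull_3)
    then show "x \<in> tri_cone a b c" unfolding tri_cone_def
      by (intro CollectI exI[of _ "k * u"] exI[of _ "k * v"] exI[of _ "k * w"]) (simp add: algebra_simps)
  qed
  show "tri_cone a b c \<subseteq> conic hull (convex hull {a, b, c})"
  proof
    fix x assume "x \<in> tri_cone a b c"
    then obtain r s t where x: "x = r *\<^sub>R a + s *\<^sub>R b + t *\<^sub>R c" "0 \<le> r" "0 \<le> s" "0 \<le> t"
      unfolding tri_cone_def by blast
    have "r *\<^sub>R a \<in> conic hull (convex hull {a, b, c})" "s *\<^sub>R b \<in> conic hull (convex hull {a, b, c})"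
      "t *\<^sub>R c \<in> conic hull (convex hull {a, b, c})"
      using x by (auto intro!: conic_mul[OF conic_conic_hull] intro: hull_inc hull_inc[THEN hull_inc])
    then show "x \<in> conic hull (convex hull {a, b, c})"
      unfolding x(1) by (intro conic_hull_add convex_convex_hull)
  qed
qed

lemma line_cone_triangle: "line_cone a (convex hull {a, b, c}) = wedge a b c"
proof
  show "line_cone a (convex hull {a, b, c}) \<subseteq> wedge a b c"
  proof
    fix x assume "x \<in> line_cone a (convex hull {a, b, c})"
    then obtain k r s t where k: "x + k *\<^sub>R a = r *\<^sub>R a + s *\<^sub>R b + t *\<^sub>R c" "0 \<le> s" "0 \<le> t"
      unfolding line_cone_def conic_hull_triangle tri_cone_def by blast
    have "x = (x + k *\<^sub>R a) - k *\<^sub>R a" by simp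
    also have "\<dots> = (r - k) *\<^sub>R a + s *\<^sub>R b + t *\<^sub>R c" unfolding k(1) by (simp add: algebra_simps)
    finally show "x \<in> wedge a b c" unfolding wedge_def using k by blast
  qed
  show "wedge a b c \<subseteq> line_cone a (convex hull {a, b, c})"
  proof
    fix x assume "x \<in> wedge a b c"
    then obtain r s t where x: "x = r *\<^sub>R a + s *\<^sub>R b + t *\<^sub>R c" "0 \<le> s" "0 \<le> t"
      unfolding wedge_def by blast
    have "x + (- r) *\<^sub>R a = 0 *\<^sub>R a + s *\<^sub>R b + t *\<^sub>R c" unfolding x(1) by simp
    then show "x \<in> line_cone a (convex hull {a, b, c})"
      unfolding line_cone_def conic_hull_triangle tri_cone_def using x(2,3) by blast
  qed
qed

lemma line_cone_triangle_edge:
  assumes "m = (1/2) *\<^sub>R a + (1/2) *\<^sub>R b"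
  shows "line_cone m (convex hull {a, b, c}) = half_space3 a b c"
proof
  show "line_cone m (convex hull {a, b, c}) \<subseteq> half_space3 a b c"
  proof
    fix x assume "x \<in> line_cone m (convex hull {a, b, c})"
    then obtain k r s t where k: "x + k *\<^sub>R m = r *\<^sub>R a + s *\<^sub>R b + t *\<^sub>R c" "0 \<le> t"
      unfolding line_cone_def conic_hull_triangle tri_cone_def by blast
    have "x = (x + k *\<^sub>R m) - k *\<^sub>R m" by simp
    also have "\<dots> = (r - k/2) *\<^sub>R a + (s - k/2) *\<^sub>R b + t *\<^sub>R c" by (subst k(1)) (simp add: assms algebra_simps)
    finally show "x \<in> half_space3 a b c" unfolding half_space3_def using k by blast
  qed
  show "half_space3 a b c \<subseteq> line_cone m (convex hull {a, b, c})"
  proof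
    fix x assume "x \<in> half_space3 a b c"
    then obtain r s t where x: "x = r *\<^sub>R a + s *\<^sub>R b + t *\<^sub>R c" "0 \<le> t"
      unfolding half_space3_def by blast
    \<comment> \<open>Twice \<open>k\<close> times the midpoint adds \<open>k\<close> to both edge
      coefficients, enough to make them nonnegative.\<close>
    define k :: real where "k = \<bar>r\<bar> + \<bar>s\<bar>"
    have "x + (2 * k) *\<^sub>R m = (r + k) *\<^sub>R a + (s + k) *\<^sub>R b + t *\<^sub>R c" unfolding x(1) assms by (simp add: algebra_simps)
    moreover have "0 \<le> r + k" "0 \<le> s + k" unfolding k_def by linarith+
    ultimately show "x \<in> line_cone m (convex hull {a, b, c})"
      unfolding line_cone_def conic_hull_triangle tri_cone_def using x(2) by blast
  qed
qed

lemma convex_tri_cone: "convex (tri_cone a b c)"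
  by (simp flip: conic_hull_triangle add: convex_conic_hull)

lemma convex_wedge: "convex (wedge a b c)"
  by (simp flip: line_cone_triangle add: convex_line_cone)

lemma convex_half_space3: "convex (half_space3 a b c)"
  by (simp flip: line_cone_triangle_edge[OF refl] add: convex_line_cone)

lemma negligible_span_2:
  fixes a b :: "real^3"
  shows "negligible (span {a, b})"
proof (rule negligible_lowdim)
  have "dim {a, b} \<le> card {a, b}" by (rule dim_le_card') simp
  also have "\<dots> \<le> 2" by (simp add: card_insert_if)
  finally show "dim (span {a, b}) < DIM(real^3)" by simp
qed

lemma mem_span_2: "s *\<^sub>R a + t *\<^sub>R b \<in> span {a, b}"
  by (intro span_add span_scale span_base) auto

text \<open>The sign of the coefficient of \<open>a\<close> separates the two cones; their overlap
  has coefficient 0 and lies in a plane.\<close>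

lemma solid_angle_wedge_split:
  fixes a b c :: "real^3"
  assumes "lin_indep3 a b c"
  shows "solid_angle (wedge a b c) = solid_angle (tri_cone a b c) + solid_angle (tri_cone (- a) b c)"
proof -
  have "wedge a b c = tri_cone a b c \<union> tri_cone (- a) b c"
  proof (intro equalityI subsetI)
    fix x assume "x \<in> wedge a b c"
    then obtain r s t where x: "x = r *\<^sub>R a + s *\<^sub>R b + t *\<^sub>R c" "0 \<le> s" "0 \<le> t"
      unfolding wedge_def by blast
    have "x = (- r) *\<^sub>R (- a) + s *\<^sub>R b + t *\<^sub>R c" using x by simp
    moreover have "0 \<le> r \<or> 0 \<le> - r" by linarith
    ultimately show "x \<in> tri_cone a b c \<union> tri_cone (- a) b c"
      unfolding tri_cone_def using x by blast
  next
    fix x assume "x \<in> tri_cone a b c \<union> tri_cone (- a) b c"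
    then show "x \<in> wedge a b c"
    proof
      assume "x \<in> tri_cone (- a) b c"
      then obtain r s t where x: "x = r *\<^sub>R (- a) + s *\<^sub>R b + t *\<^sub>R c" "0 \<le> s" "0 \<le> t"
        unfolding tri_cone_def by blast
      then have "x = (- r) *\<^sub>R a + s *\<^sub>R b + t *\<^sub>R c" by simp
      then show ?thesis unfolding wedge_def using x by blast
    qed (auto simp: tri_cone_def wedge_def)
  qed
  moreover have "negligible (tri_cone a b c \<inter> tri_cone (- a) b c)"
  proof (rule negligible_subset[OF negligible_span_2])
    show "tri_cone a b c \<inter> tri_cone (- a) b c \<subseteq> span {b, c}"
    proof
      fix x assume "x \<in> tri_cone a b c \<inter> tri_cone (- a) b c"
      then obtain r s t r' s' t' where x: "x = r *\<^sub>R a + s *\<^sub>R b + t *\<^sub>R c" "x = r' *\<^sub>R (- a) + s' *\<^sub>R b + t' *\<^sub>R c"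
        "0 \<le> r" "0 \<le> r'"
        unfolding tri_cone_def by blast
      have "r *\<^sub>R a + s *\<^sub>R b + t *\<^sub>R c = (- r') *\<^sub>R a + s' *\<^sub>R b + t' *\<^sub>R c" using x by simp
      then have "r = - r'" using lin_indep3_coords[OF assms] by blast
      then have "r = 0" using x(3,4) by simp
      then have "x = s *\<^sub>R b + t *\<^sub>R c" using x(1) by simp
      then show "x \<in> span {b, c}" using mem_span_2 by simp
    qed
  qed
  ultimately show ?thesis
    using solid_angle_Un convex_sets_lebesgue[OF convex_tri_cone] by metis
qed

lemma solid_angle_half_space3:
  fixes a b c :: "real^3"
  assumes "lin_indep3 a b c"
  shows "solid_angle (half_space3 a b c) = 1/2"
proof -
  note ms = convex_sets_lebesgue[OF convex_half_space3]
  have im: "uminus ` half_space3 a b c = half_space3 a b (- c)"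
  proof (intro equalityI subsetI)
    fix x assume "x \<in> uminus ` half_space3 a b c"
    then obtain r s t where "x = - (r *\<^sub>R a + s *\<^sub>R b + t *\<^sub>R c)" "0 \<le> t" unfolding half_space3_def by blast
    then have "x = (- r) *\<^sub>R a + (- s) *\<^sub>R b + t *\<^sub>R (- c)" "0 \<le> t" by simp_all
    then show "x \<in> half_space3 a b (- c)" unfolding half_space3_def by blast
  next
    fix x assume "x \<in> half_space3 a b (- c)"
    then obtain r s t where "x = r *\<^sub>R a + s *\<^sub>R b + t *\<^sub>R (- c)" "0 \<le> t" unfolding half_space3_def by blast
    then have "x = - ((- r) *\<^sub>R a + (- s) *\<^sub>R b + t *\<^sub>R c)" "0 \<le> t" by simp_all
    then show "x \<in> uminus ` half_space3 a b c" unfolding half_space3_def by blast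
  qed
  have "solid_angle (half_space3 a b (- c)) = solid_angle (half_space3 a b c)"
    using solid_angle_orthogonal_image[OF orthogonal_transformation_uminus ms] im by metis
  moreover have "half_space3 a b c \<union> half_space3 a b (- c) = UNIV"
  proof -
    have "x \<in> half_space3 a b c \<union> half_space3 a b (- c)" for x
    proof -
      obtain r s t where x: "x = r *\<^sub>R a + s *\<^sub>R b + t *\<^sub>R c"
        by (rule lin_indep3E[OF assms]) simp
      then have "x = r *\<^sub>R a + s *\<^sub>R b + (- t) *\<^sub>R (- c)" by simp
      moreover have "0 \<le> t \<or> 0 \<le> - t" by linarith
      ultimately show ?thesis unfolding half_space3_def using x by blast
    qed
    then show ?thesis by blast
  qed
  moreover have "negligible (half_space3 a b c \<inter> half_space3 a b (- c))"
  proof (rule negligible_subset[OF negligible_span_2])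
    show "half_space3 a b c \<inter> half_space3 a b (- c) \<subseteq> span {a, b}"
    proof
      fix x assume "x \<in> half_space3 a b c \<inter> half_space3 a b (- c)"
      then obtain r s t r' s' t' where x: "x = r *\<^sub>R a + s *\<^sub>R b + t *\<^sub>R c" "x = r' *\<^sub>R a + s' *\<^sub>R b + t' *\<^sub>R (- c)"
        "0 \<le> t" "0 \<le> t'"
        unfolding half_space3_def by blast
      have "r *\<^sub>R a + s *\<^sub>R b + t *\<^sub>R c = r' *\<^sub>R a + s' *\<^sub>R b + (- t') *\<^sub>R c" using x by simp
      then have "t = - t'" using lin_indep3_coords[OF assms] by blast
      then have "t = 0" using x(3,4) by simp
      then have "x = r *\<^sub>R a + s *\<^sub>R b" using x(1) by simp
      then show "x \<in> span {a, b}" using mem_span_2 by simp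
    qed
  qed
  ultimately show ?thesis
    using solid_angle_Un[OF ms ms, of a b c a b "- c"] by simp
qed

lemma tri_cone_perm:
  "tri_cone b a c = tri_cone a b c" "tri_cone a c b = tri_cone a b c"
  by (metis conic_hull_triangle insert_commute)+

text \<open>Girard's theorem. A wedge is the union of two of the eight octants spanned by \<open>\<plusminus>a\<close>, \<open>\<plusminus>b\<close>, \<open>\<plusminus>c\<close>,
  and by antipodal symmetry four of the octants make up a half space.\<close>

theorem girard:
  fixes a b c :: "real^3"
  assumes ind: "lin_indep3 a b c"
  shows "solid_angle (wedge a b c) + solid_angle (wedge b a c) + solid_angle (wedge c a b) =
    2 * solid_angle (tri_cone a b c) + 1/2"
proof -
  have "solid_angle (wedge a b c) = solid_angle (tri_cone a b c) + solid_angle (tri_cone (- a) b c)"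
    by (rule solid_angle_wedge_split[OF ind])
  moreover have "solid_angle (wedge b a c) = solid_angle (tri_cone a b c) + solid_angle (tri_cone a (- b) c)"
    using solid_angle_wedge_split[OF lin_indep3_perm(1)[OF ind]] by (simp add: tri_cone_perm(1))
  moreover have "solid_angle (wedge c a b) = solid_angle (tri_cone a b c) + solid_angle (tri_cone a b (- c))"
    using solid_angle_wedge_split[OF lin_indep3_perm(4)[OF ind]]
      tri_cone_perm(1)[of c a b] tri_cone_perm(1)[of "- c" a b] by (simp add: tri_cone_perm(2))
  moreover have "1/2 = solid_angle (wedge a b c) + solid_angle (wedge a (- b) c)"
  proof -
    have indb: "lin_indep3 a (- b) c" using ind lin_indep3_perm(1) lin_indep3_uminus by blast
    have "half_space3 a b c = wedge a b c \<union> wedge a (- b) c"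
    proof (intro equalityI subsetI)
      fix x assume "x \<in> half_space3 a b c"
      then obtain r s t where x: "x = r *\<^sub>R a + s *\<^sub>R b + t *\<^sub>R c" "0 \<le> t"
        unfolding half_space3_def by blast
      have "x = r *\<^sub>R a + (- s) *\<^sub>R (- b) + t *\<^sub>R c" using x by simp
      moreover have "0 \<le> s \<or> 0 \<le> - s" by linarith
      ultimately show "x \<in> wedge a b c \<union> wedge a (- b) c"
        unfolding wedge_def using x by blast
    next
      fix x assume "x \<in> wedge a b c \<union> wedge a (- b) c"
      then show "x \<in> half_space3 a b c"
      proof
        assume "x \<in> wedge a (- b) c"
        then obtain r s t where x: "x = r *\<^sub>R a + s *\<^sub>R (- b) + t *\<^sub>R c" "0 \<le> t"
          unfolding wedge_def by blast
        then have "x = r *\<^sub>R a + (- s) *\<^sub>R b + t *\<^sub>R c" by simp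
        then show ?thesis unfolding half_space3_def using x by blast
      qed (auto simp: half_space3_def wedge_def)
    qed
    moreover have "negligible (wedge a b c \<inter> wedge a (- b) c)"
    proof (rule negligible_subset[OF negligible_span_2])
      show "wedge a b c \<inter> wedge a (- b) c \<subseteq> span {a, c}"
      proof
        fix x assume "x \<in> wedge a b c \<inter> wedge a (- b) c"
        then obtain r s t r' s' t' where x: "x = r *\<^sub>R a + s *\<^sub>R b + t *\<^sub>R c" "x = r' *\<^sub>R a + s' *\<^sub>R (- b) + t' *\<^sub>R c"
          "0 \<le> s" "0 \<le> s'"
          unfolding wedge_def by blast
        have "r *\<^sub>R a + s *\<^sub>R b + t *\<^sub>R c = r' *\<^sub>R a + (- s') *\<^sub>R b + t' *\<^sub>R c" using x by simp
        then have "s = - s'" using lin_indep3_coords[OF ind] by blast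
        then have "s = 0" using x(3,4) by simp
        then have "x = r *\<^sub>R a + t *\<^sub>R c" using x(1) by simp
        then show "x \<in> span {a, c}" using mem_span_2 by simp
      qed
    qed
    ultimately show ?thesis
      using solid_angle_half_space3[OF ind] solid_angle_Un convex_sets_lebesgue[OF convex_wedge] by metis
  qed
  moreover have "solid_angle (wedge a (- b) c) = solid_angle (tri_cone a (- b) c) + solid_angle (tri_cone a b (- c))"
  proof -
    have indb: "lin_indep3 a (- b) c" using ind lin_indep3_perm(1) lin_indep3_uminus by blast
    \<comment> \<open>The octant of \<open>- a\<close>, \<open>- b\<close>, \<open>c\<close> is
      traded for its antipode, the one that \<open>wedge c a b\<close> adds to the triangle. The
      half space thus consists, in measure, of the triangle and its three neighbours.\<close>
    have "uminus ` tri_cone a b (- c) = tri_cone (- a) (- b) c"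
    proof (intro equalityI subsetI)
      fix x assume "x \<in> uminus ` tri_cone a b (- c)"
      then obtain r s t where "x = - (r *\<^sub>R a + s *\<^sub>R b + t *\<^sub>R (- c))" "0 \<le> r" "0 \<le> s" "0 \<le> t"
        unfolding tri_cone_def by blast
      moreover from this have "x = r *\<^sub>R (- a) + s *\<^sub>R (- b) + t *\<^sub>R c" by simp
      ultimately show "x \<in> tri_cone (- a) (- b) c" unfolding tri_cone_def by blast
    next
      fix x assume "x \<in> tri_cone (- a) (- b) c"
      then obtain r s t where "x = r *\<^sub>R (- a) + s *\<^sub>R (- b) + t *\<^sub>R c" "0 \<le> r" "0 \<le> s" "0 \<le> t"
        unfolding tri_cone_def by blast
      moreover from this have "x = - (r *\<^sub>R a + s *\<^sub>R b + t *\<^sub>R (- c))" by simp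
      ultimately show "x \<in> uminus ` tri_cone a b (- c)" unfolding tri_cone_def by blast
    qed
    then have "solid_angle (tri_cone (- a) (- b) c) = solid_angle (tri_cone a b (- c))"
      using solid_angle_orthogonal_image[OF orthogonal_transformation_uminus convex_sets_lebesgue[OF convex_tri_cone]]
      by metis
    then show ?thesis using solid_angle_wedge_split[OF indb] by simp
  qed
  ultimately show ?thesis by linarith
qed

text \<open>Strict Cauchy-Schwarz for the components \<open>a0\<close>, \<open>b0\<close> orthogonal
  to \<open>v\<close>, which stay independent: the nonzero vector
  \<open>A *\<^sub>R b0 - C *\<^sub>R a0\<close> has squared norm
  \<open>A * (A * B - C\<^sup>2)\<close>.\<close>

lemma lin_indep3_gram_pos:
  fixes a b c :: "'a::real_inner"
  assumes ind: "lin_indep3 v a b" and v: "v \<bullet> v = 1"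
  shows "a \<bullet> a - (v \<bullet> a)\<^sup>2 > 0"
    and "(a \<bullet> b - (v \<bullet> a) * (v \<bullet> b))\<^sup>2 < (a \<bullet> a - (v \<bullet> a)\<^sup>2) * (b \<bullet> b - (v \<bullet> b)\<^sup>2)"
proof -
  define a0 where "a0 = a - (v \<bullet> a) *\<^sub>R v"
  define b0 where "b0 = b - (v \<bullet> b) *\<^sub>R v"
  define A B C where "A = a \<bullet> a - (v \<bullet> a)\<^sup>2" and "B = b \<bullet> b - (v \<bullet> b)\<^sup>2"
    and "C = a \<bullet> b - (v \<bullet> a) * (v \<bullet> b)"
  have ip: "a0 \<bullet> a0 = A" "b0 \<bullet> b0 = B" "a0 \<bullet> b0 = C" "b0 \<bullet> a0 = C"
    using v by (simp_all add: a0_def b0_def A_def B_def C_def inner_diff power2_eq_square inner_commute algebra_simps)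
  have li: "x = 0 \<and> y = 0" if "x *\<^sub>R a0 + y *\<^sub>R b0 = 0" for x y
  proof -
    have "(- x * (v \<bullet> a) - y * (v \<bullet> b)) *\<^sub>R v + x *\<^sub>R a + y *\<^sub>R b = 0"
      using that by (simp add: a0_def b0_def algebra_simps)
    then show ?thesis using ind unfolding lin_indep3_def by blast
  qed
  have "a0 \<noteq> 0" using li[of 1 0] by auto
  then show A: "a \<bullet> a - (v \<bullet> a)\<^sup>2 > 0" using ip(1) inner_gt_zero_iff[of a0] by (simp add: A_def)
  have "A *\<^sub>R b0 - C *\<^sub>R a0 \<noteq> 0" using li[of "- C" A] A by (auto simp: A_def algebra_simps)
  then have "0 < (A *\<^sub>R b0 - C *\<^sub>R a0) \<bullet> (A *\<^sub>R b0 - C *\<^sub>R a0)" by simp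
  also have "\<dots> = A * (A * B - C\<^sup>2)"
    by (simp add: inner_diff ip power2_eq_square algebra_simps)
  finally have "0 < A * B - C\<^sup>2" using A by (simp add: A_def zero_less_mult_iff)
  then show "(a \<bullet> b - (v \<bullet> a) * (v \<bullet> b))\<^sup>2 < (a \<bullet> a - (v \<bullet> a)\<^sup>2) * (b \<bullet> b - (v \<bullet> b)\<^sup>2)"
    by (simp add: A_def B_def C_def)
qed

section \<open>Polytopes with congruent isosceles facets\<close>

text \<open>\<open>k\<close> counts the apexes at a vertex, \<open>l\<close> is half the number of
  base corners there and \<open>\<gamma>\<close> is twice the base angle, so both sums equal
  \<open>N\<close>. Hence \<open>k\<close> and \<open>l\<close> agree everywhere or differ strictly
  in both directions, and each direction confines one of the two angles.\<close>

lemma counting_isosceles: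
  fixes k l :: "'a \<Rightarrow> nat" and \<alpha> \<gamma> :: real
  assumes V: "finite V" and N: "N + 4 = 2 * card V" "card V \<le> 8"
    and pos: "0 < \<alpha>" "\<alpha> < 1/2" "0 < \<gamma>" "\<gamma> < 1"
    and s: "\<alpha> + \<gamma> = 2 / real N + 1/2"
    and v: "\<And>v. v \<in> V \<Longrightarrow> real (k v) * \<alpha> + real (l v) * \<gamma> = 1"
    and sums: "sum k V = N" "sum l V = N"
  shows "N = 4 \<or> \<gamma> = 1/2 \<and> \<alpha> = 2 / real N \<or> N = 12 \<and> \<alpha> = 1/3 \<and> \<gamma> = 1/3"
proof (cases "N = 4")
  case False
  have "N \<noteq> 0"
  proof
    assume "N = 0"
    then have "\<forall>v\<in>V. k v = 0" "\<forall>v\<in>V. l v = 0" using sums V by auto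
    moreover have "V \<noteq> {}" using N(1) by auto
    ultimately show False using v by fastforce
  qed
  moreover have "N \<noteq> 2"
  proof
    assume "N = 2"
    then show False using s pos by simp
  qed
  moreover have "even (N + 4)" "N \<le> 12" using N by simp_all
  then have "even N" by simp
  ultimately have "N \<ge> 6" using False \<open>N \<le> 12\<close> by presburger
  then have N6: "2 / real N \<le> 1/3" "1/6 \<le> 2 / real N"
    using \<open>N \<le> 12\<close> by (simp_all add: field_simps)
  define s where "s = \<alpha> + \<gamma>"
  have s: "s = 2 / real N + 1/2" "2/3 \<le> s" "s \<le> 5/6" using s N6 by (simp_all add: s_def)
  have vs: "real (l v) * s + (real (k v) - real (l v)) * \<alpha> = 1"
    "real (k v) * s + (real (l v) - real (k v)) * \<gamma> = 1" if "v \<in> V" for v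
    using v[OF that] by (simp_all add: s_def algebra_simps)
  have two: "n < 2" if "real n * s \<le> 1" for n :: nat
  proof (rule ccontr)
    assume "\<not> n < 2"
    then have "2 * s \<le> real n * s" using s by (intro mult_right_mono) auto
    then show False using that s by linarith
  qed
  \<comment> \<open>Equality would make an integer multiple of \<open>s\<close> equal to 1, but
    \<open>s\<close> lies between 2/3 and 5/6.\<close>
  have ne: "k v \<noteq> l v" if "v \<in> V" for v
  proof
    assume "k v = l v"
    then have e: "real (k v) * s = 1" using vs[OF that] by simp
    then have "k v < 2" using two by simp
    then have "k v = 0 \<or> k v = 1" by linarith
    then show False using e s by auto
  qed
  have "\<exists>v\<in>V. l v < k v"
  proof (rule ccontr)
    assume "\<not> ?thesis"
    then have le: "\<And>v. v \<in> V \<Longrightarrow> k v \<le> l v" by force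
    obtain v where "v \<in> V" using N(1) by fastforce
    then have "k v < l v" using ne[of v] le[of v] by simp
    then have "sum k V < sum l V"
      using V le \<open>v \<in> V\<close> by (intro sum_strict_mono_ex1) auto
    then show False using sums by simp
  qed
  then obtain v where v1: "v \<in> V" "l v < k v" by blast
  have "\<exists>v\<in>V. k v < l v"
  proof (rule ccontr)
    assume "\<not> ?thesis"
    then have le: "\<And>v. v \<in> V \<Longrightarrow> l v \<le> k v" by force
    obtain v where "v \<in> V" using N(1) by fastforce
    then have "l v < k v" using ne[of v] le[of v] by simp
    then have "sum l V < sum k V"
      using V le \<open>v \<in> V\<close> by (intro sum_strict_mono_ex1) auto
    then show False using sums by simp
  qed
  then obtain w where w: "w \<in> V" "k w < l w" by blast
  \<comment> \<open>A vertex with more apexes than base pairs has at most one base pair, which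
    forces \<open>\<alpha> \<le> 1/3\<close> and thereby bounds \<open>\<gamma>\<close> from
    below.\<close>
  have "0 \<le> (real (k v) - real (l v)) * \<alpha>" using v1 pos by simp
  then have "real (l v) * s \<le> 1" using vs(1)[OF v1(1)] by linarith
  then have "l v = 0 \<or> l v = 1" using two by fastforce
  then have \<alpha>: "\<alpha> \<le> 1/3"
  proof
    assume "l v = 0"
    then have k: "real (k v) * \<alpha> = 1" using vs(1)[OF v1(1)] by simp
    have "3 \<le> k v"
    proof (rule ccontr)
      assume "\<not> 3 \<le> k v"
      then have "real (k v) * \<alpha> \<le> 2 * \<alpha>" using pos by (intro mult_right_mono) auto
      then show False using k pos by linarith
    qed
    then have "3 * \<alpha> \<le> real (k v) * \<alpha>" using pos by (intro mult_right_mono) auto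
    then show ?thesis using k by linarith
  next
    assume l: "l v = 1"
    then have "(real (k v) - 1) * \<alpha> = 1 - s" using vs(1)[OF v1(1)] by simp
    moreover have "1 * \<alpha> \<le> (real (k v) - 1) * \<alpha>" using v1(2) l pos by (intro mult_right_mono) auto
    ultimately show ?thesis using s by linarith
  qed
  then have \<gamma>: "1/6 + 2 / real N \<le> \<gamma>" using s by (simp add: s_def)
  have "0 \<le> (real (l w) - real (k w)) * \<gamma>" using w pos by simp
  then have "real (k w) * s \<le> 1" using vs(2)[OF w(1)] by linarith
  then have "k w = 0 \<or> k w = 1" using two by fastforce
  \<comment> \<open>What remains besides \<open>\<gamma> = 1/2\<close> at a vertex with more base
    pairs than apexes. Combined with \<open>1/6 + 2 / real N \<le> \<gamma>\<close>, either
    alternative forces \<open>N \<ge> 12\<close>.\<close>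
  moreover have N12: "N = 12 \<and> \<alpha> = 1/3 \<and> \<gamma> = 1/3" if "\<gamma> = 1/3 \<or> \<gamma> \<le> 1/2 - 2 / real N"
  proof -
    have "2 / real N \<le> 1/6" using that \<gamma> by linarith
    then have "12 \<le> real N" using \<open>N \<ge> 6\<close> by (simp add: field_simps)
    then have N: "N = 12" using \<open>N \<le> 12\<close> by simp
    then have "\<gamma> = 1/3" using that \<gamma> by auto
    then show ?thesis using s N by (simp add: s_def)
  qed
  ultimately show ?thesis
  proof (elim disjE)
    assume "k w = 0"
    then have l: "real (l w) * \<gamma> = 1" using vs(2)[OF w(1)] by simp
    have "l w \<noteq> 1" using l pos by auto
    moreover have "l w \<le> 3"
    proof (rule ccontr)
      assume "\<not> l w \<le> 3"
      then have "4 * \<gamma> \<le> real (l w) * \<gamma>" using pos by (intro mult_right_mono) auto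
      then show False using l \<gamma> N6 by linarith
    qed
    moreover have "l w \<noteq> 0" using l by (cases "l w = 0") auto
    ultimately have "l w = 2 \<or> l w = 3" by linarith
    then show ?thesis
    proof
      assume "l w = 2"
      then have "\<gamma> = 1/2" using l by simp
      then show ?thesis using s by (simp add: s_def)
    next
      assume "l w = 3"
      then have "\<gamma> = 1/3" using l by simp
      then show ?thesis using N12 by blast
    qed
  next
    assume k: "k w = 1"
    then have "(real (l w) - 1) * \<gamma> = 1 - s" using vs(2)[OF w(1)] by simp
    moreover have "1 * \<gamma> \<le> (real (l w) - 1) * \<gamma>" using w(2) k pos by (intro mult_right_mono) auto
    ultimately have "\<gamma> \<le> 1/2 - 2 / real N" using s by linarith
    then show ?thesis using N12 by blast
  qed
qed simp

text \<open>Eliminating \<open>\<alpha>\<close> gives \<open>d * (4 + N) = 6 * N\<close>. Among the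
  even values from 4 to 12 the divisibility holds only for 4 and 8, and \<open>N = 2\<close> would
  make \<open>\<alpha>\<close> equal to 1/2.\<close>

lemma counting_equilateral:
  fixes \<alpha> :: real and d :: nat
  assumes N: "N + 4 = 2 * n" "n \<le> 8" "N \<noteq> 0" and \<alpha>: "\<alpha> < 1/2" "3 * \<alpha> = 2 / real N + 1/2" "real d * \<alpha> = 1"
  shows "N = 4 \<or> N = 8 \<and> \<alpha> = 1/4"
proof -
  have "real d * (3 * \<alpha>) = 3" using \<alpha>(3) by simp
  then have "real d * (2 / real N + 1/2) = 3" by (simp add: \<alpha>(2))
  then have "real d * (4 + real N) = 6 * real N" using N(3) by (simp add: field_simps)
  then have "real (d * (4 + N)) = real (6 * N)" by simp
  then have d: "d * (4 + N) = 6 * N" by (simp only: of_nat_eq_iff)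
  have "N \<noteq> 2" using \<alpha> by auto
  then have "N = 4 \<or> N = 6 \<or> N = 8 \<or> N = 10 \<or> N = 12" using N by presburger
  then show ?thesis using d \<alpha>(2) by (elim disjE) (simp_all, presburger+)
qed

lemma sum_card_fibres:
  assumes "finite I" "finite V" "f ` I \<subseteq> V"
  shows "(\<Sum>v\<in>V. card {i \<in> I. f i = v}) = card I"
proof -
  have "(\<Sum>v\<in>V. \<Sum>i\<in>{i \<in> I. f i = v}. 1::nat) = (\<Sum>i\<in>I. 1)"
    by (rule sum.group[OF assms])
  then show ?thesis by simp
qed

lemma even_card_if_fibres_2:
  assumes "finite I" "\<And>i. i \<in> I \<Longrightarrow> card {j \<in> I. f j = f i} = 2"
  shows "even (card I)"
proof -
  have "card I = (\<Sum>v\<in>f ` I. card {i \<in> I. f i = v})"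
    using sum_card_fibres[of I "f ` I" f] assms(1) by simp
  also have "\<dots> = (\<Sum>v\<in>f ` I. 2)" using assms(2) by (intro sum.cong) auto
  finally show ?thesis by simp
qed

lemma solid_angle_tri_cone_pos:
  fixes a b c :: "real^3"
  assumes ind: "lin_indep3 a b c" and n: "norm a = 1" "norm b = 1" "norm c = 1"
  shows "0 < solid_angle (tri_cone a b c)"
proof -
  \<comment> \<open>Halving moves the corners inside the open unit ball, so that the simplex they
    span with 0 fits into the part of the cone that is measured.\<close>
  let ?h = "\<lambda>x::real^3. (1/2) *\<^sub>R x"
  let ?S = "{?h a, ?h b, ?h c}"
  have ih: "lin_indep3 (?h a) (?h b) (?h c)"
    unfolding lin_indep3_def
  proof (intro allI impI)
    fix r s t assume "r *\<^sub>R ?h a + s *\<^sub>R ?h b + t *\<^sub>R ?h c = 0"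
    then have "(r/2) *\<^sub>R a + (s/2) *\<^sub>R b + (t/2) *\<^sub>R c = 0" by simp
    then have "r/2 = 0 \<and> s/2 = 0 \<and> t/2 = 0" using ind unfolding lin_indep3_def by blast
    then show "r = 0 \<and> s = 0 \<and> t = 0" by simp
  qed
  have D: "DIM(real^3) = 3" by simp
  note sp = lin_indep3_span[OF ih D]
  have "card ?S = DIM(real^3)" using sp(3-5) by simp
  then have "\<exists>x. x \<in> interior (convex hull (insert 0 ?S))"
    using interior_simplex_nonempty[OF sp(2)] by blast
  then have ne: "interior (convex hull (insert 0 ?S)) \<noteq> {}" by blast
  have "insert 0 ?S \<subseteq> tri_cone a b c \<inter> ball 0 1"
  proof -
    have "x \<in> tri_cone a b c" if "x = r *\<^sub>R a + s *\<^sub>R b + t *\<^sub>R c" "0 \<le> r" "0 \<le> s" "0 \<le> t" for x r s t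
      using that unfolding tri_cone_def by blast
    from this[of 0 0 0 0] this[of "?h a" "1/2" 0 0] this[of "?h b" 0 "1/2" 0] this[of "?h c" 0 0 "1/2"]
    show ?thesis using n by simp
  qed
  moreover have cv: "convex (tri_cone a b c \<inter> ball 0 1)" by (intro convex_Int convex_tri_cone convex_ball)
  ultimately have "convex hull (insert 0 ?S) \<subseteq> tri_cone a b c \<inter> ball 0 1" by (rule hull_minimal)
  then have "interior (tri_cone a b c \<inter> ball 0 1) \<noteq> {}" using ne interior_mono by blast
  then have "\<not> negligible (tri_cone a b c \<inter> ball 0 1)"
    by (metis interior_subset negligible_subset open_interior open_not_negligible)
  moreover have "tri_cone a b c \<inter> ball 0 1 \<in> lmeasurable"
    by (rule measurable_convex[OF cv]) (simp add: bounded_Int)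
  ultimately have "measure lebesgue (tri_cone a b c \<inter> ball 0 1) \<noteq> 0" by (simp add: negligible_iff_measure)
  then show ?thesis
    using measure_unit_ball_pos[where 'a="real^3"] by (simp add: solid_angle_def less_le)
qed

text \<open>\<open>A\<close>, \<open>B\<close>, \<open>C\<close> label every facet by apex and base
  corners. As the corners are unit vectors, congruence is recorded by two numbers: \<open>p\<close>
  is the cosine of the leg arcs and \<open>q\<close> that of the base arc. Equilateral facets are
  the case \<open>p = q\<close>, where the choice of apex is arbitrary.\<close>

locale isosceles_polytope =
  fixes P :: "(real^3) set" and A B C :: "(real^3) set \<Rightarrow> real^3" and p q :: real
  assumes polytope: "polytope P" and interior: "interior P \<noteq> {}"
    and hull: "\<And>F. F facet_of P \<Longrightarrow> F = convex hull {A F, B F, C F}"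
    and vert: "\<And>F. F facet_of P \<Longrightarrow> {A F, B F, C F} = vertices P \<inter> F"
    and unit: "\<And>F. F facet_of P \<Longrightarrow> A F \<bullet> A F = 1" "\<And>F. F facet_of P \<Longrightarrow> B F \<bullet> B F = 1"
      "\<And>F. F facet_of P \<Longrightarrow> C F \<bullet> C F = 1"
    and gram: "\<And>F. F facet_of P \<Longrightarrow> A F \<bullet> B F = p" "\<And>F. F facet_of P \<Longrightarrow> A F \<bullet> C F = p"
      "\<And>F. F facet_of P \<Longrightarrow> B F \<bullet> C F = q"
begin

lemma aff_dim_vertices: "F facet_of P \<Longrightarrow> aff_dim {A F, B F, C F} = 2"
proof -
  assume F: "F facet_of P"
  have "aff_dim F = aff_dim P - 1" using F by (simp add: facet_of_def)
  moreover have "aff_dim P = 3" using aff_dim_nonempty_interior[OF interior] by simp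
  moreover have "aff_dim F = aff_dim {A F, B F, C F}" using hull[OF F] aff_dim_convex_hull by metis
  ultimately show ?thesis by simp
qed

lemma affine_hull_facet: "F facet_of P \<Longrightarrow> affine hull F = affine hull {A F, B F, C F}"
  using hull affine_hull_convex_hull by metis

lemma facet_indep: "F facet_of P \<Longrightarrow> 0 \<notin> affine hull F \<Longrightarrow> lin_indep3 (A F) (B F) (C F)"
  using lin_indep3_if_affine[of "A F" "B F" "C F"] aff_dim_vertices affine_hull_facet by simp

lemma facets_isometric:
  assumes F: "F facet_of P" "0 \<notin> affine hull F" and G: "G facet_of P"
  obtains l where "orthogonal_transformation l" "l ` F = G"
proof -
  have "same_gram (A F) (B F) (C F) (A G) (B G) (C G)"
    using unit gram F(1) G by (simp add: same_gram_def)
  then obtain l where l: "orthogonal_transformation l" "l (A F) = A G" "l (B F) = B G" "l (C F) = C G"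
    using orthogonal_transformation_of_gram facet_indep F by metis
  have "l ` (convex hull {A F, B F, C F}) = convex hull (l ` {A F, B F, C F})"
    by (rule convex_hull_linear_image[OF orthogonal_transformation_linear[OF l(1)]])
  then have "l ` F = G" using l hull F(1) G by (metis image_insert image_empty)
  then show ?thesis using that l(1) by blast
qed

text \<open>Facets differ by orthogonal maps, so if the plane of one contains 0, all planes do. The
  ray through a nonzero interior point \<open>z\<close> hits some facet, whose plane then contains
  \<open>z\<close>; but this plane meets \<open>P\<close> only in the facet.\<close>

lemma zero_notin_affine_hull:
  assumes F: "F facet_of P"
  shows "0 \<notin> affine hull F"
proof
  assume 0: "0 \<in> affine hull F"
  have all: "0 \<in> affine hull G" if G: "G facet_of P" for G
  proof (rule ccontr)
    assume n: "0 \<notin> affine hull G"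
    then obtain l where l: "orthogonal_transformation l" "l ` G = F"
      using facets_isometric[OF G n F] by metis
    have lin: "linear l" by (rule orthogonal_transformation_linear[OF l(1)])
    have "affine hull F = l ` (affine hull G)"
      using affine_hull_linear_image[of l G] lin l(2) by (simp add: linear_conv_bounded_linear)
    then obtain x where "x \<in> affine hull G" "l x = 0" using 0 by auto
    moreover have "x = 0" using \<open>l x = 0\<close> orthogonal_transformation_norm[OF l(1), of x] by simp
    ultimately show False using n by simp
  qed
  obtain z where z: "z \<in> interior P" "z \<noteq> 0"
  proof -
    have "interior P \<noteq> {0}" using open_interior[of P] not_open_singleton[of "0::real^3"] by metis
    then have "\<not> interior P \<subseteq> {0}" using interior by (simp only: subset_singleton_iff simp_thms)
    then obtain y where "y \<in> interior P" "y \<noteq> 0" by blast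
    then show ?thesis by (rule that)
  qed
  obtain d where d: "0 < d" "z + d *\<^sub>R z \<in> frontier P"
    using ray_to_frontier[OF polytope_imp_bounded[OF polytope] z] by metis
  obtain G where G: "G facet_of P" "z + d *\<^sub>R z \<in> G"
    using frontier_polytope_facets[OF polytope interior] d(2) by auto
  have "(1 / (1 + d)) *\<^sub>R (z + d *\<^sub>R z) + (d / (1 + d)) *\<^sub>R 0 \<in> affine hull G"
  proof (rule mem_affine[OF affine_affine_hull hull_inc[OF G(2)] all[OF G(1)]])
    show "1 / (1 + d) + d / (1 + d) = 1" using d(1) by (simp add: add_divide_distrib[symmetric])
  qed
  moreover have "(1 / (1 + d)) *\<^sub>R (z + d *\<^sub>R z) = (1 / (1 + d)) *\<^sub>R ((1 + d) *\<^sub>R z)"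
    by (simp add: algebra_simps)
  then have "(1 / (1 + d)) *\<^sub>R (z + d *\<^sub>R z) = z" using d(1) by simp
  ultimately have "z \<in> affine hull G" by simp
  then have "z \<in> G"
    using face_of_imp_eq_affine_Int[OF polytope_imp_convex[OF polytope] facet_of_imp_face_of[OF G(1)]]
      z(1) interior_subset by blast
  then have "z \<in> frontier P" using facet_subset_frontier[OF polytope interior G(1)] by blast
  then show False using z(1) by (simp add: frontier_def)
qed

lemma indep: "F facet_of P \<Longrightarrow> lin_indep3 (A F) (B F) (C F)"
  using facet_indep zero_notin_affine_hull by blast

text \<open>The dihedral angles at the apex and at a base corner as fractions of a full turn, by the
  spherical law of cosines for sides with cosines \<open>p\<close>, \<open>p\<close>,
  \<open>q\<close>.\<close>

definition \<alpha> :: real where "\<alpha> = arccos ((q - p\<^sup>2) / (sqrt (1 - p\<^sup>2) * sqrt (1 - p\<^sup>2))) / (2 * pi)"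
definition \<beta> :: real where "\<beta> = arccos ((p - p * q) / (sqrt (1 - p\<^sup>2) * sqrt (1 - q\<^sup>2))) / (2 * pi)"

lemma facet_exists: "\<exists>F. F facet_of P"
proof -
  have "aff_dim P = 3" using aff_dim_nonempty_interior[OF interior] by simp
  then show ?thesis using polytope_facet_exists[OF polytope] by auto
qed

lemma gram_pos:
  shows "1 - p\<^sup>2 > 0" "1 - q\<^sup>2 > 0" "(q - p\<^sup>2)\<^sup>2 < (1 - p\<^sup>2) * (1 - p\<^sup>2)"
    "(p - p * q)\<^sup>2 < (1 - p\<^sup>2) * (1 - q\<^sup>2)"
proof -
  obtain F where F: "F facet_of P" using facet_exists by blast
  note g = unit[OF F] gram[OF F]
  have g': "B F \<bullet> A F = p" "C F \<bullet> A F = p" "C F \<bullet> B F = q" using g by (simp_all add: inner_commute)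
  show "1 - p\<^sup>2 > 0" "(q - p\<^sup>2)\<^sup>2 < (1 - p\<^sup>2) * (1 - p\<^sup>2)"
    using lin_indep3_gram_pos[OF indep[OF F] g(1)] g g' by (simp_all add: power2_eq_square)
  show "1 - q\<^sup>2 > 0"
    using lin_indep3_gram_pos(1)[OF lin_indep3_perm(3)[OF indep[OF F]] g(2)] g g' by simp
  show "(p - p * q)\<^sup>2 < (1 - p\<^sup>2) * (1 - q\<^sup>2)"
    using lin_indep3_gram_pos(2)[OF lin_indep3_perm(1)[OF indep[OF F]] g(2)] g g' by simp
qed

lemma solid_angles:
  assumes F: "F facet_of P"
  shows "solid_angle (wedge (A F) (B F) (C F)) = \<alpha>" "solid_angle (wedge (B F) (A F) (C F)) = \<beta>"
    "solid_angle (wedge (C F) (A F) (B F)) = \<beta>"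
proof -
  note g = unit[OF F] gram[OF F]
  have g': "B F \<bullet> A F = p" "C F \<bullet> A F = p" "C F \<bullet> B F = q" using g by (simp_all add: inner_commute)
  show "solid_angle (wedge (A F) (B F) (C F)) = \<alpha>" unfolding \<alpha>_def
    by (rule solid_angle_wedge) (use g g' gram_pos in \<open>simp_all add: power2_eq_square[of p]\<close>)
  show "solid_angle (wedge (B F) (A F) (C F)) = \<beta>" unfolding \<beta>_def
    by (rule solid_angle_wedge) (use g g' gram_pos in \<open>simp_all\<close>)
  show "solid_angle (wedge (C F) (A F) (B F)) = \<beta>" unfolding \<beta>_def
    by (rule solid_angle_wedge) (use g g' gram_pos in \<open>simp_all\<close>)
qed

lemma abs_lt_1:
  "\<bar>(q - p\<^sup>2) / (sqrt (1 - p\<^sup>2) * sqrt (1 - p\<^sup>2))\<bar> < 1" (is "\<bar>?X\<bar> < 1")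
  "\<bar>(p - p * q) / (sqrt (1 - p\<^sup>2) * sqrt (1 - q\<^sup>2))\<bar> < 1" (is "\<bar>?Y\<bar> < 1")
proof -
  have "?X\<^sup>2 = (q - p\<^sup>2)\<^sup>2 / ((1 - p\<^sup>2) * (1 - p\<^sup>2))" "?Y\<^sup>2 = (p - p * q)\<^sup>2 / ((1 - p\<^sup>2) * (1 - q\<^sup>2))"
    using gram_pos(1,2) by (simp_all add: power_divide power_mult_distrib power2_eq_square[of "1 - p\<^sup>2"])
  then have "?X\<^sup>2 < 1" "?Y\<^sup>2 < 1" using gram_pos by simp_all
  then show "\<bar>?X\<bar> < 1" "\<bar>?Y\<bar> < 1" by (simp_all add: abs_square_less_1)
qed

lemma angle_bounds: "0 < \<alpha>" "\<alpha> < 1/2" "0 < \<beta>" "\<beta> < 1/2"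
proof -
  have *: "0 < arccos x / (2 * pi)" "arccos x / (2 * pi) < 1/2" if "\<bar>x\<bar> < 1" for x
    using that arccos_lt_bounded[of x] pi_gt_zero by (auto simp: abs_less_iff field_simps)
  show "0 < \<alpha>" "\<alpha> < 1/2" "0 < \<beta>" "\<beta> < 1/2" unfolding \<alpha>_def \<beta>_def using *[OF abs_lt_1(1)] *[OF abs_lt_1(2)] by auto
qed

lemma cos_angles:
  "cos (2 * pi * \<alpha>) * (1 - p\<^sup>2) = q - p\<^sup>2"
  "cos (2 * pi * \<beta>) * (sqrt (1 - p\<^sup>2) * sqrt (1 - q\<^sup>2)) = p - p * q"
proof -
  have "cos (2 * pi * \<alpha>) = (q - p\<^sup>2) / (sqrt (1 - p\<^sup>2) * sqrt (1 - p\<^sup>2))"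
    using abs_lt_1(1) by (simp only: \<alpha>_def) (simp add: cos_arccos_abs)
  then show "cos (2 * pi * \<alpha>) * (1 - p\<^sup>2) = q - p\<^sup>2" using gram_pos(1) by simp
  have "cos (2 * pi * \<beta>) = (p - p * q) / (sqrt (1 - p\<^sup>2) * sqrt (1 - q\<^sup>2))"
    using abs_lt_1(2) by (simp only: \<beta>_def) (simp add: cos_arccos_abs)
  then show "cos (2 * pi * \<beta>) * (sqrt (1 - p\<^sup>2) * sqrt (1 - q\<^sup>2)) = p - p * q"
    using gram_pos(1,2) by simp
qed

text \<open>Girard's formula solved for the solid angle of a facet.\<close>

definition \<omega> :: real where "\<omega> = (\<alpha> + 2 * \<beta> - 1/2) / 2"

lemma solid_angle_facet:
  assumes F: "F facet_of P"
  shows "solid_angle (conic hull F) = \<omega>"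
proof -
  have "conic hull F = tri_cone (A F) (B F) (C F)" using hull[OF F] conic_hull_triangle by metis
  then show ?thesis using girard[OF indep[OF F]] solid_angles[OF F] by (simp add: \<omega>_def)
qed

lemma facet_norm: "F facet_of P \<Longrightarrow> norm (A F) = 1" "F facet_of P \<Longrightarrow> norm (B F) = 1"
    "F facet_of P \<Longrightarrow> norm (C F) = 1"
  using unit by (simp_all add: norm_eq_1)

lemma \<omega>_pos: "\<omega> > 0"
proof -
  obtain F where F: "F facet_of P" using facet_exists by blast
  have "solid_angle (conic hull F) = solid_angle (tri_cone (A F) (B F) (C F))"
    using hull[OF F] conic_hull_triangle by metis
  then show ?thesis
    using solid_angle_tri_cone_pos[OF indep[OF F] facet_norm(1)[OF F] facet_norm(2)[OF F] facet_norm(3)[OF F]] solid_angle_facet[OF F] by simp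
qed

lemma interior_0: "0 \<in> interior P"
proof -
  obtain F where F: "F facet_of P" using facet_exists by blast
  show ?thesis
  proof (rule interior_0_if_uniform_facets[OF polytope interior zero_notin_affine_hull solid_angle_facet \<omega>_pos])
    fix G assume G: "G facet_of P"
    obtain l where l: "orthogonal_transformation l" "l ` F = G"
      using facets_isometric[OF F zero_notin_affine_hull[OF F] G] by blast
    have lin: "linear l" by (rule orthogonal_transformation_linear[OF l(1)])
    have "l ` (convex hull (insert 0 F)) = convex hull (insert 0 G)"
      using convex_hull_linear_image[OF lin, of "insert 0 F"] l(2) linear_0[OF lin] by simp
    moreover have "compact F"
      using F polytope face_of_imp_compact facet_of_imp_face_of polytope_imp_compact polytope_imp_convex by blast
    then have "convex hull (insert 0 F) \<in> lmeasurable"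
      by (intro lmeasurable_compact compact_convex_hull compact_insert)
    ultimately show "measure lebesgue (convex hull (insert 0 G)) = measure lebesgue (convex hull (insert 0 F))"
      using measure_orthogonal_image[OF l(1)] by metis
  qed
qed

section \<open>Counting facets at vertices and along base edges\<close>

abbreviation \<F> :: "(real^3) set set" where "\<F> \<equiv> {F. F facet_of P}"

lemma finite_facets: "finite \<F>"
  by (rule finite_polytope_facets[OF polytope])

lemma finite_vertices: "finite (vertices P)"
  unfolding vertices_def by (rule finite_polyhedron_extreme_points[OF polytope_imp_polyhedron[OF polytope]])

lemma distinct_vertices:
  assumes F: "F facet_of P"
  shows "A F \<noteq> B F" "A F \<noteq> C F" "B F \<noteq> C F"
  using lin_indep3_span(3-5)[OF indep[OF F]] by simp_all

lemma facet_sum: "real (card \<F>) * \<omega> = 1"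
  using sum_solid_angle_facets[OF polytope interior_0] solid_angle_facet by simp

lemma vertex_in_facet:
  assumes v: "v \<in> vertices P" and F: "F facet_of P"
  shows "v \<in> F \<longleftrightarrow> v = A F \<or> v = B F \<or> v = C F"
  using vert[OF F] v by blast

lemma vertices_subset: "F facet_of P \<Longrightarrow> {A F, B F, C F} \<subseteq> vertices P"
  using vert by blast

lemma vertex_in_frontier: "v \<in> vertices P \<Longrightarrow> v \<in> frontier P"
proof -
  assume v: "v \<in> vertices P"
  then have "v extreme_point_of P" by (simp add: vertices_def)
  then have "v \<in> P" "v \<notin> interior P"
    using extreme_point_not_in_interior by (auto simp: extreme_point_of_def)
  then show ?thesis using closure_subset by (auto simp: frontier_def)
qed

definition apex_count :: "real^3 \<Rightarrow> nat" where "apex_count v = card {F \<in> \<F>. A F = v}"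
definition base_count :: "real^3 \<Rightarrow> nat" where "base_count v = card {F \<in> \<F>. B F = v} + card {F \<in> \<F>. C F = v}"

text \<open>The wedges of the facets at \<open>v\<close> fill space, and \<open>v\<close> has
  exactly one of the roles apex, first or second base corner in each of them.\<close>

lemma vertex_sum:
  assumes v: "v \<in> vertices P"
  shows "real (apex_count v) * \<alpha> + real (base_count v) * \<beta> = 1"
proof -
  let ?S = "\<lambda>X. {F \<in> \<F>. X F = v}"
  have eq: "{F. F facet_of P \<and> v \<in> F} = ?S A \<union> (?S B \<union> ?S C)"
    using vertex_in_facet[OF v] by blast
  have f: "finite (?S X)" for X using finite_facets by simp
  have d: "?S A \<inter> (?S B \<union> ?S C) = {}" "?S B \<inter> ?S C = {}"
    by (auto simp: distinct_vertices distinct_vertices[THEN not_sym])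
  have s: "(\<Sum>F\<in>?S A. solid_angle (line_cone v F)) = real (apex_count v) * \<alpha>"
  proof -
    have "solid_angle (line_cone v F) = \<alpha>" if "F \<in> ?S A" for F
      using that hull[of F] line_cone_triangle[of "A F" "B F" "C F"] solid_angles(1)[of F] by auto
    then show ?thesis by (simp add: apex_count_def)
  qed
  have sB: "(\<Sum>F\<in>?S B. solid_angle (line_cone v F)) = real (card (?S B)) * \<beta>"
  proof -
    have "solid_angle (line_cone v F) = \<beta>" if "F \<in> ?S B" for F
      using that hull[of F] line_cone_triangle[of "B F" "A F" "C F"] solid_angles(2)[of F]
      by (auto simp: insert_commute)
    then show ?thesis by simp
  qed
  have sC: "(\<Sum>F\<in>?S C. solid_angle (line_cone v F)) = real (card (?S C)) * \<beta>"
  proof -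
    have "solid_angle (line_cone v F) = \<beta>" if "F \<in> ?S C" for F
      using that hull[of F] line_cone_triangle[of "C F" "A F" "B F"] solid_angles(3)[of F]
      by (auto simp: insert_commute)
    then show ?thesis by simp
  qed
  have "1 = (\<Sum>F\<in>?S A \<union> (?S B \<union> ?S C). solid_angle (line_cone v F))"
    using sum_solid_angle_line_cone[OF polytope interior_0 vertex_in_frontier[OF v]] unfolding eq by simp
  also have "\<dots> = real (apex_count v) * \<alpha> + (real (card (?S B)) * \<beta> + real (card (?S C)) * \<beta>)"
    using f d s sB sC by (simp add: sum.union_disjoint)
  finally show ?thesis by (simp add: base_count_def algebra_simps)
qed

lemma sum_apex_count: "sum apex_count (vertices P) = card \<F>"
  unfolding apex_count_def using vertices_subset by (intro sum_card_fibres finite_facets finite_vertices) auto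

lemma sum_base_count: "sum base_count (vertices P) = 2 * card \<F>"
proof -
  have "(\<Sum>v\<in>vertices P. card {F \<in> \<F>. B F = v}) = card \<F>" "(\<Sum>v\<in>vertices P. card {F \<in> \<F>. C F = v}) = card \<F>"
    by (intro sum_card_fibres finite_facets finite_vertices; use vertices_subset in auto)+
  then show ?thesis unfolding base_count_def by (simp add: sum.distrib)
qed

text \<open>Double counting of angles: every vertex contributes 1 and every facet
  \<open>\<alpha> + 2 * \<beta>\<close>, which is \<open>2 * \<omega> + 1/2\<close> by Girard. As
  the \<open>\<omega>\<close> add up to 1, the number of vertices is 2 plus half the number of
  facets.\<close>

lemma card_facets: "card \<F> + 4 = 2 * card (vertices P)" "card \<F> > 0"
proof -
  show n0: "card \<F> > 0" using facet_sum by (cases "card \<F>") auto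
  have "real (card (vertices P)) = (\<Sum>v\<in>vertices P. real (apex_count v) * \<alpha> + real (base_count v) * \<beta>)"
    using vertex_sum by simp
  also have "\<dots> = real (sum apex_count (vertices P)) * \<alpha> + real (sum base_count (vertices P)) * \<beta>"
    by (simp add: sum.distrib sum_distrib_right)
  also have "\<dots> = real (card \<F>) * (2 * \<omega> + 1/2)"
    by (simp add: sum_apex_count sum_base_count \<omega>_def field_simps)
  also have "\<dots> = 2 * (real (card \<F>) * \<omega>) + real (card \<F>) / 2" by (simp add: field_simps)
  also have "\<dots> = 2 + real (card \<F>) / 2" unfolding facet_sum by simp
  finally have "real (card \<F> + 4) = real (2 * card (vertices P))" by (simp add: field_simps)
  then show "card \<F> + 4 = 2 * card (vertices P)" by (simp only: of_nat_eq_iff)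
qed

lemma angle_sum: "\<alpha> + 2 * \<beta> = 2 / real (card \<F>) + 1/2"
proof -
  have "\<omega> = 1 / real (card \<F>)" using facet_sum card_facets(2) by (simp add: field_simps)
  then show ?thesis by (simp add: \<omega>_def field_simps)
qed

text \<open>The facets containing the midpoint of an edge are those containing the edge, and each of them
  subtends a half space there.\<close>

lemma base_edge_in_two_facets:
  assumes F: "F facet_of P"
  shows "card {G \<in> \<F>. B F \<in> G \<and> C F \<in> G} = 2"
proof -
  define w where "w = (1/2) *\<^sub>R B F + (1/2) *\<^sub>R C F"
  have BC: "B F \<in> F" "C F \<in> F" using vert[OF F] by auto
  have wF: "w \<in> F" unfolding w_def
    using BC convex_facet[OF polytope_imp_convex[OF polytope] F] by (simp add: convexD)
  have "w \<in> frontier P" using facet_subset_frontier[OF polytope interior F] wF by blast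
  then have sum: "(\<Sum>G\<in>{G. G facet_of P \<and> w \<in> G}. solid_angle (line_cone w G)) = 1"
    by (rule sum_solid_angle_line_cone[OF polytope interior_0])
  have eq: "{G. G facet_of P \<and> w \<in> G} = {G \<in> \<F>. B F \<in> G \<and> C F \<in> G}"
  proof (intro equalityI subsetI)
    fix G assume "G \<in> {G. G facet_of P \<and> w \<in> G}"
    then have G: "G facet_of P" "w \<in> G" by auto
    \<comment> \<open>The midpoint lies in the relative interior of the edge, so a face through it
      contains both ends.\<close>
    have "w \<in> open_segment (B F) (C F)"
      unfolding in_segment w_def using distinct_vertices(3)[OF F] by (intro conjI exI[of _ "1/2"]) auto
    then show "G \<in> {G \<in> \<F>. B F \<in> G \<and> C F \<in> G}"
      using face_ofD[OF facet_of_imp_face_of[OF G(1)]] G BC facet_of_imp_subset[OF F] by blast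
  next
    fix G assume "G \<in> {G \<in> \<F>. B F \<in> G \<and> C F \<in> G}"
    then show "G \<in> {G. G facet_of P \<and> w \<in> G}"
      unfolding w_def using convex_facet[OF polytope_imp_convex[OF polytope]] by (auto intro: convexD)
  qed
  have "solid_angle (line_cone w G) = 1/2" if "G \<in> {G \<in> \<F>. B F \<in> G \<and> C F \<in> G}" for G
  proof -
    have G: "G facet_of P" "B F \<in> G" "C F \<in> G" using that by auto
    have "B F \<in> {A G, B G, C G}" "C F \<in> {A G, B G, C G}"
      using vertices_subset[OF F] vertex_in_facet[OF _ G(1)] G by auto
    then obtain a where a: "{A G, B G, C G} = {B F, C F, a}" "lin_indep3 (B F) (C F) a"
    proof -
      note bc = \<open>B F \<in> {A G, B G, C G}\<close> \<open>C F \<in> {A G, B G, C G}\<close>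
      show ?thesis
        using bc that[of "A G"] that[of "B G"] that[of "C G"]
          distinct_vertices(3)[OF F] lin_indep3_perm[OF indep[OF G(1)]] indep[OF G(1)]
        by (auto simp: insert_commute)
    qed
    have "line_cone w G = half_space3 (B F) (C F) a"
      using line_cone_triangle_edge[OF w_def, of a] hull[OF G(1)] a(1) by simp
    then show ?thesis using solid_angle_half_space3[OF a(2)] by simp
  qed
  then have "(\<Sum>G\<in>{G \<in> \<F>. B F \<in> G \<and> C F \<in> G}. solid_angle (line_cone w G)) =
      (\<Sum>G\<in>{G \<in> \<F>. B F \<in> G \<and> C F \<in> G}. 1/2)"
    by (rule sum.cong[OF refl])
  then have "real (card {G \<in> \<F>. B F \<in> G \<and> C F \<in> G}) * (1/2) = 1" using sum unfolding eq by simp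
  then show ?thesis by linarith
qed

text \<open>For \<open>p \<noteq> q\<close> an edge with inner product \<open>q\<close> cannot be a
  leg, so it is the base of every facet that contains it.\<close>

lemma base_edge_unique:
  assumes "p \<noteq> q" and F: "F facet_of P" and G: "G facet_of P" and BC: "B F \<in> G" "C F \<in> G"
  shows "{B G, C G} = {B F, C F}"
proof -
  have "B F \<in> {A G, B G, C G}" "C F \<in> {A G, B G, C G}"
    using vertices_subset[OF F] vertex_in_facet[OF _ G] BC by auto
  moreover have "B F \<noteq> C F" by (rule distinct_vertices[OF F])
  moreover have "B F \<noteq> A G"
  proof
    assume "B F = A G"
    then have "C F = B G \<or> C F = C G" using calculation by auto
    then show False using gram[OF F] gram[OF G] \<open>B F = A G\<close> assms(1) by auto
  qed
  moreover have "C F \<noteq> A G"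
  proof
    assume "C F = A G"
    then have "B F = B G \<or> B F = C G" using calculation by auto
    then show False using gram[OF F] gram[OF G] \<open>C F = A G\<close> assms(1) by (auto simp: inner_commute)
  qed
  ultimately show ?thesis by auto
qed

text \<open>The facets with \<open>v\<close> on their base fall into pairs sharing that base
  edge.\<close>

lemma even_base_count:
  assumes "p \<noteq> q"
  shows "even (base_count v)"
proof -
  let ?M = "{F \<in> \<F>. B F = v \<or> C F = v}" and ?e = "\<lambda>F. {B F, C F}"
  have "?M = {F \<in> \<F>. B F = v} \<union> {F \<in> \<F>. C F = v}" by auto
  moreover have "{F \<in> \<F>. B F = v} \<inter> {F \<in> \<F>. C F = v} = {}"
    by (auto simp: distinct_vertices(3)[THEN not_sym])
  ultimately have "base_count v = card ?M"
    unfolding base_count_def using finite_facets by (simp add: card_Un_disjoint)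
  moreover have "even (card ?M)"
  proof (rule even_card_if_fibres_2[where f = ?e])
    fix F assume F: "F \<in> ?M"
    have "{G \<in> ?M. ?e G = ?e F} = {G \<in> \<F>. B F \<in> G \<and> C F \<in> G}"
    proof (intro equalityI subsetI)
      fix G assume "G \<in> {G \<in> ?M. ?e G = ?e F}"
      then have G: "G facet_of P" "?e G = ?e F" by auto
      then have "?e F \<subseteq> G" using vert[OF G(1)] by blast
      then show "G \<in> {G \<in> \<F>. B F \<in> G \<and> C F \<in> G}" using G by auto
    next
      fix G assume "G \<in> {G \<in> \<F>. B F \<in> G \<and> C F \<in> G}"
      then have G: "G facet_of P" "B F \<in> G" "C F \<in> G" by auto
      then have e: "?e G = ?e F" using base_edge_unique[OF assms] F by blast
      have "v \<in> ?e G" using F unfolding e by auto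
      then have "B G = v \<or> C G = v" by blast
      then show "G \<in> {G \<in> ?M. ?e G = ?e F}" using G(1) e by blast
    qed
    then show "card {G \<in> ?M. ?e G = ?e F} = 2" using base_edge_in_two_facets F by simp
  qed (use finite_facets in simp)
  ultimately show ?thesis by simp
qed

end

section \<open>Surface area\<close>

text \<open>The threshold 1/5 is exactly what ten facets require, as 100 times
  \<open>4 - (6/5)\<^sup>2\<close> is 256. Five times the angle is a full turn, so the cosines of
  its double and triple agree; removing the root 1 leaves \<open>4 * c\<^sup>2 + 2 * c = 1\<close>,
  which rules out small positive \<open>c\<close>.\<close>

lemma cos_two_fifths_pi_gt: "cos (2 * pi / 5) > (1/5 :: real)"
proof -
  define x :: real where "x = 2 * pi / 5"
  define c where "c = cos x"
  have "cos (2 * x) = cos (3 * x)"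
  proof -
    have "3 * x = 2 * pi - 2 * x" by (simp add: x_def)
    then have "cos (3 * x) = cos (2 * pi - 2 * x)" by (simp only:)
    then show ?thesis by simp
  qed
  then have "2 * c\<^sup>2 - 1 = 4 * c ^ 3 - 3 * c"
    by (simp add: cos_double_cos cos_treble_cos c_def)
  then have "(c - 1) * (4 * c\<^sup>2 + 2 * c - 1) = 0"
    by (simp add: algebra_simps power2_eq_square power3_eq_cube)
  moreover have "c > 0" unfolding c_def x_def by (rule cos_gt_zero) (use pi_gt_zero in simp_all)
  moreover have "c < 1" unfolding c_def
    using cos_monotone_0_pi[of 0 x] pi_gt_zero by (simp add: x_def)
  ultimately have e: "4 * c\<^sup>2 + 2 * c = 1" by simp
  have "c > 1/5"
  proof (rule ccontr)
    assume "\<not> c > 1/5"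
    then have "c \<le> 1/5" by simp
    moreover from this have "c\<^sup>2 \<le> (1/5)\<^sup>2" using \<open>c > 0\<close> by (intro power_mono) auto
    ultimately show False using e by (simp add: power2_eq_square)
  qed
  then show ?thesis by (simp add: c_def x_def)
qed

section \<open>Areas of triangles in space through planar charts\<close>

lemma dist_preserving_frame:
  fixes o' u w :: "real^3"
  assumes "u \<bullet> u = 1" "w \<bullet> w = 1" "u \<bullet> w = 0"
  shows "dist_preserving (\<lambda>y::real^2. o' + y$1 *\<^sub>R u + y$2 *\<^sub>R w)"
  unfolding dist_preserving_def
proof (intro allI)
  fix x y :: "real^2"
  have d: "(o' + x$1 *\<^sub>R u + x$2 *\<^sub>R w) - (o' + y$1 *\<^sub>R u + y$2 *\<^sub>R w) =
      (x - y)$1 *\<^sub>R u + (x - y)$2 *\<^sub>R w"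
    by (simp add: algebra_simps)
  have "norm ((x - y)$1 *\<^sub>R u + (x - y)$2 *\<^sub>R w) = norm (x - y)"
    unfolding norm_eq using assms
    by (simp add: inner_add_left inner_add_right inner_commute[of w u] inner_vec_def[of "x - y"] sum_2)
  then show "dist (o' + x$1 *\<^sub>R u + x$2 *\<^sub>R w) (o' + y$1 *\<^sub>R u + y$2 *\<^sub>R w) = dist x y"
    unfolding dist_norm d .
qed

lemma dist_preserving_inj: "dist_preserving f \<Longrightarrow> inj f"
  unfolding dist_preserving_def inj_def by (metis dist_eq_0_iff)

lemma dist_preserving_convex_hull:
  fixes f :: "'a::euclidean_space \<Rightarrow> 'b::euclidean_space"
  assumes "dist_preserving f"
  shows "f ` (convex hull S) = convex hull (f ` S)"
proof -
  define l where "l x = f x - f 0" for x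
  have "linear l" unfolding l_def by (rule dist_preserving_linear[OF assms])
  then have "l ` (convex hull S) = convex hull (l ` S)" by (rule convex_hull_linear_image)
  moreover have "f ` X = (+) (f 0) ` (l ` X)" for X by (simp add: image_image l_def)
  ultimately show ?thesis by (simp add: convex_hull_translation)
qed

lemma planar_area_dist_preserving_image:
  fixes f :: "real^2 \<Rightarrow> real^3"
  assumes "dist_preserving f"
  shows "planar_area (f ` S) = measure lebesgue S"
  using planar_area_eq[OF assms, of "f ` S"] dist_preserving_inj[OF assms]
  by (simp add: inj_vimage_image_eq image_mono)

text \<open>The chart has its origin at the midpoint of the base and its axes along base and height,
  which are perpendicular because the legs are equal. The area is half base times height,
  \<open>norm e * norm h\<close>, and both squared norms are read off from the Gram matrix.\<close>

lemma planar_area_isosceles: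
  fixes a b c :: "real^3"
  assumes g: "a \<bullet> a = 1" "b \<bullet> b = 1" "c \<bullet> c = 1" "a \<bullet> b = p" "a \<bullet> c = p" "b \<bullet> c = q"
    and ind: "lin_indep3 a b c"
  shows "planar_area (convex hull {a, b, c}) = sqrt ((1 - q) * (3 - 4 * p + q)) / 2"
proof -
  define m where "m = (1/2) *\<^sub>R b + (1/2) *\<^sub>R c"
  define e where "e = (1/2) *\<^sub>R c - (1/2) *\<^sub>R b"
  define h where "h = a - m"
  have g': "b \<bullet> a = p" "c \<bullet> a = p" "c \<bullet> b = q" using g by (simp_all add: inner_commute)
  have ee: "e \<bullet> e = (1 - q) / 2" and hh: "h \<bullet> h = (3 - 4 * p + q) / 2" and eh: "e \<bullet> h = 0"
    using g g' by (simp_all add: e_def h_def m_def inner_diff_left inner_diff_right inner_add_left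
        inner_add_right field_simps)
  have "0 *\<^sub>R a + (-1/2) *\<^sub>R b + (1/2) *\<^sub>R c = e" by (simp add: e_def)
  then have e0: "e \<noteq> 0" using ind unfolding lin_indep3_def by (metis zero_neq_one divide_eq_0_iff zero_neq_numeral)
  have "1 *\<^sub>R a + (-1/2) *\<^sub>R b + (-1/2) *\<^sub>R c = h" by (simp add: h_def m_def)
  then have h0: "h \<noteq> 0" using ind unfolding lin_indep3_def by (metis zero_neq_one)
  define u where "u = (1 / norm e) *\<^sub>R e"
  define w where "w = (1 / norm h) *\<^sub>R h"
  define f where "f = (\<lambda>y::real^2. m + y$1 *\<^sub>R u + y$2 *\<^sub>R w)"
  have f: "dist_preserving f" unfolding f_def
    by (rule dist_preserving_frame) (use e0 h0 eh in \<open>simp_all add: u_def w_def flip: power2_norm_eq_inner add: power2_eq_square\<close>)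
  define A' B' C' :: "real^2" where "A' = vector [0, norm h]" and "B' = vector [- norm e, 0]"
    and "C' = vector [norm e, 0]"
  have v2: "(vector [x, y] :: real^2) $ 1 = x" "(vector [x, y] :: real^2) $ 2 = y" for x y
    by (simp_all add: vector_2)
  have "f A' = a" "f B' = b" "f C' = c"
    using e0 h0 by (simp_all add: f_def A'_def B'_def C'_def v2 u_def w_def)
      (simp_all add: h_def m_def e_def flip: scaleR_add_left)
  then have "convex hull {a, b, c} = f ` (convex hull {A', B', C'})"
    using dist_preserving_convex_hull[OF f] by simp
  then have "planar_area (convex hull {a, b, c}) = measure lebesgue (convex hull {A', B', C'})"
    using planar_area_dist_preserving_image[OF f] by simp
  also have "\<dots> = measure lborel (convex hull {A', B', C'})"
    by (rule measure_completion) (auto intro!: borel_compact finite_imp_compact_convex_hull)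
  also have "\<dots> = norm e * norm h"
    by (simp add: content_triangle A'_def B'_def C'_def v2 abs_mult)
  also have "\<dots> = sqrt ((e \<bullet> e) * (h \<bullet> h))" by (simp add: norm_eq_sqrt_inner real_sqrt_mult)
  also have "\<dots> = sqrt (((1 - q) * (3 - 4 * p + q)) / 2\<^sup>2)" unfolding ee hh by (simp add: power2_eq_square)
  also have "\<dots> = sqrt ((1 - q) * (3 - 4 * p + q)) / 2" by (simp add: real_sqrt_divide)
  finally show ?thesis .
qed

section \<open>The surviving triangles and their area\<close>

context isosceles_polytope
begin

text \<open>For these values two facets meeting at a base edge are the halves of a square.\<close>

lemma not_cube: "\<not> (p = 1/3 \<and> q = - 1/3)"
proof
  assume pq: "p = 1/3 \<and> q = - 1/3"
  then have ne: "p \<noteq> q" by simp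
  obtain F where F: "F facet_of P" using facet_exists by blast
  let ?S = "{G \<in> \<F>. B F \<in> G \<and> C F \<in> G}"
  have FS: "F \<in> ?S" using F vert[OF F] by blast
  have "\<not> ?S \<subseteq> {F}"
  proof
    assume "?S \<subseteq> {F}"
    then have "card ?S \<le> card {F}" by (intro card_mono) auto
    then show False using base_edge_in_two_facets[OF F] by simp
  qed
  then obtain G where G: "G facet_of P" "B F \<in> G" "C F \<in> G" "G \<noteq> F" by blast
  have e: "{B G, C G} = {B F, C F}" by (rule base_edge_unique[OF ne F G(1-3)])
  define a b c a' where "a = A F" and "b = B F" and "c = C F" and "a' = A G"
  have g: "a \<bullet> a = 1" "b \<bullet> b = 1" "c \<bullet> c = 1" "a' \<bullet> a' = 1" "a \<bullet> b = 1/3" "a \<bullet> c = 1/3" "b \<bullet> c = - 1/3"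
    using unit gram F G(1) pq by (simp_all add: a_def b_def c_def a'_def)
  have g2: "a' \<bullet> b = 1/3" "a' \<bullet> c = 1/3"
    using e gram[OF G(1)] pq by (auto simp: a'_def b_def c_def doubleton_eq_iff)
  \<comment> \<open>\<open>u\<close> and \<open>u'\<close> are the heights of the two triangles over
    the common base. Because \<open>2 * p = 1 + q\<close> they are orthogonal to both
    \<open>b\<close> and \<open>c\<close>, hence parallel, and equal length leaves only
    \<open>u' = u\<close> and \<open>u' = - u\<close>.\<close>
  define u where "u = a - (1/2) *\<^sub>R b - (1/2) *\<^sub>R c"
  define u' where "u' = a' - (1/2) *\<^sub>R b - (1/2) *\<^sub>R c"
  have g': "b \<bullet> a = 1/3" "c \<bullet> a = 1/3" "c \<bullet> b = - 1/3" "b \<bullet> a' = 1/3" "c \<bullet> a' = 1/3"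
    using g g2 by (simp_all add: inner_commute)
  have ub: "u \<bullet> b = 0" "u \<bullet> c = 0" "u' \<bullet> b = 0" "u' \<bullet> c = 0" "u \<bullet> u = 2/3" "u' \<bullet> u' = 2/3"
    using g g2 g' by (simp_all add: u_def u'_def inner_diff_left inner_diff_right)
  have ind: "lin_indep3 a b c" unfolding a_def b_def c_def by (rule indep[OF F])
  have D: "DIM(real^3) = 3" by simp
  obtain r s t where "u' = r *\<^sub>R a + s *\<^sub>R b + t *\<^sub>R c" by (rule lin_indep3E[OF ind D])
  then have u': "u' = r *\<^sub>R u + (s + r/2) *\<^sub>R b + (t + r/2) *\<^sub>R c" by (simp add: u_def algebra_simps)
  define x y where "x = s + r/2" and "y = t + r/2"
  have u'2: "u' = r *\<^sub>R u + x *\<^sub>R b + y *\<^sub>R c" using u' by (simp add: x_def y_def)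
  have "u' \<bullet> b = x - y/3" "u' \<bullet> c = y - x/3"
    unfolding u'2 using ub g g' by (simp_all add: inner_add_left)
  then have "x = y/3" "y = x/3" using ub by simp_all
  then have "x = 0" "y = 0" by simp_all
  then have ur: "u' = r *\<^sub>R u" using u'2 by simp
  then have "u' \<bullet> u' = r * r * (u \<bullet> u)" by simp
  then have "r * r * (2/3) = 2/3" unfolding ub(5,6) by (rule sym)
  then have "r\<^sup>2 = 1" by (simp add: power2_eq_square)
  then have "r = 1 \<or> r = - 1" by (simp add: power2_eq_1_iff)
  then have "a' \<in> affine hull F"
  proof
    assume "r = 1"
    then have "a' = a" using ur by (simp add: u_def u'_def)
    then show ?thesis using vert[OF F] by (auto simp: a_def intro: hull_inc)
  next
    \<comment> \<open>Now \<open>a' = b + c - a\<close> is the fourth corner of the square, still an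
      affine combination of \<open>a\<close>, \<open>b\<close>, \<open>c\<close>.\<close>
    assume "r = - 1"
    have "a' = u' + (1/2) *\<^sub>R b + (1/2) *\<^sub>R c" by (simp add: u'_def)
    have "u' = - u" using ur \<open>r = - 1\<close> by simp
    have "- u + x + y = - a + (x + x) + (y + y)" if "x = (1/2) *\<^sub>R b" "y = (1/2) *\<^sub>R c" for x y
      unfolding u_def that[symmetric] by (simp add: algebra_simps)
    from this[OF refl refl]
    have "- u + (1/2) *\<^sub>R b + (1/2) *\<^sub>R c = (-1) *\<^sub>R a + 1 *\<^sub>R b + 1 *\<^sub>R c"
      by (simp flip: scaleR_add_left)
    with \<open>u' = - u\<close> \<open>a' = u' + (1/2) *\<^sub>R b + (1/2) *\<^sub>R c\<close>
    have "a' = (-1) *\<^sub>R a + 1 *\<^sub>R b + 1 *\<^sub>R c" by simp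
    moreover have "(-1) *\<^sub>R a + 1 *\<^sub>R b + 1 *\<^sub>R c \<in> affine hull {a, b, c}"
      unfolding affine_hull_3 by (intro CollectI exI[of _ "-1"] exI[of _ 1] conjI) auto
    ultimately show ?thesis unfolding affine_hull_facet[OF F] by (simp add: a_def b_def c_def)
  qed
  moreover have "b \<in> affine hull F" "c \<in> affine hull F" using vert[OF F] by (auto simp: b_def c_def intro: hull_inc)
  moreover have "G = convex hull {a', b, c}"
    using hull[OF G(1)] e unfolding a'_def b_def c_def by simp
  ultimately have "G \<subseteq> affine hull F"
    using hull_minimal[of "{a', b, c}" "affine hull F" convex] affine_imp_convex by auto
  then have sub: "G \<subseteq> F"
    using face_of_imp_eq_affine_Int[OF polytope_imp_convex[OF polytope] facet_of_imp_face_of[OF F]]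
      facet_of_imp_subset[OF G(1)] by blast
  have cF: "convex F" by (rule convex_facet[OF polytope_imp_convex[OF polytope] F])
  have "G face_of F"
    using face_of_subset[OF facet_of_imp_face_of[OF G(1)] sub facet_of_imp_subset[OF F]] .
  then have "aff_dim G < aff_dim F" using face_of_aff_dim_lt[OF cF] G(4) by blast
  then show False using F G(1) by (simp add: facet_of_def)
qed

lemma gram_bounds: "q < 1" "q > - 1" "p < 1" "p > - 1"
  using gram_pos(1,2) abs_square_less_1[of p] abs_square_less_1[of q] by (auto simp: abs_less_iff)

text \<open>The cosine formulas turn angles into \<open>p\<close> and \<open>q\<close>:
  \<open>\<beta> = 1/4\<close> means \<open>p = 0\<close>, so legs are quarter circles, and then
  \<open>\<alpha> = 2 / real N\<close> gives \<open>q = cos (4 * pi / real N)\<close>. The cases are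
  split by what the area bound asks for: up to 8 facets \<open>p = 0\<close> is enough, for 10 and
  12 the base matters.\<close>

lemma dichotomy:
  assumes n: "card (vertices P) \<le> 8"
  defines "N \<equiv> card \<F>"
  shows "N = 4 \<or> p = 0 \<and> (N \<le> 8 \<or> N = 10 \<and> q > 1/5 \<or> N = 12 \<and> q = 1/2)"
proof (cases "p = q")
  case True
  have ab: "\<alpha> = \<beta>" unfolding \<alpha>_def \<beta>_def using True by (simp add: power2_eq_square)
  have "card (vertices P) \<noteq> 0" using card_facets by linarith
  then obtain v where v: "v \<in> vertices P" by fastforce
  have "N = 4 \<or> N = 8 \<and> \<alpha> = 1/4"
  proof (rule counting_equilateral)
    show "real (apex_count v + base_count v) * \<alpha> = 1" using vertex_sum[OF v] ab by (simp add: algebra_simps)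
    show "3 * \<alpha> = 2 / real N + 1/2" using angle_sum ab by (simp add: N_def)
  qed (use card_facets n angle_bounds in \<open>auto simp: N_def\<close>)
  then show ?thesis
  proof
    \<comment> \<open>The regular octahedron, which joins the bipyramids through
      \<open>p = 0\<close>.\<close>
    assume N: "N = 8 \<and> \<alpha> = 1/4"
    have "2 * pi * \<alpha> = pi / 2" using N by simp
    then have "cos (2 * pi * \<alpha>) = 0" by (simp only: cos_pi_half)
    then have "q - p\<^sup>2 = 0" using cos_angles(1) by (simp only: mult_zero_left)
    then have "p * (1 - p) = 0" using True by (simp add: power2_eq_square algebra_simps)
    then have "p = 0" using gram_bounds(3) by simp
    then show ?thesis using N by simp
  qed simp
next
  case False
  define l where "l v = base_count v div 2" for v
  have l2: "base_count v = 2 * l v" for v using even_base_count[OF False, of v] by (simp add: l_def)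
  have "2 * sum l (vertices P) = 2 * N" using sum_base_count by (simp add: l2 sum_distrib_left N_def)
  then have "N = 4 \<or> 2 * \<beta> = 1/2 \<and> \<alpha> = 2 / real N \<or> N = 12 \<and> \<alpha> = 1/3 \<and> 2 * \<beta> = 1/3"
    using card_facets n angle_bounds angle_sum vertex_sum sum_apex_count finite_vertices
    by (intro counting_isosceles[of "vertices P" N \<alpha> "2 * \<beta>" apex_count l]) (auto simp: l2 N_def mult_ac)
  then show ?thesis
  proof (elim disjE conjE)
    assume \<beta>: "2 * \<beta> = 1/2" and \<alpha>: "\<alpha> = 2 / real N"
    have "2 * pi * \<beta> = pi / 2" using \<beta> by simp
    then have "cos (2 * pi * \<beta>) = 0" by (simp only: cos_pi_half)
    then have "p - p * q = 0" using cos_angles(2) by (simp only: mult_zero_left)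
    then have "p * (1 - q) = 0" by (simp add: algebra_simps)
    then have p: "p = 0" using gram_bounds by simp
    have "2 * pi * \<alpha> = 4 * pi / real N" by (simp add: \<alpha>)
    then have q: "cos (4 * pi / real N) = q" using cos_angles(1) p by simp
    have "N \<le> 12" "even (N + 4)" using card_facets(1) n unfolding N_def by linarith (metis card_facets(1) dvd_triv_left)
    then consider "N \<le> 8" | "N = 10" | "N = 12" by fastforce
    then show ?thesis
    proof cases
      case 2
      then show ?thesis using q cos_two_fifths_pi_gt p by simp
    next
      case 3
      then show ?thesis using q cos_60 p by simp
    qed (use p in simp)
  next
    assume N: "N = 12" and \<alpha>: "\<alpha> = 1/3" and \<beta>: "2 * \<beta> = 1/3"
    have "2 * pi * \<alpha> = 2 * pi / 3" "2 * pi * \<beta> = pi / 3" using \<alpha> \<beta> by simp_all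
    then have cs: "cos (2 * pi * \<alpha>) = - 1/2" "cos (2 * pi * \<beta>) = 1/2" by (simp_all only: cos_120 cos_60)
    have q: "- (1/2) * (1 - p\<^sup>2) = q - p\<^sup>2" using cos_angles(1) unfolding cs by simp
    have pe: "1/2 * (sqrt (1 - p\<^sup>2) * sqrt (1 - q\<^sup>2)) = p * (1 - q)"
      using cos_angles(2) unfolding cs by (simp add: right_diff_distrib)
    \<comment> \<open>Squaring below loses the sign of \<open>p\<close>; positivity of this product
      keeps it.\<close>
    have "0 < 1/2 * (sqrt (1 - p\<^sup>2) * sqrt (1 - q\<^sup>2))" using gram_pos(1,2) by simp
    then have "0 < p * (1 - q)" using pe by simp
    then have p0: "p > 0" using gram_bounds(1) by (simp add: zero_less_mult_iff)
    have "(1/2 * (sqrt (1 - p\<^sup>2) * sqrt (1 - q\<^sup>2)))\<^sup>2 = (1 - p\<^sup>2) * (1 - q\<^sup>2) / 4"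
      using gram_pos(1,2) by (simp add: power_mult_distrib power_divide)
    then have sq: "(1 - p\<^sup>2) * (1 - q\<^sup>2) / 4 = p\<^sup>2 * (1 - q)\<^sup>2" unfolding pe by (simp add: power_mult_distrib)
    define P2 where "P2 = p\<^sup>2"
    have q': "q = (3 * P2 - 1) / 2" using q by (simp add: P2_def field_simps)
    \<comment> \<open>Eliminating \<open>q\<close> leaves a cubic in \<open>P2\<close> with the
      double root 1, excluded by \<open>gram_pos\<close>, and the root 1/9.\<close>
    have "(1 - P2) * (1 - q\<^sup>2) / 4 - P2 * (1 - q)\<^sup>2 = 3/16 * (1 - P2) * (1 - P2) * (1 - 9 * P2)"
      unfolding q' by (simp add: power2_eq_square field_simps)
    then have "3/16 * (1 - P2) * (1 - P2) * (1 - 9 * P2) = 0" using sq by (simp add: P2_def)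
    then have P2: "P2 = 1/9" using gram_pos(1) by (simp add: P2_def)
    then have "p\<^sup>2 = (1/3)\<^sup>2" by (simp add: P2_def power2_eq_square)
    then have "p = 1/3" using p0 by (simp add: power2_eq_iff)
    moreover have "q = - 1/3" using q' P2 by simp
    ultimately show ?thesis using not_cube by simp
  qed simp
qed

text \<open>\<open>X\<close> is four times the squared facet area, so the claim amounts to
  \<open>(real N)\<^sup>2 * X < 256\<close>. The bounds are 16 times 16 for \<open>N = 4\<close>, 64
  times 4 for \<open>N \<le> 8\<close>, 100 times \<open>4 - (6/5)\<^sup>2\<close> for
  \<open>N = 10\<close>, all strict, and the exact value 252 for \<open>N = 12\<close>.\<close>

lemma surface_area_less_8:
  assumes n: "card (vertices P) \<le> 8"
  shows "surface_area P < 8"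
proof -
  define N where "N = card \<F>"
  define X where "X = (1 - q) * (3 - 4 * p + q)"
  have bound: "(real N)\<^sup>2 * X < 256"
    using dichotomy[OF n] unfolding N_def[symmetric]
  proof (elim disjE conjE)
    assume "N = 4"
    have "X \<le> 4 * (1 - p)\<^sup>2"
    proof -
      \<comment> \<open>With \<open>x = 1 - p\<close> and \<open>y = 1 - q\<close>, \<open>X\<close>
        is \<open>y * (4 * x - y)\<close>, which is largest at \<open>y = 2 * x\<close>.\<close>
      have "0 \<le> (2 * (1 - p) - (1 - q))\<^sup>2" by simp
      then show ?thesis by (simp add: X_def power2_eq_square algebra_simps)
    qed
    also have "(1 - p)\<^sup>2 < 2\<^sup>2" using gram_bounds by (intro power_strict_mono) auto
    finally show ?thesis using \<open>N = 4\<close> by simp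
  next
    assume p: "p = 0" and "N \<le> 8"
    have "X = 4 - (1 + q)\<^sup>2" by (simp add: X_def p power2_eq_square algebra_simps)
    also have "\<dots> < 4" using gram_bounds by simp
    finally have "X < 4" .
    moreover have "(real N)\<^sup>2 \<le> 8\<^sup>2" using \<open>N \<le> 8\<close> by (intro power_mono) auto
    moreover have "N > 0" using card_facets(2) by (simp add: N_def)
    ultimately have "(real N)\<^sup>2 * X < (real N)\<^sup>2 * 4" "(real N)\<^sup>2 * 4 \<le> 256" by simp_all
    then show ?thesis by linarith
  next
    assume p: "p = 0" and "N = 10" and q: "1/5 < q"
    have "(6/5)\<^sup>2 < (1 + q)\<^sup>2" using q by (intro power_strict_mono) auto
    moreover have "X = 4 - (1 + q)\<^sup>2" by (simp add: X_def p power2_eq_square algebra_simps)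
    ultimately show ?thesis using \<open>N = 10\<close> by (simp add: power2_eq_square)
  next
    assume p: "p = 0" and "N = 12" and q: "q = 1/2"
    have "X = 7/4" unfolding X_def p q by simp
    then show ?thesis using \<open>N = 12\<close> by simp
  qed
  have "aff_dim P = 3" using aff_dim_nonempty_interior[OF interior] by simp
  then have "surface_area P = (\<Sum>F\<in>\<F>. planar_area F)" by (simp add: surface_area_def)
  also have "\<dots> = (\<Sum>F\<in>\<F>. sqrt X / 2)"
  proof (rule sum.cong[OF refl])
    fix F assume "F \<in> \<F>"
    then have F: "F facet_of P" by simp
    show "planar_area F = sqrt X / 2"
      using planar_area_isosceles[OF unit(1)[OF F] unit(2)[OF F] unit(3)[OF F] gram(1)[OF F] gram(2)[OF F]
          gram(3)[OF F] indep[OF F]] hull[OF F] by (simp add: X_def)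
  qed
  also have "\<dots> = real N * sqrt X / 2" by (simp add: N_def)
  also have "\<dots> = sqrt ((real N)\<^sup>2 * X) / 2" by (simp add: real_sqrt_mult)
  also have "\<dots> < sqrt (16\<^sup>2) / 2" using bound by (intro divide_strict_right_mono real_sqrt_less_mono) auto
  finally show ?thesis by simp
qed

end

section \<open>The cube as competitor\<close>

definition cube :: "real \<Rightarrow> (real^3) set" where
  "cube s = cbox (\<chi> i. - s) (\<chi> i. s)"

lemma mem_cube: "x \<in> cube s \<longleftrightarrow> (\<forall>i. - s \<le> x$i \<and> x$i \<le> s)"
  by (simp add: cube_def mem_box_cart)

lemma polytope_cube: "polytope (cube s)"
  unfolding cube_def by (rule polytope_interval)

lemma interior_cube:
  assumes "s > 0"
  shows "interior (cube s) \<noteq> {}"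
proof -
  have "(0::real^3) \<in> box (\<chi> i. - s) (\<chi> i. s)" using assms by (simp add: mem_box_cart)
  then show ?thesis by (auto simp: cube_def interior_cbox)
qed

text \<open>A coordinate strictly between \<open>- s\<close> and \<open>s\<close> can be moved both
  ways along its axis, so the point is the midpoint of a segment in the cube. The inclusion suffices
  to bound the number of vertices and to place them on the sphere.\<close>

lemma vertices_cube_subset: "vertices (cube s) \<subseteq> {x. \<forall>i. x$i = s \<or> x$i = - s}"
proof
  fix x assume "x \<in> vertices (cube s)"
  then have x: "x \<in> cube s" and ext: "\<And>a b. a \<in> cube s \<Longrightarrow> b \<in> cube s \<Longrightarrow> x \<notin> open_segment a b"
    by (auto simp: vertices_def extreme_point_of_def)
  have "x$i = s \<or> x$i = - s" for i
  proof (rule ccontr)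
    assume n: "\<not> (x$i = s \<or> x$i = - s)"
    define e where "e = min (s - x$i) (x$i + s)"
    have e: "e > 0" "x$i + e \<le> s" "- s \<le> x$i - e"
      using n x unfolding e_def mem_cube by (auto simp: less_le dest: spec[of _ i])
    have "x + e *\<^sub>R axis i 1 \<in> cube s" "x - e *\<^sub>R axis i 1 \<in> cube s"
      using x e unfolding mem_cube by (auto simp: axis_def dest: spec)
    moreover have "x \<in> open_segment (x - e *\<^sub>R axis i 1) (x + e *\<^sub>R axis i 1)"
    proof -
      have "x = (1 - 1/2) *\<^sub>R (x - e *\<^sub>R axis i 1) + (1/2) *\<^sub>R (x + e *\<^sub>R axis i 1)"
        by (simp add: algebra_simps flip: scaleR_add_left)
      moreover have "(x - e *\<^sub>R axis i 1) $ i \<noteq> (x + e *\<^sub>R axis i 1) $ i" using e by (simp add: axis_def)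
      then have "x - e *\<^sub>R axis i 1 \<noteq> x + e *\<^sub>R axis i 1" by metis
      ultimately show ?thesis unfolding in_segment by (intro conjI exI[of _ "1/2"]) auto
    qed
    ultimately show False using ext by blast
  qed
  then show "x \<in> {x. \<forall>i. x$i = s \<or> x$i = - s}" by blast
qed

lemma cube_inscribed:
  assumes s: "s\<^sup>2 = 1/3"
  shows "cube s \<in> inscribed_polytopes 8"
proof -
  let ?V = "{x::real^3. \<forall>i. x$i = s \<or> x$i = - s}"
  let ?f = "\<lambda>(a, b, c). vector [a, b, c] :: real^3"
  let ?S = "{s, - s} \<times> {s, - s} \<times> {s, - s}"
  have "?V \<subseteq> ?f ` ?S"
  proof
    fix x assume x: "x \<in> ?V"
    have "x = ?f (x$1, x$2, x$3)" by (simp add: vec_eq_iff forall_3 vector_3)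
    moreover have "(x$1, x$2, x$3) \<in> ?S"
      using x by (simp only: mem_Collect_eq mem_Times_iff fst_conv snd_conv insert_iff empty_iff) blast
    ultimately show "x \<in> ?f ` ?S" by (rule image_eqI)
  qed
  moreover have fin: "finite (?f ` ?S)" by simp
  ultimately have "card (vertices (cube s)) \<le> card (?f ` ?S)"
    using order_trans[OF vertices_cube_subset] by (intro card_mono)
  also have "\<dots> \<le> card ?S" by (intro card_image_le) simp
  also have "\<dots> \<le> 8" by (cases "s = - s") (auto simp: card_cartesian_product)
  finally have "card (vertices (cube s)) \<le> 8" .
  moreover have "?V \<subseteq> sphere 0 1"
  proof
    fix x assume x: "x \<in> ?V"
    have sq: "x$i * x$i = 1/3" for i using x s by (auto simp: power2_eq_square dest: spec[of _ i])
    have "x \<bullet> x = x$1 * x$1 + x$2 * x$2 + x$3 * x$3" by (simp add: inner_vec_def sum_3)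
    then have "x \<bullet> x = 1" unfolding sq by simp
    then show "x \<in> sphere 0 1" by (simp add: norm_eq_1)
  qed
  ultimately show ?thesis
    using polytope_cube vertices_cube_subset unfolding inscribed_polytopes_def by blast
qed

text \<open>\<open>i\<close>, \<open>j\<close>, \<open>k\<close> is any ordering of the axes and
  \<open>t\<close> has either sign, so one argument serves all six faces. The chart \<open>f\<close>
  carries a planar square onto the face and yields both its area and its dimension.\<close>

lemma cube_face:
  fixes i j k :: 3
  assumes s: "s > 0" and ijk: "i \<noteq> j" "i \<noteq> k" "j \<noteq> k" and t: "t = s \<or> t = - s"
  shows "{x \<in> cube s. x$i = t} facet_of cube s" "planar_area {x \<in> cube s. x$i = t} = (2 * s)\<^sup>2"
proof -
  let ?F = "{x \<in> cube s. x$i = t}"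
  define f where "f = (\<lambda>y::real^2. t *\<^sub>R axis i 1 + y$1 *\<^sub>R axis j 1 + y$2 *\<^sub>R (axis k 1 :: real^3))"
  have "card {i, j, k} = card (UNIV :: 3 set)" using ijk by simp
  then have U: "{i, j, k} = UNIV" by (intro card_subset_eq) auto
  have all: "(\<forall>l. Q l) \<longleftrightarrow> Q i \<and> Q j \<and> Q k" for Q :: "3 \<Rightarrow> bool"
    using U by (metis UNIV_I insertE empty_iff)
  have fn: "f y $ i = t" "f y $ j = y$1" "f y $ k = y$2" for y
    using ijk by (simp_all add: f_def axis_def)
  have f: "dist_preserving f" unfolding f_def
    by (rule dist_preserving_frame) (use ijk in \<open>simp_all add: inner_axis_axis\<close>)
  let ?S = "cbox (\<chi> i. - s) (\<chi> i. s) :: (real^2) set"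
  have F: "?F = f ` ?S"
  proof (intro equalityI subsetI)
    fix x assume x: "x \<in> ?F"
    define y :: "real^2" where "y = vector [x$j, x$k]"
    have y: "y$1 = x$j" "y$2 = x$k" by (simp_all add: y_def vector_2)
    have "f y = x" using x by (simp add: vec_eq_iff all fn y)
    moreover have "y \<in> ?S" using x by (simp add: mem_box_cart forall_2 y mem_cube)
    ultimately show "x \<in> f ` ?S" by blast
  next
    fix x assume "x \<in> f ` ?S"
    then obtain y where "y \<in> ?S" "x = f y" by blast
    then show "x \<in> ?F" using t s by (auto simp: mem_cube all fn mem_box_cart forall_2)
  qed
  have "planar_area ?F = measure lebesgue ?S" unfolding F by (rule planar_area_dist_preserving_image[OF f])
  also have "\<dots> = measure lborel ?S" by (rule measure_completion) simp
  also have "\<dots> = (2 * s)\<^sup>2"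
    using s by (subst content_cbox_cart) (simp_all add: interval_eq_empty_cart prod_2 power2_eq_square)
  finally show "planar_area ?F = (2 * s)\<^sup>2" .
  have aff: "aff_dim ?F = 2"
  proof -
    define l where "l x = f x - f 0" for x
    have lin: "linear l" unfolding l_def by (rule dist_preserving_linear[OF f])
    have inj: "inj l" using dist_preserving_inj[OF f] by (simp add: l_def inj_def)
    have "f ` ?S = (+) (f 0) ` (l ` ?S)" by (simp add: image_image l_def)
    then have "aff_dim ?F = aff_dim ?S"
      unfolding F using aff_dim_translation_eq aff_dim_injective_linear_image[OF lin inj] by metis
    moreover have "interior ?S \<noteq> {}"
    proof -
      have "(0::real^2) \<in> interior ?S" using s by (simp add: interior_cbox mem_box_cart)
      then show ?thesis by blast
    qed
    then have "aff_dim ?S = 2" by (simp add: aff_dim_nonempty_interior)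
    ultimately show ?thesis by simp
  qed
  have conv: "convex (cube s)" by (simp add: cube_def)
  have "?F face_of cube s"
  proof (cases "t = s")
    case True
    then have "?F = cube s \<inter> {x. axis i 1 \<bullet> x = s}" by (auto simp: inner_axis')
    moreover have "cube s \<inter> {x. axis i 1 \<bullet> x = s} face_of cube s"
      by (rule face_of_Int_supporting_hyperplane_le[OF conv]) (simp add: mem_cube inner_axis')
    ultimately show ?thesis by simp
  next
    case False
    then have "?F = cube s \<inter> {x. axis i 1 \<bullet> x = - s}" using t by (auto simp: inner_axis')
    moreover have "cube s \<inter> {x. axis i 1 \<bullet> x = - s} face_of cube s"
      by (rule face_of_Int_supporting_hyperplane_ge[OF conv]) (simp add: mem_cube inner_axis')
    ultimately show ?thesis by simp
  qed
  moreover have "aff_dim (cube s) = 3" using aff_dim_nonempty_interior[OF interior_cube[OF s]] by simp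
  moreover have "?F \<noteq> {}" using aff by (metis aff_dim_empty numeral_neq_neg_one)
  ultimately show "?F facet_of cube s" using aff by (simp add: facet_of_def)
qed

text \<open>Six distinct facets of area \<open>(2 * s)\<^sup>2\<close> are exhibited and all areas
  are nonnegative; a lower bound is what the comparison uses.\<close>

lemma surface_area_cube:
  assumes s: "s > 0"
  shows "24 * s\<^sup>2 \<le> surface_area (cube s)"
proof -
  let ?I = "(UNIV :: 3 set) \<times> {s, - s}"
  let ?F = "\<lambda>(i, t). {x \<in> cube s. x$i = t}"
  have facet: "?F z facet_of cube s \<and> planar_area (?F z) = (2 * s)\<^sup>2" if "z \<in> ?I" for z
  proof -
    obtain i t where z: "z = (i, t)" "t = s \<or> t = - s" using \<open>z \<in> ?I\<close> by auto
    obtain j k :: 3 where "i \<noteq> j" "i \<noteq> k" "j \<noteq> k"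
    proof -
      have "i = 1 \<or> i = 2 \<or> i = 3" by (rule exhaust_3)
      then show ?thesis using that[of 2 3] that[of 1 3] that[of 1 2] by auto
    qed
    then show ?thesis using cube_face[OF s _ _ _ z(2)] z(1) by auto
  qed
  have inj: "inj_on ?F ?I"
  proof (rule inj_onI)
    fix z z' assume z: "z \<in> ?I" "z' \<in> ?I" "?F z = ?F z'"
    obtain i t i' t' where zz: "z = (i, t)" "z' = (i', t')" by (metis surj_pair)
    \<comment> \<open>The centre of a face has a single nonzero coordinate and identifies the
      face.\<close>
    have "t *\<^sub>R axis i 1 \<in> ?F z" using z(1) s by (auto simp: zz mem_cube axis_def)
    then have "(t *\<^sub>R axis i 1 :: real^3) $ i' = t'" unfolding z(3) by (simp add: zz)
    moreover have "t' \<noteq> 0" using z(2) s by (auto simp: zz)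
    ultimately show "z = z'" by (auto simp: zz axis_def split: if_splits)
  qed
  have "card ?I = 6" using s by (simp add: card_cartesian_product)
  then have "24 * s\<^sup>2 = (\<Sum>z\<in>?I. planar_area (?F z))"
    using facet by (simp add: power_mult_distrib)
  also have "\<dots> = (\<Sum>F\<in>?F ` ?I. planar_area F)" by (simp add: sum.reindex[OF inj] o_def)
  also have "\<dots> \<le> (\<Sum>F\<in>{F. F facet_of cube s}. planar_area F)"
  proof (rule sum_mono2)
    show "finite {F. F facet_of cube s}" by (rule finite_polytope_facets[OF polytope_cube])
    show "?F ` ?I \<subseteq> {F. F facet_of cube s}" using facet by blast
    show "0 \<le> planar_area F" for F by (simp add: planar_area_def)
  qed
  also have "\<dots> = surface_area (cube s)"
    using aff_dim_nonempty_interior[OF interior_cube[OF s]] by (simp add: surface_area_def)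
  finally show ?thesis .
qed

text \<open>One facet is labelled with its apex first, and congruences from it carry the labels to
  all others. Distances then agree, and for unit vectors they determine the inner products. An
  equilateral triangle is read as an isosceles one.\<close>

lemma monohedral_isosceles_polytope:
  fixes P :: "(real^3) set"
  assumes P: "P \<in> monohedral_isosceles n" and int: "interior P \<noteq> {}"
  obtains A B C p q where "isosceles_polytope P A B C p q"
proof -
  have poly: "polytope P" and sph: "vertices P \<subseteq> sphere 0 1"
    and cong: "\<And>F G. F facet_of P \<Longrightarrow> G facet_of P \<Longrightarrow> congruent_sets F G"
    using P by (auto simp: monohedral_isosceles_def inscribed_polytopes_def)
  have iso: "isosceles_triangle F" if "F facet_of P" for F
  proof -
    have "isosceles_triangle F \<or> equilateral_triangle F"
      using P that by (auto simp: monohedral_isosceles_def)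
    then show ?thesis unfolding isosceles_triangle_def equilateral_triangle_def by blast
  qed
  have dimP: "aff_dim P = 3" using aff_dim_nonempty_interior[OF int] by simp
  obtain F0 where F0: "F0 facet_of P" using polytope_facet_exists[OF poly] dimP by auto
  obtain a b c where abc: "F0 = convex hull {a, b, c}" "dist a b = dist a c"
    using iso[OF F0] unfolding isosceles_triangle_def by blast
  have "\<exists>f. dist_preserving f \<and> f ` F0 = F" if "F facet_of P" for F
    using cong[OF F0 that] unfolding congruent_sets_def by blast
  then obtain f where f: "\<And>F. F facet_of P \<Longrightarrow> dist_preserving (f F)" "\<And>F. F facet_of P \<Longrightarrow> f F ` F0 = F"
    by metis
  have hull: "F = convex hull {f F a, f F b, f F c}" if "F facet_of P" for F
    using dist_preserving_convex_hull[OF f(1)[OF that], of "{a, b, c}"] f(2)[OF that] abc(1) by simp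
  have vert: "{f F a, f F b, f F c} = vertices P \<inter> F" if F: "F facet_of P" for F
  proof -
    have ext: "v extreme_point_of F \<longleftrightarrow> v \<in> vertices P \<inter> F" for v
      using extreme_point_of_face[OF facet_of_imp_face_of[OF F]] by (auto simp: vertices_def)
    have "aff_dim F = 2" using F dimP by (simp add: facet_of_def)
    then have d: "aff_dim {f F a, f F b, f F c} = 2" using hull[OF F] aff_dim_convex_hull by metis
    have "card {f F a, f F b, f F c} \<le> 3" by (simp add: card_insert_if)
    then have "int (card {f F a, f F b, f F c}) = aff_dim {f F a, f F b, f F c} + 1"
      using aff_dim_le_card[of "{f F a, f F b, f F c}"] d by simp
    \<comment> \<open>Affine independence makes the three corners the extreme points of the facet,
      hence vertices of \<open>P\<close> and points of the sphere.\<close>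
    then have "\<not> affine_dependent {f F a, f F b, f F c}"
      unfolding affine_independent_iff_card by (intro conjI finite.intros) linarith
    then have "v extreme_point_of F \<longleftrightarrow> v \<in> {f F a, f F b, f F c}" for v
      using extreme_point_of_convex_hull_affine_independent hull[OF F] by metis
    then show ?thesis using ext by blast
  qed
  have unit: "f F a \<bullet> f F a = 1 \<and> f F b \<bullet> f F b = 1 \<and> f F c \<bullet> f F c = 1" if "F facet_of P" for F
    using vert[OF that] sph by (auto simp flip: norm_eq_1)
  have dot: "x \<bullet> y = 1 - (dist x y)\<^sup>2 / 2" if "x \<bullet> x = 1" "y \<bullet> y = 1" for x y :: "real^3"
    using that by (simp add: dist_norm power2_norm_eq_inner inner_diff inner_commute field_simps)
  have dist: "dist (f F x) (f F y) = dist x y" if "F facet_of P" for F x y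
    using f(1)[OF that] by (simp add: dist_preserving_def)
  have "isosceles_polytope P (\<lambda>F. f F a) (\<lambda>F. f F b) (\<lambda>F. f F c) (1 - (dist a b)\<^sup>2 / 2) (1 - (dist b c)\<^sup>2 / 2)"
  proof
    fix F assume F: "F facet_of P"
    show "F = convex hull {f F a, f F b, f F c}" by (rule hull[OF F])
    show "{f F a, f F b, f F c} = vertices P \<inter> F" by (rule vert[OF F])
    show "f F a \<bullet> f F a = 1" "f F b \<bullet> f F b = 1" "f F c \<bullet> f F c = 1" using unit[OF F] by auto
    show "f F a \<bullet> f F b = 1 - (dist a b)\<^sup>2 / 2" "f F a \<bullet> f F c = 1 - (dist a b)\<^sup>2 / 2"
      "f F b \<bullet> f F c = 1 - (dist b c)\<^sup>2 / 2"
      using dot unit[OF F] dist[OF F] abc(2) by simp_all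
  qed (fact poly int)+
  then show ?thesis by (rule that)
qed

theorem corollary1p4:
  fixes P :: "(real^3) set"
  assumes "P \<in> inscribed_polytopes 8"
    and "\<forall>Q\<in>inscribed_polytopes 8. surface_area Q \<le> surface_area P"
  shows "P \<notin> monohedral_isosceles 8"
proof
  assume mono: "P \<in> monohedral_isosceles 8"
  \<comment> \<open>Three times \<open>s\<^sup>2\<close> is 1, which puts the corners of the cube on
    the sphere.\<close>
  define s :: real where "s = sqrt (1/3)"
  have s: "s > 0" "s\<^sup>2 = 1/3" by (simp_all add: s_def)
  have "8 \<le> surface_area (cube s)" using surface_area_cube[OF s(1)] s(2) by simp
  also have "\<dots> \<le> surface_area P" using assms(2) cube_inscribed[OF s(2)] by blast
  finally have big: "8 \<le> surface_area P" .
  have poly: "polytope P" and n: "card (vertices P) \<le> 8"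
    using assms(1) by (auto simp: inscribed_polytopes_def)
  \<comment> \<open>A nondegenerate triangle as facet forces dimension 3, so flat polygons, whose
    facets are segments, drop out.\<close>
  have dim: "aff_dim P = 3" if F: "F facet_of P" for F
  proof -
    have "isosceles_triangle F \<or> equilateral_triangle F"
      using mono F by (auto simp: monohedral_isosceles_def)
    then obtain a b c where "\<not> collinear {a, b, c}" "F = convex hull {a, b, c}"
      unfolding isosceles_triangle_def equilateral_triangle_def by blast
    then have "aff_dim F > 1" by (simp add: collinear_aff_dim aff_dim_convex_hull)
    then have "aff_dim P > 2" using F by (simp add: facet_of_def)
    moreover have "aff_dim P \<le> 3" using aff_dim_le_DIM[of P] by simp
    ultimately show ?thesis by simp
  qed
  show False
  proof (cases "\<exists>F. F facet_of P")
    case True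
    then have d3: "aff_dim P = 3" using dim by blast
    then have "affine hull P = UNIV" using aff_dim_eq_full[of P] by simp
    then have "rel_interior P = interior P" by (rule rel_interior_interior)
    moreover have "P \<noteq> {}" using d3 by auto
    ultimately have int: "interior P \<noteq> {}"
      using rel_interior_eq_empty[OF polytope_imp_convex[OF poly]] by simp
    obtain A B C p q where "isosceles_polytope P A B C p q"
      using monohedral_isosceles_polytope[OF mono int] by blast
    then have "surface_area P < 8" using isosceles_polytope.surface_area_less_8 n by blast
    then show False using big by simp
  next
    case False
    \<comment> \<open>Without facets the conditions on them hold vacuously, but then
      \<open>P\<close> is empty or a point and its area is an empty sum.\<close>
    then have "\<not> 0 < aff_dim P" using polytope_facet_exists[OF poly] by blast
    then have "surface_area P = 0" using False by (simp add: surface_area_def)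
    then show False using big by simp
  qed
qed

end
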